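(* Let $f:\mathbb{R}\to\mathbb{R}$ be continuous with $f(s)=0$ for $s\le 0$, and assume: (1) $f(0)=0$, $f(s)>0$ for $s>0$, and there exists $p\in(2,4)$ such that $0<\liminf_{s\to0^+}\frac{f(s)}{s^{p-1}}\le\limsup_{s\to0^+}\frac{f(s)}{s^{p-1}}<+\infty$; (2) there exists $\alpha_0>0$ such that $\lim_{s\to+\infty}f(s)e^{-\alpha s^2}=0$ for every $\alpha>\alpha_0$ and $\lim_{s\to+\infty}f(s)e^{-\alpha s^2}=+\infty$ for every $\alpha<\alpha_0$; (3) $\lim_{s\to+\infty}\frac{F(s)}{f(s)s}=0$. For $c\in(0,c_0)$ let $(\bar u_c,\bar\lambda_c)$ be a mountain pass type critical point of $I|_{S_{r,c}}$ with its multiplier, that is: $\bar u_c\in S_{r,c}$, $\bar u_c>0$, $\bar\lambda_c>0$, $-\Delta\bar u_c+\bar\lambda_c\bar u_c=f(\bar u_c)$ in $\mathbb{R}^2$, $I(\bar u_c)=M_c$, and $0<M_c<m_c+\frac{2\pi}{\alpha_0}$, where $M_c$ is the mountain pass level. Then, as $c\to0^+$, $$\|\nabla\bar u_c\|_2^2\to\frac{4\pi}{\alpha_0},\qquad \int_{\mathbb{R}^2}f(\bar u_c)\bar u_c\,dx\to\frac{4\pi}{\alpha_0},\qquad M_c\to\frac{2\pi}{\alpha_0}.$$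
   Context: $F(s)=\int_0^s f(\tau)\,d\tau$. $I:H^1(\mathbb{R}^2)\to\mathbb{R}$, $I(u)=\frac12\|\nabla u\|_2^2-\int_{\mathbb{R}^2}F(u)\,dx$. $S_c=\{u\in H^1(\mathbb{R}^2):\|u\|_2^2=c^2\}$; $H^1_r(\mathbb{R}^2)$ is the subspace of radial functions of $H^1(\mathbb{R}^2)$; $S_{r,c}=S_c\cap H^1_r(\mathbb{R}^2)$. The constants $c_0>0$ (sufficiently small), $\rho^*\in(0,4\pi/\alpha_0)$ and $\tau_0>0$ are fixed such that for all $c\in(0,c_0)$, with $V_c=\{u\in S_c:\|\nabla u\|_2^2<\rho^*\}$ and $\partial V_c=\{u\in S_c:\|\nabla u\|_2^2=\rho^*\}$, one has $m_c:=\inf_{V_c}I<0<\tau_0<\inf_{\partial V_c}I$; $m_c$ is attained by a positive radially symmetric decreasing $u_c\in V_c$ solving $-\Delta u_c+\lambda_cu_c=f(u_c)$ with some $\lambda_c>0$; and $u_c$ is a normalized ground state solution, meaning $I(u_c)=\min\{I(u):u\in S_c,\ (I|_{S_c})'(u)=0\}$. The mountain pass level is $$M_c=\inf_{\gamma\in\Gamma_c}\max_{t\in[0,\infty)}I(\gamma(t)),\quad \Gamma_c=\{\gamma\in C([0,\infty),S_{r,c}):\gamma(0)=u_c,\ \exists\,t_\gamma>0\text{ s.t. }I(\gamma(t))<2m_c\ \forall t\ge t_\gamma\}.$$ *)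

theory Defs
  imports "HOL-Analysis.Analysis"
begin

type_synonym plane = "real ^ 2"

text \<open>
  Elements of \<open>H\<^sup>1(\<real>\<^sup>2)\<close> are handled through Borel representatives. All notions below
  that are meant for classes depend on a representative only up to a Lebesgue null set,
  and every Lebesgue class of \<open>L\<^sup>2\<close> contains a Borel function.
\<close>

definition pderiv_at :: "2 \<Rightarrow> (plane \<Rightarrow> real) \<Rightarrow> plane \<Rightarrow> real" where
  "pderiv_at i \<phi> x = frechet_derivative \<phi> (at x) (axis i 1)"

primrec Ck :: "nat \<Rightarrow> (plane \<Rightarrow> real) \<Rightarrow> bool" where
  "Ck 0 \<phi> \<longleftrightarrow> continuous_on UNIV \<phi>"
| "Ck (Suc k) \<phi> \<longleftrightarrow> (\<forall>x. \<phi> differentiable (at x)) \<and> (\<forall>i. Ck k (pderiv_at i \<phi>))"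

definition test_function :: "(plane \<Rightarrow> real) \<Rightarrow> bool" where
  "test_function \<phi> \<longleftrightarrow> (\<forall>k. Ck k \<phi>) \<and> compact (closure {x. \<phi> x \<noteq> 0})"

definition L2 :: "(plane \<Rightarrow> 'b::euclidean_space) set" where
  "L2 = {u. u \<in> borel_measurable lborel \<and> integrable lborel (\<lambda>x. (norm (u x))\<^sup>2)}"

definition L2_sq :: "(plane \<Rightarrow> 'b::euclidean_space) \<Rightarrow> real" where
  "L2_sq u = (LINT x|lborel. (norm (u x))\<^sup>2)"

definition weak_gradient :: "(plane \<Rightarrow> real) \<Rightarrow> (plane \<Rightarrow> plane) \<Rightarrow> bool" where
  "weak_gradient u g \<longleftrightarrow>
     (\<forall>\<phi>. test_function \<phi> \<longrightarrow>
       (\<forall>i. (LINT x|lborel. u x * pderiv_at i \<phi> x) = - (LINT x|lborel. g x $ i * \<phi> x)))"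

definition H1 :: "(plane \<Rightarrow> real) set" where
  "H1 = {u \<in> L2. \<exists>g \<in> L2. weak_gradient u g}"

text \<open>For \<open>u \<in> H1\<close> the weak gradient is unique up to a null set; the choice is immaterial.\<close>

definition grad :: "(plane \<Rightarrow> real) \<Rightarrow> plane \<Rightarrow> plane" where
  "grad u = (SOME g. g \<in> L2 \<and> weak_gradient u g)"

definition H1_norm :: "(plane \<Rightarrow> real) \<Rightarrow> real" where
  "H1_norm u = sqrt (L2_sq u + L2_sq (grad u))"

definition radial :: "(plane \<Rightarrow> real) \<Rightarrow> bool" where
  "radial u \<longleftrightarrow> (\<exists>v. AE x in lborel. u x = v (norm x))"

definition radially_decreasing :: "(plane \<Rightarrow> real) \<Rightarrow> bool" where
  "radially_decreasing u \<longleftrightarrow> (\<exists>v. antimono_on {0<..} v \<and> (AE x in lborel. u x = v (norm x)))"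

definition H1r :: "(plane \<Rightarrow> real) set" where
  "H1r = {u \<in> H1. radial u}"

definition S :: "real \<Rightarrow> (plane \<Rightarrow> real) set" where
  "S c = {u \<in> H1. L2_sq u = c\<^sup>2}"

definition Sr :: "real \<Rightarrow> (plane \<Rightarrow> real) set" where
  "Sr c = S c \<inter> H1r"

definition primitive :: "(real \<Rightarrow> real) \<Rightarrow> real \<Rightarrow> real" where
  "primitive f s = (LBINT t=0..s. f t)"

text \<open>
  If \<open>f\<close> has at most exponential critical growth and \<open>f(s) = O(s)\<close> near 0, then \<open>F(u)\<close> is
  integrable and \<open>f(u)\<close> is in \<open>L\<^sup>2\<close> for each \<open>u \<in> H1\<close> by the Trudinger-Moser inequality, so
  the Bochner integrals in the next two definitions take no default values.
\<close>

definition energy :: "(real \<Rightarrow> real) \<Rightarrow> (plane \<Rightarrow> real) \<Rightarrow> real" where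
  "energy f u = 1 / 2 * L2_sq (grad u) - (LINT x|lborel. primitive f (u x))"

text \<open>Weak form of \<open>-\<Delta>u + lam u = f(u)\<close> in \<open>\<real>\<^sup>2\<close>.\<close>

definition weak_solution :: "(real \<Rightarrow> real) \<Rightarrow> real \<Rightarrow> (plane \<Rightarrow> real) \<Rightarrow> bool" where
  "weak_solution f lam u \<longleftrightarrow> u \<in> H1 \<and>
     (\<forall>\<phi> \<in> H1. (LINT x|lborel. grad u x \<bullet> grad \<phi> x) + lam * (LINT x|lborel. u x * \<phi> x)
              = (LINT x|lborel. f (u x) * \<phi> x))"

text \<open>
  The derivative of \<open>energy f\<close> restricted to \<open>S c\<close> vanishes at \<open>u\<close>: the derivative of
  \<open>energy f\<close> at \<open>u\<close> is zero on the tangent space \<open>{v \<in> H1. \<integral> u v = 0}\<close> of \<open>S c\<close> at \<open>u\<close>.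
\<close>

definition constrained_critical :: "(real \<Rightarrow> real) \<Rightarrow> real \<Rightarrow> (plane \<Rightarrow> real) \<Rightarrow> bool" where
  "constrained_critical f c u \<longleftrightarrow> u \<in> S c \<and>
     (\<forall>v \<in> H1. (LINT x|lborel. u x * v x) = 0 \<longrightarrow>
        ((\<lambda>t. energy f (\<lambda>x. u x + t * v x)) has_real_derivative 0) (at 0))"

definition normalized_ground_state :: "(real \<Rightarrow> real) \<Rightarrow> real \<Rightarrow> (plane \<Rightarrow> real) \<Rightarrow> bool" where
  "normalized_ground_state f c u \<longleftrightarrow> constrained_critical f c u \<and>
     (\<forall>v. constrained_critical f c v \<longrightarrow> energy f u \<le> energy f v)"

definition V :: "real \<Rightarrow> real \<Rightarrow> (plane \<Rightarrow> real) set" where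
  "V \<rho> c = {u \<in> S c. L2_sq (grad u) < \<rho>}"

definition bdV :: "real \<Rightarrow> real \<Rightarrow> (plane \<Rightarrow> real) set" where
  "bdV \<rho> c = {u \<in> S c. L2_sq (grad u) = \<rho>}"

text \<open>
  Infima and suprema of the energy are formed in \<open>ereal\<close>, so that they also have their usual
  meaning for empty or unbounded sets of values.
\<close>

definition inf_level :: "(real \<Rightarrow> real) \<Rightarrow> real \<Rightarrow> real \<Rightarrow> ereal" where
  "inf_level f \<rho> c = (INF u \<in> V \<rho> c. ereal (energy f u))"

definition H1_continuous_path :: "(real \<Rightarrow> plane \<Rightarrow> real) \<Rightarrow> bool" where
  "H1_continuous_path \<gamma> \<longleftrightarrow>
     (\<forall>t \<ge> 0. ((\<lambda>s. H1_norm (\<lambda>x. \<gamma> s x - \<gamma> t x)) \<longlongrightarrow> 0) (at t within {0..}))"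

definition mp_paths ::
  "(real \<Rightarrow> real) \<Rightarrow> real \<Rightarrow> real \<Rightarrow> (plane \<Rightarrow> real) \<Rightarrow> (real \<Rightarrow> plane \<Rightarrow> real) set" where
  "mp_paths f \<rho> c u = {\<gamma>. (\<forall>t \<ge> 0. \<gamma> t \<in> Sr c) \<and> H1_continuous_path \<gamma> \<and>
     (AE x in lborel. \<gamma> 0 x = u x) \<and>
     (\<exists>t0 > 0. \<forall>t \<ge> t0. ereal (energy f (\<gamma> t)) < 2 * inf_level f \<rho> c)}"

text \<open>
  The supremum below is a maximum: if the infimum level \<open>m\<close> is finite and negative and is
  attained at \<open>u\<close>, the energy is continuous along the path, starts at \<open>m\<close> and is eventually
  below \<open>2 m < m\<close>.
\<close>

definition mp_level :: "(real \<Rightarrow> real) \<Rightarrow> real \<Rightarrow> real \<Rightarrow> (plane \<Rightarrow> real) \<Rightarrow> ereal" where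
  "mp_level f \<rho> c u = (INF \<gamma> \<in> mp_paths f \<rho> c u. SUP t \<in> {0..}. ereal (energy f (\<gamma> t)))"

end

theory Submission
  imports Defs
begin

text \<open>
  Write \<open>A\<close>, \<open>B\<close> and \<open>\<Phi>\<close> for the integrals of \<open>|\<nabla>u|\<^sup>2\<close>, \<open>f(u)u\<close> and \<open>F(u)\<close> at the mountain pass point \<open>u\<close>
  with \<open>L\<^sup>2\<close> norm \<open>c\<close>. The Nehari and Pohozaev identities give \<open>A = 2 M\<^sub>c + 2 \<Phi>\<close> and \<open>B = 2 M\<^sub>c + 4 \<Phi>\<close>. Since
  \<open>F(s) \<le> \<epsilon> f(s) s + C s\<^sup>2\<close> and \<open>M\<^sub>c < 2\<pi>/\<alpha>\<^sub>0\<close>, \<open>\<Phi>\<close> tends to 0, so all three limits reduce to that of \<open>M\<^sub>c\<close>.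
  If \<open>M\<^sub>c\<close> stayed bounded away from \<open>2\<pi>/\<alpha>\<^sub>0\<close> along a sequence \<open>c \<rightarrow> 0\<close>, \<open>A\<close> would be subcritical for the Trudinger-Moser
  inequality, hence \<open>B\<close> would tend to 0; but \<open>B \<ge> 2 M\<^sub>c \<ge> 2 \<tau>\<^sub>0\<close>, because every admissible path crosses \<open>\<partial>V\<^sub>c\<close>.

  As \<open>u\<close> is radial, both analytic inputs are one-dimensional in the variable \<open>s = |x|\<^sup>2\<close>, whose image
  measure is \<open>\<pi> ds\<close> on \<open>(0, \<infinity>)\<close>. The profile \<open>W\<close> satisfies \<open>|W(b) - W(a)|\<^sup>2 \<le> A ln(b/a) / 4\<pi>\<close>, which
  yields the Trudinger-Moser estimate, and the equation becomes \<open>-4 (s W')' + \<lambda> W = f(W)\<close>, for which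
  \<open>s (\<lambda> W\<^sup>2 / 2 - F(W)) - 2 (s W')\<^sup>2\<close> is a primitive of \<open>\<lambda> W\<^sup>2 / 2 - F(W)\<close>.
\<close>

section \<open>Smooth functions with compact support\<close>

text \<open>The value 4\<pi>/\<alpha>0 comes from the origin: the modulus of W gives roughly W(s)^2
  \<le> A ln(1/s) / 4\<pi>, so exp(\<alpha> W^2) is at most of order s^(-\<alpha> A / 4\<pi>), a
  power integrable near 0 exactly when \<alpha> A < 4\<pi>. With \<alpha> slightly above \<alpha>0
  this is A < 4\<pi>/\<alpha>0, twice the bound on the level, in accordance with the factor 2 in the
  formula for A. The obstacle is regularity. The function u is only in H1, its gradient is known
  through smooth test functions, and its profile is an arbitrary function. Both W and s W' are
  therefore recovered by duality, from du Bois-Reymond arguments that need an explicit supply of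
  test functions. The equation then makes W continuously differentiable on the open half-line, which
  suffices for the Pohozaev identity without elliptic regularity. Its boundary terms at 0 and
  infinity are not estimated pointwise: divided by s they are integrable, so they vanish along
  suitable sequences.\<close>

definition flat :: "nat \<Rightarrow> real \<Rightarrow> real" where
  "flat k s = (if s > 0 then exp (- 1 / s) / s ^ k else 0)"

lemma flat_tendsto_0: "(flat k \<longlongrightarrow> 0) (at_right 0)"
proof -
  have "((\<lambda>y::real. y ^ k / exp y) \<longlongrightarrow> 0) at_top"
    by (rule tendsto_power_div_exp_0)
  moreover have "filterlim (\<lambda>s::real. inverse s) at_top (at_right 0)"
    by (rule filterlim_inverse_at_top_right)
  ultimately have "((\<lambda>s::real. (inverse s) ^ k / exp (inverse s)) \<longlongrightarrow> 0) (at_right 0)"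
    by (rule filterlim_compose)
  then show ?thesis
    by (rule Lim_transform_eventually)
      (auto simp: eventually_at_right_less flat_def field_simps exp_minus
        intro!: eventually_at_rightI[of 0 1])
qed

text \<open>Differentiating exp(-1/s) s^(-k) only shifts the exponent, so the family is closed under
  derivatives. At 0 the right difference quotient of \<open>flat k\<close> is
  \<open>flat (Suc k)\<close>, which tends to 0 because the exponential beats every power.\<close>

lemma DERIV_flat: "(flat k has_real_derivative (flat (Suc (Suc k)) s - real k * flat (Suc k) s)) (at s)"
proof -
  consider "s > 0" | "s < 0" | "s = 0" by linarith
  then show ?thesis
  proof cases
    case 1
    have "((\<lambda>s. exp (- 1 / s) / s ^ k) has_real_derivative
        (flat (Suc (Suc k)) s - real k * flat (Suc k) s)) (at s)"
      using 1 by (auto intro!: derivative_eq_intros simp: flat_def)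
        (cases k; simp add: field_simps power2_eq_square)
    then show ?thesis
      by (rule has_field_derivative_transform_within_open[of _ _ _ "{0<..}"])
        (use 1 in \<open>auto simp: flat_def\<close>)
  next
    case 2
    have "((\<lambda>s. 0) has_real_derivative 0) (at s)" by simp
    then have "(flat k has_real_derivative 0) (at s)"
      by (rule has_field_derivative_transform_within_open[of _ _ _ "{..<0}"])
        (use 2 in \<open>auto simp: flat_def\<close>)
    then show ?thesis using 2 by (simp add: flat_def)
  next
    case 3
    have "((\<lambda>h. flat k h / h) \<longlongrightarrow> 0) (at 0)"
      unfolding filterlim_at_split
    proof
      show "((\<lambda>h. flat k h / h) \<longlongrightarrow> 0) (at_right 0)"
        by (rule Lim_transform_eventually[OF flat_tendsto_0[of "Suc k"]])
          (auto simp: flat_def intro!: eventually_at_rightI[of 0 1])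
      show "((\<lambda>h. flat k h / h) \<longlongrightarrow> 0) (at_left 0)"
        by (rule Lim_transform_eventually[OF tendsto_const])
          (auto simp: flat_def intro!: eventually_at_leftI[of "-1" 0])
    qed
    then have "(flat k has_real_derivative 0) (at 0)"
      by (simp add: DERIV_def flat_def[of k 0])
    then show ?thesis using 3 by (simp add: flat_def)
  qed
qed

text \<open>Smoothness is encoded by generators whose derivatives are again generated, so that
  derivatives of all orders follow from one induction. \<open>primitive\<close> admits
  antiderivatives of mean-zero combinations of bumps; \<open>quot\<close> admits division by s for
  functions that vanish to the left of some a > 0, as needed for fields containing x /
  |x|^2.\<close>

inductive smooth_real :: "(real \<Rightarrow> real) \<Rightarrow> bool" where
  const: "smooth_real (\<lambda>s. a)"
| ident: "smooth_real (\<lambda>s. s)"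
| add: "smooth_real g \<Longrightarrow> smooth_real h \<Longrightarrow> smooth_real (\<lambda>s. g s + h s)"
| mult: "smooth_real g \<Longrightarrow> smooth_real h \<Longrightarrow> smooth_real (\<lambda>s. g s * h s)"
| flat: "smooth_real g \<Longrightarrow> smooth_real (\<lambda>s. flat k (g s))"
| primitive: "smooth_real g \<Longrightarrow> (\<And>s. (h has_real_derivative g s) (at s)) \<Longrightarrow> smooth_real h"
| quot: "smooth_real g \<Longrightarrow> 0 < a \<Longrightarrow> (\<And>s. s < a \<Longrightarrow> g s = 0) \<Longrightarrow> smooth_real (\<lambda>s. g s / s)"

lemma smooth_real_diff: "smooth_real g \<Longrightarrow> smooth_real h \<Longrightarrow> smooth_real (\<lambda>s. g s - h s)"
  using smooth_real.add[of g "\<lambda>s. (-1) * h s"] smooth_real.mult[OF smooth_real.const[of "-1"]] by simp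

lemma smooth_real_deriv:
  assumes "smooth_real g"
  obtains g' where "smooth_real g'" "\<And>s. (g has_real_derivative g' s) (at s)"
proof -
  have "\<exists>g'. smooth_real g' \<and> (\<forall>s. (g has_real_derivative g' s) (at s))"
    using assms
  proof induction
    case (const a)
    then show ?case by (intro exI[of _ "\<lambda>s. 0"]) (auto intro: smooth_real.const)
  next
    case ident
    then show ?case by (intro exI[of _ "\<lambda>s. 1"]) (auto intro: smooth_real.const)
  next
    case (add g h)
    then obtain g' h' where "smooth_real g'" "smooth_real h'"
      "\<forall>s. (g has_real_derivative g' s) (at s)" "\<forall>s. (h has_real_derivative h' s) (at s)" by blast
    then show ?case
      by (intro exI[of _ "\<lambda>s. g' s + h' s"]) (auto intro: smooth_real.add DERIV_add)
  next
    case (mult g h)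
    then obtain g' h' where "smooth_real g'" "smooth_real h'"
      "\<forall>s. (g has_real_derivative g' s) (at s)" "\<forall>s. (h has_real_derivative h' s) (at s)" by blast
    with mult show ?case
      by (intro exI[of _ "\<lambda>s. g' s * h s + h' s * g s"])
        (auto intro!: smooth_real.add smooth_real.mult DERIV_mult)
  next
    case (flat g k)
    then obtain g' where g': "smooth_real g'" "\<forall>s. (g has_real_derivative g' s) (at s)" by blast
    have "smooth_real (\<lambda>s. (flat (Suc (Suc k)) (g s) + (- real k) * flat (Suc k) (g s)) * g' s)"
      by (intro smooth_real.add smooth_real.mult smooth_real.flat flat g' smooth_real.const)
    moreover have "((\<lambda>s. flat k (g s)) has_real_derivative
       (flat (Suc (Suc k)) (g s) + (- real k) * flat (Suc k) (g s)) * g' s) (at s)" for s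
      using DERIV_chain2[OF DERIV_flat g'(2)[rule_format], of k s] by simp
    ultimately show ?case by blast
  next
    case (primitive g h)
    then show ?case by blast
  next
    case (quot g a)
    then obtain g' where g': "smooth_real g'" "\<And>s. (g has_real_derivative g' s) (at s)" by blast
    \<comment> \<open>The derivative also vanishes to the left of a, so g'/s and (g/s)/s are both
      instances of \<open>quot\<close>. The quotient is identically 0 near the origin, which makes
      the value of division by 0 the right one there.\<close>
    have z: "g' s = 0" if "s < a" for s
    proof -
      have "(g has_real_derivative 0) (at s)"
        by (rule has_field_derivative_transform_within_open[of "\<lambda>s. 0" _ _ "{..<a}"])
          (use that quot(3) in auto)
      then show ?thesis using g'(2) DERIV_unique by blast
    qed
    have q: "smooth_real (\<lambda>s. g s / s)" by (rule smooth_real.quot[OF quot(1-3)])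
    have q0: "g s / s = 0" if "s < a" for s using quot(3)[OF that] by simp
    have "smooth_real (\<lambda>s. g' s / s + (- 1) * (g s / s / s))"
      by (intro smooth_real.add smooth_real.mult smooth_real.const
          smooth_real.quot[OF g'(1) quot(2) z] smooth_real.quot[OF q quot(2) q0])
    moreover have "((\<lambda>s. g s / s) has_real_derivative g' s / s + (- 1) * (g s / s / s)) (at s)" for s
    proof (cases "s = 0")
      case True
      have "((\<lambda>s. g s / s) has_real_derivative 0) (at s)"
        by (rule has_field_derivative_transform_within_open[of "\<lambda>s. 0" _ _ "{..<a}"])
          (use True quot(2,3) in auto)
      then show ?thesis using True by simp
    next
      case False
      then show ?thesis
        by (auto intro!: derivative_eq_intros g'(2) simp: field_simps)
    qed
    ultimately show ?case by blast
  qed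
  with that show ?thesis by blast
qed

lemma smooth_real_continuous: "smooth_real g \<Longrightarrow> continuous_on A g"
  by (metis smooth_real_deriv DERIV_continuous_on has_field_derivative_at_within)

text \<open>As on the line, partial derivatives stay in the class. Composition needs outer functions
  of one variable only, which covers tensor products of bumps and functions of |x|^2.\<close>

inductive smooth_plane :: "(plane \<Rightarrow> real) \<Rightarrow> bool" where
  const: "smooth_plane (\<lambda>x. a)"
| coord: "smooth_plane (\<lambda>x. x $ i)"
| add: "smooth_plane g \<Longrightarrow> smooth_plane h \<Longrightarrow> smooth_plane (\<lambda>x. g x + h x)"
| mult: "smooth_plane g \<Longrightarrow> smooth_plane h \<Longrightarrow> smooth_plane (\<lambda>x. g x * h x)"
| comp: "smooth_plane g \<Longrightarrow> smooth_real h \<Longrightarrow> smooth_plane (\<lambda>x. h (g x))"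

lemma smooth_plane_deriv_ex:
  assumes "smooth_plane \<phi>"
  shows "\<exists>D. (\<forall>i. smooth_plane (D i)) \<and>
     (\<forall>x. (\<phi> has_derivative (\<lambda>h. \<Sum>i\<in>UNIV. D i x * h $ i)) (at x))"
  using assms
proof induction
  case (const a)
  then show ?case by (intro exI[of _ "\<lambda>i x. 0"]) (auto intro: smooth_plane.const)
next
  case (coord i)
  have "(\<lambda>h. \<Sum>j\<in>UNIV. (if j = i then 1 else 0) * h $ j) = (\<lambda>h::plane. h $ i)"
    by (simp add: if_distrib if_distribR cong: if_cong)
  then show ?case
    by (intro exI[of _ "\<lambda>j x. if j = i then 1 else 0"])
      (auto intro: smooth_plane.const bounded_linear.has_derivative[OF bounded_linear_vec_nth])
next
  case (add g h)
  then obtain D E where "\<forall>i. smooth_plane (D i)" "\<forall>i. smooth_plane (E i)"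
    "\<forall>x. (g has_derivative (\<lambda>h. \<Sum>i\<in>UNIV. D i x * h $ i)) (at x)"
    "\<forall>x. (h has_derivative (\<lambda>h. \<Sum>i\<in>UNIV. E i x * h $ i)) (at x)" by blast
  then show ?case
    by (intro exI[of _ "\<lambda>i x. D i x + E i x"])
      (auto intro!: smooth_plane.add derivative_eq_intros simp: distrib_right sum.distrib)
next
  case (mult g h)
  then obtain D E where *: "\<forall>i. smooth_plane (D i)" "\<forall>i. smooth_plane (E i)"
    and d: "\<And>x. (g has_derivative (\<lambda>h. \<Sum>i\<in>UNIV. D i x * h $ i)) (at x)"
    "\<And>x. (h has_derivative (\<lambda>h. \<Sum>i\<in>UNIV. E i x * h $ i)) (at x)" by blast
  have "((\<lambda>x. g x * h x) has_derivative
     (\<lambda>k. \<Sum>i\<in>UNIV. (g x * E i x + D i x * h x) * k $ i)) (at x)" for x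
    by (rule has_derivative_eq_rhs[OF has_derivative_mult[OF d]])
      (auto simp: algebra_simps sum_distrib_left sum_distrib_right sum.distrib)
  moreover have "smooth_plane (\<lambda>x. g x * E i x + D i x * h x)" for i
    using * mult(1,2) by (intro smooth_plane.add smooth_plane.mult) auto
  ultimately show ?case
    by (intro exI[of _ "\<lambda>i x. g x * E i x + D i x * h x"]) simp
next
  case (comp g h)
  obtain h' where h': "smooth_real h'" "\<And>s. (h has_real_derivative h' s) (at s)"
    using smooth_real_deriv[OF comp(2)] by blast
  obtain D where *: "\<forall>i. smooth_plane (D i)"
    and d: "\<And>x. (g has_derivative (\<lambda>h. \<Sum>i\<in>UNIV. D i x * h $ i)) (at x)" using comp by blast
  have "((\<lambda>x. h (g x)) has_derivative
     (\<lambda>k. \<Sum>i\<in>UNIV. (h' (g x) * D i x) * k $ i)) (at x)" for x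
    by (rule has_derivative_eq_rhs[OF has_derivative_compose[OF d
            h'(2)[unfolded has_field_derivative_def]]])
      (auto simp: algebra_simps sum_distrib_left)
  moreover have "smooth_plane (\<lambda>x. h' (g x) * D i x)" for i
    using smooth_plane.mult[OF smooth_plane.comp[OF comp(1) h'(1)]] * by blast
  ultimately show ?case
    by (intro exI[of _ "\<lambda>i x. h' (g x) * D i x"]) simp
qed

lemma pderiv_at_eq:
  "(\<phi> has_derivative D) (at x) \<Longrightarrow> pderiv_at i \<phi> x = D (axis i 1)"
  unfolding pderiv_at_def by (metis frechet_derivative_at)

lemma smooth_plane_Ck: "smooth_plane \<phi> \<Longrightarrow> Ck k \<phi>"
proof (induction k arbitrary: \<phi>)
  case 0
  obtain D where d: "\<And>x. (\<phi> has_derivative (\<lambda>h. \<Sum>i\<in>UNIV. D i x * h $ i)) (at x)"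
    using smooth_plane_deriv_ex[OF 0] by blast
  have "isCont \<phi> x" for x using has_derivative_continuous[OF d] .
  then show ?case by (simp add: continuous_at_imp_continuous_on)
next
  case (Suc k)
  obtain D where D: "\<forall>i. smooth_plane (D i)"
    and d: "\<And>x. (\<phi> has_derivative (\<lambda>h. \<Sum>i\<in>UNIV. D i x * h $ i)) (at x)"
    using smooth_plane_deriv_ex[OF Suc(2)] by blast
  have "pderiv_at i \<phi> = D i" for i
    by (rule ext, subst pderiv_at_eq[OF d])
      (simp add: axis_def if_distrib cong: if_cong)
  moreover have "\<phi> differentiable at x" for x
    using d by (rule differentiableI)
  ultimately show ?case using Suc(1) D by simp
qed

lemma compact_closure_support:
  fixes \<phi> :: "plane \<Rightarrow> real"
  assumes "\<And>x. norm x > R \<Longrightarrow> \<phi> x = 0"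
  shows "compact (closure {x. \<phi> x \<noteq> 0})"
proof -
  have "{x. \<phi> x \<noteq> 0} \<subseteq> cball 0 R"
    using assms by (force simp: not_less)
  then show ?thesis
    by (simp add: bounded_subset[OF bounded_cball])
qed

lemma smooth_plane_test:
  assumes "smooth_plane \<phi>" "\<And>x. norm x > R \<Longrightarrow> \<phi> x = 0"
  shows "test_function \<phi>"
  unfolding test_function_def
  using smooth_plane_Ck[OF assms(1)] compact_closure_support[of R \<phi>, OF assms(2)] by blast

text \<open>The parameter n enters as exp(-1/(n y)), which tends to 1 for y > 0 while the factor
  stays 0 for y \<le> 0. Hence these smooth functions lie below the indicator of the open interval
  and converge to it without any mollification.\<close>

definition bump :: "nat \<Rightarrow> real \<Rightarrow> real \<Rightarrow> real \<Rightarrow> real" where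
  "bump n a b s = flat 0 (real n * (s - a)) * flat 0 (real n * (b - s))"

lemma smooth_bump: "smooth_real (bump n a b)"
  unfolding bump_def
  by (intro smooth_real.mult smooth_real.flat smooth_real_diff smooth_real.const smooth_real.ident)

lemma flat_0_bounds: "0 \<le> flat 0 s" "flat 0 s \<le> 1"
  by (auto simp: flat_def)

lemma bump_nonneg: "0 \<le> bump n a b s"
  by (auto simp: bump_def flat_0_bounds)

lemma bump_le: "bump n a b s \<le> indicator {a<..<b} s"
proof (cases "s \<in> {a<..<b}")
  case True
  then show ?thesis
    by (simp add: bump_def flat_0_bounds mult_le_one)
next
  case False
  then have "s \<le> a \<or> b \<le> s" by auto
  then have "real n * (s - a) \<le> 0 \<or> real n * (b - s) \<le> 0"
    by (auto simp: mult_le_0_iff)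
  then show ?thesis using False by (auto simp: bump_def flat_def)
qed

lemma bump_tendsto: "(\<lambda>n. bump n a b s) \<longlonglongrightarrow> indicator {a<..<b} s"
proof -
  have pos: "(\<lambda>n. flat 0 (real n * y)) \<longlonglongrightarrow> 1" if "y > 0" for y
  proof -
    have "(\<lambda>n. exp (- (inverse y * (1 / real n)))) \<longlonglongrightarrow> exp (- (inverse y * 0))"
      by (intro tendsto_intros lim_1_over_n)
    then have "(\<lambda>n. exp (- (inverse y * (1 / real n)))) \<longlonglongrightarrow> 1" by simp
    then show ?thesis
      by (rule Lim_transform_eventually)
        (use that in \<open>auto simp: flat_def field_simps intro!: eventually_sequentiallyI[of 1]\<close>)
  qed
  show ?thesis
  proof (cases "s \<in> {a<..<b}")
    case True
    then show ?thesis
      unfolding bump_def using tendsto_mult[OF pos[of "s - a"] pos[of "b - s"]] by simp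
  next
    case False
    have "bump n a b s = 0" for n
      using bump_le[of n a b s] bump_nonneg[of n a b s] False by simp
    then show ?thesis using False by simp
  qed
qed

lemma bump_eq_0: "s \<notin> {a<..<b} \<Longrightarrow> bump n a b s = 0"
  using bump_le[of n a b s] bump_nonneg[of n a b s] by simp

text \<open>The positive and negative parts of h are densities of two measures that are finite and
  equal on boxes. Boxes form an intersection-stable generator, so the measures agree, hence so do
  the densities almost everywhere; two parts that are equal are both 0.\<close>

lemma AE_zero_if_box_integrals_zero:
  fixes h :: "'a::euclidean_space \<Rightarrow> real"
  assumes meas: "h \<in> borel_measurable borel"
    and int: "\<And>a b. set_integrable lborel (box a b) h"
    and zero: "\<And>a b. (LBINT x:box a b. h x) = 0"
  shows "AE x in lborel. h x = 0"
proof -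
  let ?p = "\<lambda>x. ennreal (max 0 (h x))" and ?m = "\<lambda>x. ennreal (max 0 (- h x))"
  have mh: "h \<in> borel_measurable lborel" using meas by simp
  have eq: "emeasure (density lborel ?p) (box a b) = emeasure (density lborel ?m) (box a b)"
    and fin: "emeasure (density lborel ?p) (box a b) \<noteq> \<infinity>" for a b :: 'a
  proof -
    define g where "g = (\<lambda>x. indicator (box a b) x *\<^sub>R h x)"
    have g: "integrable lborel g" using int[of a b] by (simp add: g_def set_integrable_def)
    have "emeasure (density lborel ?p) (box a b) = (\<integral>\<^sup>+ x. ennreal (max 0 (g x)) \<partial>lborel)"
      using mh by (subst emeasure_density)
        (auto intro!: nn_integral_cong simp: g_def indicator_def)
    also have "\<dots> = ennreal (LBINT x. max 0 (g x))"
      using g by (intro nn_integral_eq_integral) auto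
    finally have p: "emeasure (density lborel ?p) (box a b) = ennreal (LBINT x. max 0 (g x))" .
    have "emeasure (density lborel ?m) (box a b) = (\<integral>\<^sup>+ x. ennreal (max 0 (- g x)) \<partial>lborel)"
      using mh by (subst emeasure_density)
        (auto intro!: nn_integral_cong simp: g_def indicator_def)
    also have "\<dots> = ennreal (LBINT x. max 0 (- g x))"
      using g by (intro nn_integral_eq_integral) auto
    finally have m: "emeasure (density lborel ?m) (box a b) = ennreal (LBINT x. max 0 (- g x))" .
    have "(\<lambda>x. max 0 (g x) - max 0 (- g x)) = g" by (auto simp: max_def)
    then have "(LBINT x. max 0 (g x)) - (LBINT x. max 0 (- g x)) = (LBINT x. g x)"
      using g by (subst Bochner_Integration.integral_diff[symmetric]) auto
    also have "\<dots> = 0"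
      using zero[of a b] by (simp add: g_def set_lebesgue_integral_def)
    finally have "(LBINT x. max 0 (g x)) = (LBINT x. max 0 (- g x))" by simp
    with p m show "emeasure (density lborel ?p) (box a b) = emeasure (density lborel ?m) (box a b)"
      by simp
    show "emeasure (density lborel ?p) (box a b) \<noteq> \<infinity>" unfolding p by simp
  qed
  let ?E = "range (\<lambda>(a, b). box a b :: 'a set)"
  have "density lborel ?p = density lborel ?m"
  proof (rule measure_eqI_generator_eq)
    show "Int_stable ?E"
      by (auto simp: Int_stable_def box_Int_box)
    show "?E \<subseteq> Pow UNIV" by simp
    show "\<And>X. X \<in> ?E \<Longrightarrow> emeasure (density lborel ?p) X = emeasure (density lborel ?m) X"
      using eq by auto
    show "sets (density lborel ?p) = sigma_sets UNIV ?E" "sets (density lborel ?m) = sigma_sets UNIV ?E"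
      by (simp_all add: borel_eq_box sets_measure_of)
    show "range (\<lambda>n::nat. box (- (real n *\<^sub>R One)) (real n *\<^sub>R One) :: 'a set) \<subseteq> ?E" by auto
    show "(\<Union>n::nat. box (- (real n *\<^sub>R One)) (real n *\<^sub>R One)) = (UNIV :: 'a set)"
      by (rule UN_box_eq_UNIV)
    show "emeasure (density lborel ?p) (box (- (real n *\<^sub>R One)) (real n *\<^sub>R One)) \<noteq> \<infinity>" for n :: nat
      by (rule fin)
  qed
  then have "AE x in lborel. ?p x = ?m x"
    by (intro sigma_finite_measure.density_unique[OF sigma_finite_lborel]) (use mh in auto)
  then show ?thesis
    by eventually_elim (auto simp: max_def split: if_splits)
qed

section \<open>Weak gradients\<close>

lemma integrable_mult_sq:
  fixes f g :: "'a \<Rightarrow> real"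
  assumes "f \<in> borel_measurable M" "g \<in> borel_measurable M"
    "integrable M (\<lambda>x. (f x)\<^sup>2)" "integrable M (\<lambda>x. (g x)\<^sup>2)"
  shows "integrable M (\<lambda>x. f x * g x)"
proof (rule Bochner_Integration.integrable_bound)
  show "integrable M (\<lambda>x. (f x)\<^sup>2 + (g x)\<^sup>2)" using assms by simp
  have "\<bar>a * b\<bar> \<le> a\<^sup>2 + b\<^sup>2" for a b :: real
  proof -
    have "2 * \<bar>a\<bar> * \<bar>b\<bar> \<le> \<bar>a\<bar>\<^sup>2 + \<bar>b\<bar>\<^sup>2" by (rule sum_squares_bound)
    moreover have "0 \<le> \<bar>a\<bar> * \<bar>b\<bar>" by simp
    ultimately show ?thesis unfolding abs_mult power2_abs by linarith
  qed
  then show "AE x in M. norm (f x * g x) \<le> norm ((f x)\<^sup>2 + (g x)\<^sup>2)" by simp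
qed (use assms in measurable)

lemma Cauchy_Schwarz_integral:
  fixes f g :: "'a \<Rightarrow> real"
  assumes f: "f \<in> borel_measurable M" and g: "g \<in> borel_measurable M"
    and f2: "integrable M (\<lambda>x. (f x)\<^sup>2)" and g2: "integrable M (\<lambda>x. (g x)\<^sup>2)"
  shows "(LINT x|M. f x * g x)\<^sup>2 \<le> (LINT x|M. (f x)\<^sup>2) * (LINT x|M. (g x)\<^sup>2)"
proof (cases "(LINT x|M. (g x)\<^sup>2) = 0")
  case True
  then have "AE x in M. (g x)\<^sup>2 = 0"
    using integral_nonneg_eq_0_iff_AE[OF g2] by simp
  then have "AE x in M. f x * g x = 0" by eventually_elim simp
  then have "(LINT x|M. f x * g x) = 0"
    by (rule integral_eq_zero_AE)
  then show ?thesis using True by simp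
next
  case False
  define G where "G = (LINT x|M. (g x)\<^sup>2)"
  have G: "G > 0" using False G_def by (simp add: order_less_le)
  define J where "J = (LINT x|M. f x * g x)"
  have fg: "integrable M (\<lambda>x. f x * g x)" by (rule integrable_mult_sq[OF f g f2 g2])
  have "0 \<le> (LINT x|M. (f x - J / G * g x)\<^sup>2)" by simp
  also have "(\<lambda>x. (f x - J / G * g x)\<^sup>2) = (\<lambda>x. (f x)\<^sup>2 - 2 * (J / G) * (f x * g x) + (J / G)\<^sup>2 * (g x)\<^sup>2)"
    by (auto simp: power2_eq_square algebra_simps)
  also have "(LINT x|M. (f x)\<^sup>2 - 2 * (J / G) * (f x * g x) + (J / G)\<^sup>2 * (g x)\<^sup>2)
    = (LINT x|M. (f x)\<^sup>2) - 2 * (J / G) * J + (J / G)\<^sup>2 * G"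
    using f2 g2 fg by (simp add: J_def G_def del: times_divide_eq_left times_divide_eq_right)
  also have "\<dots> = (LINT x|M. (f x)\<^sup>2) - J\<^sup>2 / G"
    using G by (simp add: field_simps power2_eq_square)
  finally show ?thesis using G by (simp add: J_def G_def field_simps)
qed

lemma L2D: "u \<in> L2 \<Longrightarrow> u \<in> borel_measurable borel" "u \<in> L2 \<Longrightarrow> integrable lborel (\<lambda>x. (norm (u x))\<^sup>2)"
  by (auto simp: L2_def)

lemma L2_indicator:
  assumes "A \<in> sets borel" "emeasure lborel A < \<infinity>"
  shows "(indicator A :: plane \<Rightarrow> real) \<in> L2"
proof -
  have "(\<lambda>x. (norm (indicator A x :: real))\<^sup>2) = (indicator A :: plane \<Rightarrow> real)"
    by (auto simp: indicator_def)
  then show ?thesis using assms by (simp add: L2_def)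
qed

lemma L2_vec_nth:
  fixes g :: "plane \<Rightarrow> plane"
  assumes "g \<in> L2"
  shows "(\<lambda>x. g x $ i) \<in> L2"
proof -
  have [measurable]: "g \<in> borel_measurable borel" using assms by (rule L2D)
  have m: "(\<lambda>x. g x $ i) \<in> borel_measurable borel"
    by (subst cart_eq_inner_axis) measurable
  moreover have "integrable lborel (\<lambda>x. (norm (g x $ i))\<^sup>2)"
    by (rule Bochner_Integration.integrable_bound[OF L2D(2)[OF assms]])
      (use m in \<open>auto simp: abs_le_square_iff[symmetric] component_le_norm_cart\<close>)
  ultimately show ?thesis by (simp add: L2_def)
qed

lemma L2_mult_integrable:
  fixes u v :: "plane \<Rightarrow> real"
  assumes "u \<in> L2" "v \<in> L2"
  shows "integrable lborel (\<lambda>x. u x * v x)"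
  using assms by (intro integrable_mult_sq) (auto simp: L2_def)

lemma L2_diff:
  fixes u v :: "plane \<Rightarrow> 'b::euclidean_space"
  assumes "u \<in> L2" "v \<in> L2"
  shows "(\<lambda>x. u x - v x) \<in> L2"
proof -
  have [measurable]: "u \<in> borel_measurable borel" "v \<in> borel_measurable borel"
    using assms by (auto intro: L2D)
  have le: "(norm (a - b))\<^sup>2 \<le> 2 * (norm a)\<^sup>2 + 2 * (norm b)\<^sup>2" for a b :: 'b
  proof -
    have "(norm (a - b))\<^sup>2 \<le> (norm a + norm b)\<^sup>2" by (intro power_mono norm_triangle_ineq4) auto
    also have "\<dots> \<le> 2 * (norm a)\<^sup>2 + 2 * (norm b)\<^sup>2"
      using sum_squares_bound[of "norm a" "norm b"] by (simp add: power2_sum)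
    finally show ?thesis .
  qed
  have "integrable lborel (\<lambda>x. 2 * (norm (u x))\<^sup>2 + 2 * (norm (v x))\<^sup>2)"
    using L2D(2)[OF assms(1)] L2D(2)[OF assms(2)] by simp
  then have "integrable lborel (\<lambda>x. (norm (u x - v x))\<^sup>2)"
    by (rule Bochner_Integration.integrable_bound[where f = "\<lambda>x. 2 * (norm (u x))\<^sup>2 + 2 * (norm (v x))\<^sup>2"])
      (use le in auto)
  then show ?thesis by (simp add: L2_def)
qed

lemma continuous_compact_support_integrable:
  fixes \<phi> :: "plane \<Rightarrow> 'b::euclidean_space"
  assumes c: "continuous_on UNIV \<phi>" and R: "\<And>x. norm x > R \<Longrightarrow> \<phi> x = 0"
  shows "integrable lborel \<phi>"
proof -
  have "set_integrable lborel (cball 0 R) \<phi>"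
    unfolding set_integrable_def using continuous_on_subset[OF c]
    by (intro borel_integrable_compact) auto
  moreover have "(\<lambda>x. indicator (cball 0 R) x *\<^sub>R \<phi> x) = \<phi>"
    using R by (force simp: indicator_def not_le)
  ultimately show ?thesis by (simp add: set_integrable_def)
qed

lemma continuous_compact_support_L2:
  fixes \<phi> :: "plane \<Rightarrow> 'b::euclidean_space"
  assumes c: "continuous_on UNIV \<phi>" and R: "\<And>x. norm x > R \<Longrightarrow> \<phi> x = 0"
  shows "\<phi> \<in> L2"
proof -
  have "integrable lborel (\<lambda>x. (norm (\<phi> x))\<^sup>2)"
    using c R by (intro continuous_compact_support_integrable[of _ R] continuous_intros) auto
  moreover have "\<phi> \<in> borel_measurable lborel"
    using borel_measurable_continuous_onI[OF c] by simp
  ultimately show ?thesis by (simp add: L2_def)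
qed

text \<open>Weaker than \<open>test_function\<close>: the functions inserted into the weak equation
  are antiderivatives of merely continuous functions of |x|^2, and this much regularity already
  places them in \<open>H1\<close> with their classical gradient.\<close>

definition C1c :: "(plane \<Rightarrow> real) \<Rightarrow> bool" where
  "C1c \<phi> \<longleftrightarrow> (\<forall>x. \<phi> differentiable (at x)) \<and> (\<forall>i. continuous_on UNIV (pderiv_at i \<phi>)) \<and>
     (\<exists>R. \<forall>x. norm x > R \<longrightarrow> \<phi> x = 0)"

lemma test_function_C1c: "test_function \<phi> \<Longrightarrow> C1c \<phi>"
proof -
  assume t: "test_function \<phi>"
  then have "Ck (Suc 0) \<phi>" by (auto simp: test_function_def)
  moreover have "bounded (closure {x. \<phi> x \<noteq> 0})"
    using t by (simp only: test_function_def compact_imp_bounded)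
  then obtain R where "closure {x. \<phi> x \<noteq> 0} \<subseteq> cball 0 R"
    by (metis bounded_subset_ballD ball_subset_cball subset_trans)
  then have "\<forall>x. norm x > R \<longrightarrow> \<phi> x = 0"
    using closure_subset[of "{x. \<phi> x \<noteq> 0}"] by force
  ultimately show ?thesis by (auto simp: C1c_def)
qed

lemma C1c_continuous: "C1c \<phi> \<Longrightarrow> continuous_on UNIV \<phi>"
  by (auto simp: C1c_def differentiable_imp_continuous_within intro!: continuous_at_imp_continuous_on)

lemma C1c_support:
  assumes "C1c \<phi>"
  obtains R where "\<And>x. norm x > R \<Longrightarrow> \<phi> x = 0" "\<And>x i. norm x > R \<Longrightarrow> pderiv_at i \<phi> x = 0"
proof -
  obtain R where R: "\<And>x. norm x > R \<Longrightarrow> \<phi> x = 0" using assms by (auto simp: C1c_def)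
  have "pderiv_at i \<phi> x = 0" if "norm x > R" for x i
  proof -
    have "(\<phi> has_derivative (\<lambda>h. 0)) (at x)"
      by (rule has_derivative_transform_within_open[where f = "\<lambda>x. 0" and s = "- cball 0 R"])
        (use that R in \<open>auto simp: open_Compl\<close>)
    then show ?thesis by (simp add: pderiv_at_eq)
  qed
  with R that show ?thesis by blast
qed

text \<open>Difference quotients in direction i have integral 0 by translation invariance, and they
  converge to the derivative under a common bound; no iterated integration is required.\<close>

lemma integral_pderiv_zero:
  assumes \<phi>: "C1c \<phi>"
  shows "(LBINT x. pderiv_at i \<phi> x) = 0"
proof -
  obtain R where R: "\<And>x. norm x > R \<Longrightarrow> \<phi> x = 0" "\<And>x i. norm x > R \<Longrightarrow> pderiv_at i \<phi> x = 0"
    using C1c_support[OF \<phi>] by blast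
  have cd: "continuous_on UNIV (pderiv_at i \<phi>)" using \<phi> by (auto simp: C1c_def)
  have "compact (pderiv_at i \<phi> ` cball 0 R)"
    by (intro compact_continuous_image continuous_on_subset[OF cd]) auto
  then have "bounded (pderiv_at i \<phi> ` cball 0 R)" by (rule compact_imp_bounded)
  then obtain B0 where B0: "\<And>x. x \<in> cball 0 R \<Longrightarrow> \<bar>pderiv_at i \<phi> x\<bar> \<le> B0"
    unfolding bounded_iff real_norm_def by blast
  define B where "B = max B0 0"
  have B: "\<bar>pderiv_at i \<phi> x\<bar> \<le> B" "0 \<le> B" for x
    using B0[of x] R(2)[of x i] by (cases "norm x > R"; force simp: B_def)+
  let ?e = "axis i 1 :: plane"
  have der: "((\<lambda>t. \<phi> (x + t *\<^sub>R ?e)) has_real_derivative pderiv_at i \<phi> (x + t *\<^sub>R ?e)) (at t)" for x t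
  proof -
    have "(\<phi> has_derivative frechet_derivative \<phi> (at (x + t *\<^sub>R ?e))) (at (x + t *\<^sub>R ?e))"
      using \<phi> by (simp add: C1c_def frechet_derivative_works)
    then have "((\<lambda>t. \<phi> (x + t *\<^sub>R ?e)) has_derivative
        (\<lambda>h. frechet_derivative \<phi> (at (x + t *\<^sub>R ?e)) (h *\<^sub>R ?e))) (at t)"
      by (rule has_derivative_compose[rotated]) (auto intro!: derivative_eq_intros)
    moreover have "frechet_derivative \<phi> (at (x + t *\<^sub>R ?e)) (h *\<^sub>R ?e) = h * pderiv_at i \<phi> (x + t *\<^sub>R ?e)" for h
      using linear_cmul[OF linear_frechet_derivative, of \<phi>] \<phi> by (simp add: C1c_def pderiv_at_def)
    ultimately show ?thesis by (auto intro: has_derivative_imp_has_field_derivative)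
  qed
  define h where "h = (\<lambda>n. 1 / real (Suc n))"
  have h: "0 < h n" "h n \<le> 1" for n by (auto simp: h_def)
  have hlim: "h \<longlonglongrightarrow> 0" unfolding h_def by (rule LIMSEQ_Suc[OF lim_1_over_n])
  define q where "q = (\<lambda>n x. (\<phi> (x + h n *\<^sub>R ?e) - \<phi> x) / h n)"
  have cont: "continuous_on UNIV \<phi>" by (rule C1c_continuous[OF \<phi>])
  have int: "integrable lborel \<phi>" by (rule continuous_compact_support_integrable[OF cont R(1)])
  have shift: "integrable lborel (\<lambda>x. \<phi> (x + a))" "(LBINT x. \<phi> (x + a)) = (LBINT x. \<phi> x)" for a
  proof -
    have m: "\<phi> \<in> borel_measurable borel" using cont by (rule borel_measurable_continuous_onI)
    have d: "distr lborel borel ((+) a) = lborel" by (rule lborel_distr_plus)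
    show "integrable lborel (\<lambda>x. \<phi> (x + a))"
      using integrable_distr_eq[of "(+) a" lborel borel \<phi>] m int d by (simp add: add.commute)
    show "(LBINT x. \<phi> (x + a)) = (LBINT x. \<phi> x)"
      using integral_distr[of "(+) a" lborel borel \<phi>] m d by (simp add: add.commute)
  qed
  have q0: "(LBINT x. q n x) = 0" for n
    using shift int unfolding q_def by simp
  have "(\<lambda>n. LBINT x. q n x) \<longlonglongrightarrow> (LBINT x. pderiv_at i \<phi> x)"
  \<comment> \<open>Shifts have length at most 1, so all quotients vanish outside the ball of radius
    R + 1; inside it the mean value theorem bounds them by B.\<close>
  proof (rule integral_dominated_convergence[where w = "\<lambda>x. B * indicator (cball 0 (R + 1)) x"])
    show "integrable lborel (\<lambda>x. B * indicator (cball 0 (R + 1)) x :: real)"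
      by (intro integrable_mult_right integrable_real_indicator)
        (simp_all add: emeasure_bounded_finite[simplified])
    show "pderiv_at i \<phi> \<in> borel_measurable lborel"
      using borel_measurable_continuous_onI[OF cd] by simp
    show "q n \<in> borel_measurable lborel" for n
    proof -
      have "continuous_on UNIV (q n)" unfolding q_def using h
        by (intro continuous_intros continuous_on_compose2[OF cont]) (auto simp: less_imp_neq[symmetric])
      then show ?thesis using borel_measurable_continuous_onI by auto
    qed
    show "AE x in lborel. (\<lambda>n. q n x) \<longlonglongrightarrow> pderiv_at i \<phi> x"
    proof (rule AE_I2)
      fix x
      have "((\<lambda>t. (\<phi> (x + t *\<^sub>R ?e) - \<phi> x) / t) \<longlongrightarrow> pderiv_at i \<phi> x) (at 0)"
        using der[of x 0] by (simp add: DERIV_def)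
      moreover have "filterlim h (at 0) sequentially"
        using hlim h by (simp add: filterlim_at less_imp_neq[symmetric])
      ultimately show "(\<lambda>n. q n x) \<longlonglongrightarrow> pderiv_at i \<phi> x"
        unfolding q_def by (rule filterlim_compose)
    qed
    show "AE x in lborel. norm (q n x) \<le> B * indicator (cball 0 (R + 1)) x" for n
    proof (rule AE_I2)
      fix x
      show "norm (q n x) \<le> B * indicator (cball 0 (R + 1)) x"
      proof (cases "norm x > R + 1")
        case True
        have "norm x \<le> norm (x + h n *\<^sub>R ?e) + norm (h n *\<^sub>R ?e)"
          using norm_triangle_ineq4[of "x + h n *\<^sub>R ?e" "h n *\<^sub>R ?e"] by simp
        also have "norm (h n *\<^sub>R ?e) \<le> 1" using h[of n] by (simp add: norm_axis_1)
        finally have "norm (x + h n *\<^sub>R ?e) > R" using True by simp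
        then show ?thesis using R(1) True B by (simp add: q_def)
      next
        case False
        obtain z where "\<phi> (x + h n *\<^sub>R ?e) - \<phi> (x + 0 *\<^sub>R ?e) = (h n - 0) * pderiv_at i \<phi> (x + z *\<^sub>R ?e)"
          using MVT2[OF h(1)[of n], of "\<lambda>t. \<phi> (x + t *\<^sub>R ?e)" "\<lambda>t. pderiv_at i \<phi> (x + t *\<^sub>R ?e)"] der by blast
        then have "q n x = pderiv_at i \<phi> (x + z *\<^sub>R ?e)" using h(1)[of n] by (simp add: q_def)
        then show ?thesis using B False by simp
      qed
    qed
  qed
  then show ?thesis using q0 by (simp add: LIMSEQ_const_iff)
qed

lemma pderiv_at_mult:
  assumes "\<phi> differentiable (at x)" "\<eta> differentiable (at x)"
  shows "pderiv_at i (\<lambda>x. \<phi> x * \<eta> x) x = \<phi> x * pderiv_at i \<eta> x + pderiv_at i \<phi> x * \<eta> x"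
proof -
  have "((\<lambda>x. \<phi> x * \<eta> x) has_derivative
    (\<lambda>h. \<phi> x * frechet_derivative \<eta> (at x) h + frechet_derivative \<phi> (at x) h * \<eta> x)) (at x)"
    using assms by (intro has_derivative_mult) (auto simp: frechet_derivative_works)
  then show ?thesis by (simp add: pderiv_at_eq) (simp add: pderiv_at_def)
qed

lemma C1c_mult:
  assumes "C1c \<phi>" "C1c \<eta>"
  shows "C1c (\<lambda>x. \<phi> x * \<eta> x)"
proof -
  have "pderiv_at i (\<lambda>x. \<phi> x * \<eta> x) = (\<lambda>x. \<phi> x * pderiv_at i \<eta> x + pderiv_at i \<phi> x * \<eta> x)" for i
    using assms by (intro ext pderiv_at_mult) (auto simp: C1c_def)
  then have "continuous_on UNIV (pderiv_at i (\<lambda>x. \<phi> x * \<eta> x))" for i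
    using assms C1c_continuous[of \<phi>] C1c_continuous[of \<eta>] by (auto simp: C1c_def intro!: continuous_intros)
  moreover obtain R where "\<forall>x. norm x > R \<longrightarrow> \<phi> x = 0" using assms(1) by (auto simp: C1c_def)
  then have "\<exists>R. \<forall>x. norm x > R \<longrightarrow> \<phi> x * \<eta> x = 0" by (intro exI[of _ R]) simp
  ultimately show ?thesis using assms by (simp add: C1c_def)
qed

lemma C1c_L2:
  assumes "C1c \<phi>"
  shows "\<phi> \<in> L2" "pderiv_at i \<phi> \<in> L2"
proof -
  obtain R where R: "\<And>x. norm x > R \<Longrightarrow> \<phi> x = 0" "\<And>x i. norm x > R \<Longrightarrow> pderiv_at i \<phi> x = 0"
    using C1c_support[OF assms] by blast
  show "\<phi> \<in> L2" by (rule continuous_compact_support_L2[OF C1c_continuous[OF assms] R(1)])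
  show "pderiv_at i \<phi> \<in> L2"
    by (rule continuous_compact_support_L2[of _ R]) (use assms R in \<open>auto simp: C1c_def\<close>)
qed

text \<open>Integration by parts is the vanishing of the integral of a derivative, applied to the
  product with the test function.\<close>

lemma C1c_weak_gradient:
  assumes \<phi>: "C1c \<phi>"
  shows "weak_gradient \<phi> (\<lambda>x. \<chi> i. pderiv_at i \<phi> x)"
  unfolding weak_gradient_def
proof (intro allI impI)
  fix \<eta> i assume "test_function \<eta>"
  then have \<eta>: "C1c \<eta>" by (rule test_function_C1c)
  have "0 = (LBINT x. pderiv_at i (\<lambda>x. \<phi> x * \<eta> x) x)"
    using integral_pderiv_zero[OF C1c_mult[OF \<phi> \<eta>]] by simp
  also have "\<dots> = (LBINT x. \<phi> x * pderiv_at i \<eta> x + pderiv_at i \<phi> x * \<eta> x)"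
    using \<phi> \<eta> by (simp add: pderiv_at_mult C1c_def)
  also have "\<dots> = (LBINT x. \<phi> x * pderiv_at i \<eta> x) + (LBINT x. pderiv_at i \<phi> x * \<eta> x)"
    using C1c_L2[OF \<phi>] C1c_L2[OF \<eta>] by (intro Bochner_Integration.integral_add L2_mult_integrable)
  finally show "(LBINT x. \<phi> x * pderiv_at i \<eta> x) =
     - (LBINT x. (\<chi> i. pderiv_at i \<phi> x) $ i * \<eta> x)" by simp
qed

lemma C1c_grad_L2:
  assumes \<phi>: "C1c \<phi>"
  shows "(\<lambda>x. \<chi> i. pderiv_at i \<phi> x) \<in> L2"
proof -
  obtain R where R: "\<And>x. norm x > R \<Longrightarrow> \<phi> x = 0" "\<And>x i. norm x > R \<Longrightarrow> pderiv_at i \<phi> x = 0"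
    using C1c_support[OF \<phi>] by blast
  have "continuous_on UNIV (\<lambda>x. \<chi> i. pderiv_at i \<phi> x)"
    by (rule continuous_on_vec_lambda) (use \<phi> in \<open>simp add: C1c_def\<close>)
  then show ?thesis
    by (rule continuous_compact_support_L2[where R = R]) (simp add: R vec_eq_iff)
qed

lemma C1c_H1: "C1c \<phi> \<Longrightarrow> \<phi> \<in> H1"
  using C1c_L2(1) C1c_grad_L2 C1c_weak_gradient by (auto simp: H1_def)

text \<open>A component of g - g' has integral 0 against every product of two bumps. These products
  converge to indicators of boxes, so all box integrals vanish.\<close>

lemma weak_gradient_unique:
  assumes w: "weak_gradient u g" "weak_gradient u g'" and L: "g \<in> L2" "g' \<in> L2"
  shows "AE x in lborel. g x = g' x"
proof -
  have "AE x in lborel. g x $ i - g' x $ i = 0" for i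
  proof (rule AE_zero_if_box_integrals_zero)
    define h where "h = (\<lambda>x. g x $ i - g' x $ i)"
    have hL: "h \<in> L2" unfolding h_def by (intro L2_diff L2_vec_nth L)
    then have m[measurable]: "h \<in> borel_measurable borel" by (rule L2D)
    then show "(\<lambda>x. g x $ i - g' x $ i) \<in> borel_measurable borel" by (simp add: h_def)
    show "set_integrable lborel (box a b) (\<lambda>x. g x $ i - g' x $ i)" for a b
    proof -
      have "(indicator (box a b) :: plane \<Rightarrow> real) \<in> L2"
        by (intro L2_indicator) (auto simp: emeasure_lborel_box_finite[simplified])
      from L2_mult_integrable[OF this hL] show ?thesis
        by (simp add: set_integrable_def h_def)
    qed
    show "(LBINT x:box a b. g x $ i - g' x $ i) = 0" for a b :: plane
    proof -
      define \<phi> :: "nat \<Rightarrow> plane \<Rightarrow> real" where "\<phi> = (\<lambda>n x. bump n (a $ 1) (b $ 1) (x $ 1) * bump n (a $ 2) (b $ 2) (x $ 2))"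
      have le: "0 \<le> \<phi> n x" "\<phi> n x \<le> indicator (box a b) x" for n and x :: plane
      proof -
        show "0 \<le> \<phi> n x" by (simp add: \<phi>_def bump_nonneg)
        have "\<phi> n x \<le> indicator {a $ 1 <..< b $ 1} (x $ 1) * indicator {a $ 2 <..< b $ 2} (x $ 2)"
          unfolding \<phi>_def by (intro mult_mono bump_le bump_nonneg) auto
        then show "\<phi> n x \<le> indicator (box a b) x"
          by (auto simp: indicator_def mem_box_cart forall_2 split: if_splits)
      qed
      obtain R where "box a b \<subseteq> cball 0 R"
          by (metis bounded_box bounded_subset_ballD ball_subset_cball subset_trans)
      have test: "test_function (\<phi> n)" for n
      proof (rule smooth_plane_test[where R = R])
        show "smooth_plane (\<phi> n)" unfolding \<phi>_def
          by (rule smooth_plane.mult[OF smooth_plane.comp[OF smooth_plane.coord smooth_bump]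
                smooth_plane.comp[OF smooth_plane.coord smooth_bump]])
        show "\<phi> n x = 0" if "norm x > R" for x
        proof -
          have "x \<notin> box a b" using that \<open>box a b \<subseteq> cball 0 R\<close> by auto
          then show ?thesis using le[of n x] by simp
        qed
      qed
      have z: "(LBINT x. \<phi> n x * h x) = 0" for n
      proof -
        have "(LBINT x. \<phi> n x * h x) = (LBINT x. g x $ i * \<phi> n x - g' x $ i * \<phi> n x)"
          by (simp add: h_def algebra_simps)
        also have "\<dots> = (LBINT x. g x $ i * \<phi> n x) - (LBINT x. g' x $ i * \<phi> n x)"
          using L C1c_L2(1)[OF test_function_C1c[OF test]]
          by (intro Bochner_Integration.integral_diff L2_mult_integrable L2_vec_nth)
        also have "\<dots> = 0" using w test[of n] unfolding weak_gradient_def by fastforce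
        finally show ?thesis .
      qed
      have "(\<lambda>n. LBINT x. \<phi> n x * h x) \<longlonglongrightarrow> (LBINT x. indicator (box a b) x * h x)"
      proof (rule integral_dominated_convergence[where w = "\<lambda>x. \<bar>indicator (box a b) x * h x\<bar>"])
        have "(indicator (box a b) :: plane \<Rightarrow> real) \<in> L2"
          by (intro L2_indicator) (auto simp: emeasure_lborel_box_finite[simplified])
        from L2_mult_integrable[OF this hL]
        show "integrable lborel (\<lambda>x. \<bar>indicator (box a b) x * h x\<bar>)" by simp
        have [measurable]: "\<phi> n \<in> borel_measurable borel" for n
          using L2D(1)[OF C1c_L2(1)[OF test_function_C1c[OF test]]] .
        show "(\<lambda>x. \<phi> n x * h x) \<in> borel_measurable lborel" for n by simp
        show "(\<lambda>x. indicator (box a b) x * h x) \<in> borel_measurable lborel" by simp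
        show "AE x in lborel. (\<lambda>n. \<phi> n x * h x) \<longlonglongrightarrow> indicator (box a b) x * h x"
        proof (rule AE_I2)
          fix x :: plane
          have "(\<lambda>n. \<phi> n x) \<longlonglongrightarrow> indicator {a $ 1 <..< b $ 1} (x $ 1) * indicator {a $ 2 <..< b $ 2} (x $ 2)"
            unfolding \<phi>_def by (intro tendsto_mult bump_tendsto)
          also have "indicator {a $ 1 <..< b $ 1} (x $ 1) * indicator {a $ 2 <..< b $ 2} (x $ 2) = (indicator (box a b) x :: real)"
            by (auto simp: indicator_def mem_box_cart forall_2)
          finally show "(\<lambda>n. \<phi> n x * h x) \<longlonglongrightarrow> indicator (box a b) x * h x"
            by (intro tendsto_mult tendsto_const)
        qed
        show "AE x in lborel. norm (\<phi> n x * h x) \<le> \<bar>indicator (box a b) x * h x\<bar>" for n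
          using le by (auto simp: abs_mult intro!: mult_right_mono)
      qed
      then have "(LBINT x. indicator (box a b) x * h x) = 0"
        using z by (simp add: LIMSEQ_const_iff)
      then show ?thesis by (simp add: set_lebesgue_integral_def h_def)
    qed
  qed
  then have "AE x in lborel. \<forall>i. g x $ i - g' x $ i = 0"
    by (subst AE_all_countable) auto
  then show ?thesis by eventually_elim (simp add: vec_eq_iff)
qed

lemma grad_H1:
  assumes "u \<in> H1"
  shows "grad u \<in> L2" "weak_gradient u (grad u)"
proof -
  have "\<exists>g. g \<in> L2 \<and> weak_gradient u g" using assms by (auto simp: H1_def)
  then have "grad u \<in> L2 \<and> weak_gradient u (grad u)"
    unfolding grad_def by (rule someI_ex)
  then show "grad u \<in> L2" "weak_gradient u (grad u)" by auto
qed

lemma grad_AE_eq: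
  assumes "u \<in> L2" "g \<in> L2" "weak_gradient u g"
  shows "AE x in lborel. grad u x = g x"
proof -
  have "u \<in> H1" using assms by (auto simp: H1_def)
  from grad_H1[OF this] assms show ?thesis by (intro weak_gradient_unique)
qed

lemma L2_sq_cong_AE:
  assumes "u \<in> L2" "v \<in> L2" "AE x in lborel. u x = v x"
  shows "L2_sq u = L2_sq v"
proof -
  have [measurable]: "u \<in> borel_measurable borel" "v \<in> borel_measurable borel"
    using assms by (auto intro: L2D)
  show ?thesis unfolding L2_sq_def
    by (rule integral_cong_AE) (use assms(3) in \<open>auto elim: eventually_mono\<close>)
qed

lemma weak_gradient_cong_AE:
  assumes "weak_gradient u g" "u \<in> L2" "v \<in> L2" "AE x in lborel. u x = v x"
  shows "weak_gradient v g"
  unfolding weak_gradient_def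
proof (intro allI impI)
  fix \<phi> i assume t: "test_function \<phi>"
  have [measurable]: "u \<in> borel_measurable borel" "v \<in> borel_measurable borel" "pderiv_at i \<phi> \<in> borel_measurable borel"
    using assms C1c_L2(2)[OF test_function_C1c[OF t]] by (auto intro: L2D)
  have "(LBINT x. v x * pderiv_at i \<phi> x) = (LBINT x. u x * pderiv_at i \<phi> x)"
    by (rule integral_cong_AE) (use assms(4) in \<open>auto elim: eventually_mono\<close>)
  then show "(LBINT x. v x * pderiv_at i \<phi> x) = - (LBINT x. g x $ i * \<phi> x)"
    using assms(1) t by (simp add: weak_gradient_def)
qed

lemma L2_sq_grad_cong_AE:
  assumes "u \<in> H1" "v \<in> H1" "AE x in lborel. u x = v x"
  shows "L2_sq (grad u) = L2_sq (grad v)"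
proof -
  have L: "u \<in> L2" "v \<in> L2" using assms by (auto simp: H1_def)
  have "AE x in lborel. grad v x = grad u x"
    by (rule grad_AE_eq[OF L(2) grad_H1(1)[OF assms(1)]
          weak_gradient_cong_AE[OF grad_H1(2)[OF assms(1)] L assms(3)]])
  then show ?thesis using L2_sq_cong_AE[OF grad_H1(1)[OF assms(2)] grad_H1(1)[OF assms(1)]] by simp
qed

lemma weak_gradient_diff:
  assumes "u \<in> H1" "v \<in> H1"
  shows "weak_gradient (\<lambda>x. u x - v x) (\<lambda>x. grad u x - grad v x)"
  unfolding weak_gradient_def
proof (intro allI impI)
  fix \<phi> i assume t: "test_function \<phi>"
  have L: "u \<in> L2" "v \<in> L2" using assms by (auto simp: H1_def)
  have \<phi>: "C1c \<phi>" using t by (rule test_function_C1c)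
  have "(LBINT x. (u x - v x) * pderiv_at i \<phi> x) =
     (LBINT x. u x * pderiv_at i \<phi> x) - (LBINT x. v x * pderiv_at i \<phi> x)"
    unfolding left_diff_distrib
    by (intro Bochner_Integration.integral_diff L2_mult_integrable L C1c_L2 \<phi>)
  also have "\<dots> = - ((LBINT x. grad u x $ i * \<phi> x) - (LBINT x. grad v x $ i * \<phi> x))"
    using grad_H1(2)[OF assms(1)] grad_H1(2)[OF assms(2)] t by (simp add: weak_gradient_def)
  also have "(LBINT x. grad u x $ i * \<phi> x) - (LBINT x. grad v x $ i * \<phi> x) =
     (LBINT x. grad u x $ i * \<phi> x - grad v x $ i * \<phi> x)"
    by (intro Bochner_Integration.integral_diff[symmetric] L2_mult_integrable L2_vec_nth grad_H1 assms C1c_L2 \<phi>)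
  finally show "(LBINT x. (u x - v x) * pderiv_at i \<phi> x) =
     - (LBINT x. (grad u x - grad v x) $ i * \<phi> x)"
    by (simp add: left_diff_distrib)
qed

lemma L2_sq_nonneg: "0 \<le> L2_sq u"
  by (simp add: L2_sq_def)

text \<open>With d = g' - g, the integrand |g'|^2 - |g|^2 equals 2 g.d + |d|^2; Cauchy-Schwarz
  bounds the mixed term. It supplies the continuity of the Dirichlet integral along paths.\<close>

lemma L2_sq_perturb:
  fixes g d :: "plane \<Rightarrow> 'b::euclidean_space"
  assumes g: "g \<in> L2" and g': "g' \<in> L2"
  shows "\<bar>L2_sq g' - L2_sq g\<bar> \<le> 2 * sqrt (L2_sq g) * sqrt (L2_sq (\<lambda>x. g' x - g x)) + L2_sq (\<lambda>x. g' x - g x)"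
proof -
  define d where "d = (\<lambda>x. g' x - g x)"
  have d: "d \<in> L2" unfolding d_def by (intro L2_diff g g')
  have [measurable]: "g \<in> borel_measurable borel" "d \<in> borel_measurable borel"
    using g d by (auto intro: L2D)
  have i: "integrable lborel (\<lambda>x. norm (g x) * norm (d x))"
    by (rule integrable_mult_sq) (use L2D(2)[OF g] L2D(2)[OF d] in auto)
  have "L2_sq g' - L2_sq g = (LBINT x. (norm (g' x))\<^sup>2 - (norm (g x))\<^sup>2)"
    unfolding L2_sq_def by (intro Bochner_Integration.integral_diff[symmetric] L2D g g')
  also have "\<bar>\<dots>\<bar> \<le> (LBINT x. \<bar>(norm (g' x))\<^sup>2 - (norm (g x))\<^sup>2\<bar>)"
    by (rule integral_abs_bound)
  also have "\<dots> \<le> (LBINT x. 2 * (norm (g x) * norm (d x)) + (norm (d x))\<^sup>2)"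
  proof (rule integral_mono)
    show "integrable lborel (\<lambda>x. \<bar>(norm (g' x))\<^sup>2 - (norm (g x))\<^sup>2\<bar>)" using L2D(2)[OF g] L2D(2)[OF g'] by auto
    show "integrable lborel (\<lambda>x. 2 * (norm (g x) * norm (d x)) + (norm (d x))\<^sup>2)"
      using i L2D(2)[OF d] by auto
    fix x
    have "(norm (g' x))\<^sup>2 - (norm (g x))\<^sup>2 = 2 * (g x \<bullet> d x) + (norm (d x))\<^sup>2"
      by (simp add: d_def power2_norm_eq_inner algebra_simps inner_commute)
    moreover have "\<bar>g x \<bullet> d x\<bar> \<le> norm (g x) * norm (d x)" by (rule Cauchy_Schwarz_ineq2)
    ultimately show "\<bar>(norm (g' x))\<^sup>2 - (norm (g x))\<^sup>2\<bar> \<le> 2 * (norm (g x) * norm (d x)) + (norm (d x))\<^sup>2"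
      using zero_le_power2[of "norm (d x)"] by linarith
  qed
  also have "\<dots> = 2 * (LBINT x. norm (g x) * norm (d x)) + L2_sq d"
    using i L2D(2)[OF d] by (simp add: L2_sq_def)
  also have "(LBINT x. norm (g x) * norm (d x)) \<le> sqrt (L2_sq g * L2_sq d)"
    unfolding L2_sq_def
    by (intro real_le_rsqrt Cauchy_Schwarz_integral) (use L2D(2)[OF g] L2D(2)[OF d] in auto)
  finally show ?thesis by (simp add: d_def real_sqrt_mult)
qed

section \<open>Radial functions and the variable \<open>|x|\<^sup>2\<close>\<close>

text \<open>The disc |x|^2 \<le> r has area \<pi> r, linear in r; this is why the squared radius is
  the convenient variable. Agreement on the half-lines \<open>{..r}\<close>, which generate the
  Borel sets, is enough.\<close>

lemma distr_norm_sq: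
  "distr lborel borel (\<lambda>x::plane. (norm x)\<^sup>2) = density lborel (\<lambda>s::real. ennreal (pi * indicator {0<..} s))"
    (is "?M = ?N")
proof -
  have M: "emeasure ?M {..r} = ennreal (pi * max 0 r)" for r
  proof -
    have "emeasure ?M {..r} = emeasure lborel {x::plane. (norm x)\<^sup>2 \<le> r}"
      by (subst emeasure_distr) (auto intro!: arg_cong2[where f = emeasure])
    also have "\<dots> = ennreal (pi * max 0 r)"
    proof (cases "r \<ge> 0")
      case True
      have "{x::plane. (norm x)\<^sup>2 \<le> r} = cball 0 (sqrt r)"
        using True by (auto simp: real_le_rsqrt real_le_lsqrt sqrt_ge_absD abs_le_square_iff[symmetric])
      then show ?thesis
        using True by (simp add: emeasure_cball unit_ball_vol_2)
    next
      case False
      then have "{x::plane. (norm x)\<^sup>2 \<le> r} = {}"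
        by (auto simp: not_le) (meson less_le_trans not_less zero_le_power2)
      then show ?thesis using False by simp
    qed
    finally show ?thesis .
  qed
  have N: "emeasure ?N {..r} = ennreal (pi * max 0 r)" for r
  proof -
    have "emeasure ?N {..r} = (\<integral>\<^sup>+ s. ennreal pi * indicator {0<..r} s \<partial>lborel)"
      by (subst emeasure_density) (auto intro!: nn_integral_cong simp: indicator_def)
    also have "\<dots> = ennreal pi * emeasure lborel {0<..r}"
      by (subst nn_integral_cmult_indicator) auto
    also have "emeasure lborel {0<..r} = ennreal (max 0 r)"
      by (cases "0 \<le> r") (auto simp: max_def)
    finally show ?thesis by (simp add: ennreal_mult)
  qed
  have sb: "sets (borel :: real measure) = sigma_sets UNIV (range atMost)"
    by (subst borel_eq_atMost) simp
  show ?thesis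
  proof (rule measure_eqI_generator_eq[where E = "range atMost" and \<Omega> = UNIV and A = "\<lambda>n. {..real n}"])
    show "Int_stable (range (atMost :: real \<Rightarrow> _))"
      by (auto simp: Int_stable_def intro!: image_eqI[of _ _ "min _ _"])
    show "sets ?M = sigma_sets UNIV (range atMost)" "sets ?N = sigma_sets UNIV (range atMost)"
      using sb by simp_all
    show "(\<Union>n. {..real n}) = UNIV" by (auto intro: real_arch_simple)
    show "emeasure ?M {..real n} \<noteq> \<infinity>" for n by (simp add: M)
  qed (auto simp: M N)
qed

lemma AE_norm_sq:
  assumes "AE s in lborel. s > 0 \<longrightarrow> P s"
  shows "AE x in lborel. P ((norm (x::plane))\<^sup>2)"
proof (rule AE_distrD[where f = "\<lambda>x::plane. (norm x)\<^sup>2" and P = P and M' = borel])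
  show "(\<lambda>x::plane. (norm x)\<^sup>2) \<in> lborel \<rightarrow>\<^sub>M borel" by simp
  show "AE s in distr lborel borel (\<lambda>x::plane. (norm x)\<^sup>2). P s"
    unfolding distr_norm_sq using assms
    by (subst AE_density) (auto elim!: eventually_mono simp: ennreal_mult)
qed

lemma integral_norm_sq:
  fixes F :: "real \<Rightarrow> real"
  assumes [measurable]: "F \<in> borel_measurable borel"
  shows "(LBINT x. F ((norm (x::plane))\<^sup>2)) = pi * (LBINT s:{0<..}. F s)"
proof -
  have "(LBINT x. F ((norm (x::plane))\<^sup>2)) = integral\<^sup>L (distr lborel borel (\<lambda>x::plane. (norm x)\<^sup>2)) F"
    by (subst integral_distr) auto
  also have "\<dots> = (LBINT s. (pi * indicator {0<..} s) *\<^sub>R F s)"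
    unfolding distr_norm_sq by (subst integral_density) auto
  also have "\<dots> = pi * (LBINT s:{0<..}. F s)"
    unfolding set_lebesgue_integral_def by (subst integral_mult_right_zero[symmetric]) (simp add: mult.assoc)
  finally show ?thesis .
qed

lemma integrable_norm_sq_iff:
  fixes F :: "real \<Rightarrow> real"
  assumes [measurable]: "F \<in> borel_measurable borel"
  shows "integrable lborel (\<lambda>x::plane. F ((norm x)\<^sup>2)) \<longleftrightarrow> set_integrable lborel {0<..} F"
proof -
  have "integrable lborel (\<lambda>x::plane. F ((norm x)\<^sup>2)) \<longleftrightarrow>
     integrable (distr lborel borel (\<lambda>x::plane. (norm x)\<^sup>2)) F"
    by (subst integrable_distr_eq) auto
  also have "\<dots> \<longleftrightarrow> integrable lborel (\<lambda>s. (pi * indicator {0<..} s) *\<^sub>R F s)"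
    unfolding distr_norm_sq by (subst integrable_density) auto
  also have "\<dots> \<longleftrightarrow> integrable lborel (\<lambda>s. pi * (indicator {0<..} s *\<^sub>R F s))"
    by (simp add: mult.assoc)
  also have "\<dots> \<longleftrightarrow> set_integrable lborel {0<..} F"
    unfolding set_integrable_def by (subst integrable_mult_left_iff) auto
  finally show ?thesis .
qed

text \<open>Exceptional sets defined through a nonmeasurable profile need not be Borel.
  Negligibility does not require that, and it passes to images under differentiable maps of the
  line.\<close>

lemma AE_lborel_iff_negligible: "(AE x in lborel. P x) \<longleftrightarrow> negligible {x. \<not> P x}"
proof
  assume "AE x in lborel. P x"
  then obtain N where "N \<in> null_sets lborel" "{x. \<not> P x} \<subseteq> N"
    by (auto simp: eventually_ae_filter)
  then show "negligible {x. \<not> P x}"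
    by (meson negligible_iff_null_sets negligible_subset null_sets_completionI)
next
  assume "negligible {x. \<not> P x}"
  then obtain N where "N \<in> null_sets lborel" "{x. \<not> P x} \<subseteq> N"
    by (auto simp: negligible_iff_null_sets null_sets_completion_iff2)
  then show "AE x in lborel. P x"
    by (auto simp: eventually_ae_filter)
qed

lemma AE_lborel_ex_between:
  assumes "AE t in lborel. P t" "(a::real) < b"
  shows "\<exists>t\<in>{a<..<b}. P t"
proof (rule ccontr)
  assume *: "\<not> ?thesis"
  have "negligible {t. \<not> P t}" using assms(1) by (simp add: AE_lborel_iff_negligible)
  then have "negligible {a<..<b}" by (rule negligible_subset) (use * in auto)
  then show False using assms(2) open_not_negligible[of "{a<..<b}"] by auto
qed

section \<open>Borel profiles of radial functions\<close>

definition plane_of :: "real \<times> real \<Rightarrow> plane" where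
  "plane_of p = (\<chi> i. if i = 1 then fst p else snd p)"

lemma plane_of_nth [simp]: "plane_of p $ 1 = fst p" "plane_of p $ 2 = snd p"
  by (auto simp: plane_of_def)

lemma continuous_plane_of: "continuous_on A plane_of"
  unfolding plane_of_def
proof (rule continuous_on_vec_lambda)
  show "continuous_on A (\<lambda>p. if i = 1 then fst p else snd p)" for i :: 2
    by (cases "i = 1") (auto intro!: continuous_intros)
qed

lemma measurable_plane_of [measurable]: "plane_of \<in> borel \<rightarrow>\<^sub>M borel"
  by (rule borel_measurable_continuous_onI[OF continuous_plane_of])

lemma distr_plane_of: "distr (lborel \<Otimes>\<^sub>M lborel) borel plane_of = lborel"
proof (rule lborel_eqI[symmetric])
  fix l u :: plane assume le: "\<And>b. b \<in> Basis \<Longrightarrow> l \<bullet> b \<le> u \<bullet> b"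
  have le12: "l $ 1 \<le> u $ 1" "l $ 2 \<le> u $ 2"
    using le[of "axis 1 1"] le[of "axis 2 1"] by (auto simp: inner_axis axis_in_Basis_iff)
  have B: "(Basis :: plane set) = {axis 1 1, axis 2 1}"
    by (auto simp: Basis_vec_def UNIV_2)
  have ne: "axis 1 1 \<noteq> (axis 2 1 :: plane)" by (simp add: axis_eq_axis)
  have v: "plane_of -` box l u = {l $ 1 <..< u $ 1} \<times> {l $ 2 <..< u $ 2}"
    by (auto simp: mem_box_cart forall_2)
  have "emeasure (distr (lborel \<Otimes>\<^sub>M lborel) borel plane_of) (box l u)
     = emeasure (lborel \<Otimes>\<^sub>M lborel) ({l $ 1 <..< u $ 1} \<times> {l $ 2 <..< u $ 2})"
    by (subst emeasure_distr) (auto simp: v lborel_prod space_pair_measure)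
  also have "\<dots> = ennreal (u $ 1 - l $ 1) * ennreal (u $ 2 - l $ 2)"
    using le12 by (subst lborel.emeasure_pair_measure_Times) auto
  also have "\<dots> = (\<Prod>b\<in>Basis. (u - l) \<bullet> b)"
    unfolding B using ne le12 by (simp add: inner_axis ennreal_mult)
  finally show "emeasure (distr (lborel \<Otimes>\<^sub>M lborel) borel plane_of) (box l u) = (\<Prod>b\<in>Basis. (u - l) \<bullet> b)" .
qed simp

lemma norm_plane_of: "norm (plane_of p) = sqrt ((fst p)\<^sup>2 + (snd p)\<^sup>2)"
  by (simp add: norm_vec_def L2_set_def UNIV_2 plane_of_def)

text \<open>The profile in the definition of \<open>radial\<close> need not be measurable. By Fubini it agrees almost
  everywhere on \<open>(t, \<infinity>)\<close> with a Borel function read off from the restriction of \<open>u\<close> to a line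
  at distance \<open>t\<close> from the origin, for almost every small \<open>t\<close>.\<close>

lemma radial_Borel_profile:
  assumes [measurable]: "u \<in> borel_measurable borel" and "radial u"
  obtains w where "w \<in> borel_measurable borel" "AE x in lborel. u x = w ((norm (x::plane))\<^sup>2)"
proof -
  obtain v where "AE x in lborel. u x = v (norm x)" using assms(2) by (auto simp: radial_def)
  then have "AE x in distr (lborel \<Otimes>\<^sub>M lborel) borel plane_of. u x = v (norm x)"
    unfolding distr_plane_of .
  then have "AE p in lborel \<Otimes>\<^sub>M lborel. u (plane_of p) = v (norm (plane_of p))"
    by (rule AE_distrD[rotated, where P = "\<lambda>x. u x = v (norm x)" and f = plane_of and M' = borel])
      (simp add: lborel_prod)
  then have ae: "AE t in lborel. AE r in lborel. u (plane_of (t, r)) = v (norm (plane_of (t, r)))"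
    by (rule lborel_pair.AE_pair)
  define G where "G = (\<lambda>t. AE r in lborel. u (plane_of (t, r)) = v (norm (plane_of (t, r))))"
  have "\<exists>t\<in>{0<..<1 / real (Suc n)}. G t" for n
    using AE_lborel_ex_between[OF ae[folded G_def], of 0 "1 / real (Suc n)"] by simp
  then obtain t where t: "\<And>n. 0 < t n" "\<And>n. t n < 1 / real (Suc n)" "\<And>n. G (t n)"
    by (metis greaterThanLessThan_iff)
  have good: "AE r in lborel. u (plane_of (t n, r)) = v (norm (plane_of (t n, r)))" for n
    using t(3)[of n] unfolding G_def .
  have ex: "\<exists>n. (t n)\<^sup>2 < s" if "s > 0" for s
  proof -
    obtain n where n: "1 / real (Suc n) < sqrt s"
      using \<open>s > 0\<close> reals_Archimedean[of "sqrt s"] by (auto simp: inverse_eq_divide)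
    have "(t n)\<^sup>2 < (sqrt s)\<^sup>2"
      using t(1,2)[of n] n by (intro power_strict_mono) auto
    then show ?thesis using that by auto
  qed
  \<comment> \<open>Many lines lie close enough to the origin to reach radius sqrt s. Taking the
    least index is a measurable choice with countable range, so w is Borel although v may not
    be.\<close>
  define N where "N = (\<lambda>s. LEAST n. (t n)\<^sup>2 < s)"
  define w where "w = (\<lambda>s. u (plane_of (t (N s), sqrt (s - (t (N s))\<^sup>2))))"
  have [measurable]: "N \<in> borel \<rightarrow>\<^sub>M count_space UNIV"
    unfolding N_def by measurable
  have w: "w \<in> borel_measurable borel"
    unfolding w_def
  proof (rule measurable_compose_countable[where f = "\<lambda>n s. u (plane_of (t n, sqrt (s - (t n)\<^sup>2)))" and g = N])
    show "(\<lambda>s. u (plane_of (t n, sqrt (s - (t n)\<^sup>2)))) \<in> borel_measurable borel" for n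
    proof -
      have "(\<lambda>s. (t n, sqrt (s - (t n)\<^sup>2))) \<in> borel \<rightarrow>\<^sub>M borel"
        by (intro borel_measurable_continuous_onI continuous_intros)
      then show ?thesis by measurable
    qed
  qed measurable
  have "AE s in lborel. \<forall>n. (t n)\<^sup>2 < s \<longrightarrow> u (plane_of (t n, sqrt (s - (t n)\<^sup>2))) = v (sqrt s)"
  proof (subst AE_all_countable, intro allI)
    fix n
    let ?bad = "{r. u (plane_of (t n, r)) \<noteq> v (norm (plane_of (t n, r)))}"
    \<comment> \<open>On the line at distance t n the squared radius is (t n)^2 + r^2. The bad
      values of s are images of bad r under this differentiable map, which sends null sets to null
      sets.\<close>
    have "negligible ((\<lambda>r. (t n)\<^sup>2 + r\<^sup>2) ` ?bad)"
    proof (rule negligible_differentiable_image_negligible)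
      show "negligible ?bad" using good[of n] by (simp add: AE_lborel_iff_negligible)
      show "(\<lambda>r. (t n)\<^sup>2 + r\<^sup>2) differentiable_on ?bad"
        by (auto simp: differentiable_on_def intro!: derivative_intros)
    qed simp
    then have "negligible {s. \<not> ((t n)\<^sup>2 < s \<longrightarrow> u (plane_of (t n, sqrt (s - (t n)\<^sup>2))) = v (sqrt s))}"
    proof (rule negligible_subset)
      show "{s. \<not> ((t n)\<^sup>2 < s \<longrightarrow> u (plane_of (t n, sqrt (s - (t n)\<^sup>2))) = v (sqrt s))}
        \<subseteq> (\<lambda>r. (t n)\<^sup>2 + r\<^sup>2) ` ?bad"
      proof
        fix s assume "s \<in> {s. \<not> ((t n)\<^sup>2 < s \<longrightarrow> u (plane_of (t n, sqrt (s - (t n)\<^sup>2))) = v (sqrt s))}"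
        then have "(t n)\<^sup>2 < s" "u (plane_of (t n, sqrt (s - (t n)\<^sup>2))) \<noteq> v (sqrt s)" by auto
        then show "s \<in> (\<lambda>r. (t n)\<^sup>2 + r\<^sup>2) ` ?bad"
          by (intro image_eqI[of _ _ "sqrt (s - (t n)\<^sup>2)"]) (auto simp: norm_plane_of)
      qed
    qed
    then show "AE s in lborel. (t n)\<^sup>2 < s \<longrightarrow> u (plane_of (t n, sqrt (s - (t n)\<^sup>2))) = v (sqrt s)"
      by (simp add: AE_lborel_iff_negligible)
  qed
  then have "AE s in lborel. s > 0 \<longrightarrow> w s = v (sqrt s)"
  proof eventually_elim
    case (elim s)
    show ?case
    proof
      assume "s > 0"
      then have "(t (N s))\<^sup>2 < s" unfolding N_def using LeastI_ex[OF ex] by blast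
      with elim show "w s = v (sqrt s)" by (simp add: w_def)
    qed
  qed
  then have "AE x in lborel. w ((norm (x::plane))\<^sup>2) = v (sqrt ((norm x)\<^sup>2))"
    by (rule AE_norm_sq[where P = "\<lambda>s. w s = v (sqrt s)"])
  moreover note \<open>AE x in lborel. u x = v (norm x)\<close>
  ultimately have "AE x in lborel. u x = w ((norm x)\<^sup>2)"
    by eventually_elim simp
  with w that show ?thesis by blast
qed

text \<open>The normalization by |x|^2 fits the variable s = |x|^2: for a smooth W, the gradient 2
  W'(|x|^2) x of W(|x|^2) has radial part 2 W'(|x|^2) away from the origin.\<close>

definition radial_part :: "(plane \<Rightarrow> plane) \<Rightarrow> plane \<Rightarrow> real" where
  "radial_part g x = (g x \<bullet> x) / (norm x)\<^sup>2"

text \<open>Split the product as (g.x / |x|) (F / |x|). The first factor is at most |g|, the square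
  of the second has integral \<pi> times that of F^2/s, and Cauchy-Schwarz combines them.\<close>

lemma radial_part_weighted:
  assumes g: "g \<in> L2" and [measurable]: "F \<in> borel_measurable borel"
    and F: "set_integrable lborel {0<..} (\<lambda>s. (F s)\<^sup>2 / s)"
  shows "integrable lborel (\<lambda>x. radial_part g x * F ((norm x)\<^sup>2))"
    and "(LBINT x. radial_part g x * F ((norm x)\<^sup>2))\<^sup>2
       \<le> L2_sq g * (pi * (LBINT s:{0<..}. (F s)\<^sup>2 / s))"
proof -
  have [measurable]: "g \<in> borel_measurable borel" using g by (rule L2D)
  define A where "A = (\<lambda>x. (g x \<bullet> x) / norm x)"
  define B where "B = (\<lambda>x::plane. F ((norm x)\<^sup>2) / norm x)"
  have [measurable]: "A \<in> borel_measurable borel" "B \<in> borel_measurable borel"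
    by (simp_all add: A_def B_def)
  have eq: "radial_part g x * F ((norm x)\<^sup>2) = A x * B x" for x
    by (simp add: radial_part_def A_def B_def power2_eq_square)
  have A_le: "(A x)\<^sup>2 \<le> (norm (g x))\<^sup>2" for x
  proof (cases "x = 0")
    case False
    have "\<bar>g x \<bullet> x\<bar> \<le> norm (g x) * norm x" by (rule Cauchy_Schwarz_ineq2)
    then have "\<bar>A x\<bar> \<le> norm (g x)" using False by (simp add: A_def field_simps)
    then show ?thesis by (simp add: abs_le_square_iff[symmetric])
  qed (simp add: A_def)
  have A2: "integrable lborel (\<lambda>x. (A x)\<^sup>2)"
    by (rule Bochner_Integration.integrable_bound[OF L2D(2)[OF g]]) (use A_le in auto)
  have B2: "(\<lambda>x. (B x)\<^sup>2) = (\<lambda>x. (F ((norm x)\<^sup>2))\<^sup>2 / (norm x)\<^sup>2)"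
    by (simp add: B_def power_divide)
  have B2i: "integrable lborel (\<lambda>x. (B x)\<^sup>2)"
    unfolding B2 by (subst integrable_norm_sq_iff[of "\<lambda>s. (F s)\<^sup>2 / s"]) (use F in auto)
  show "integrable lborel (\<lambda>x. radial_part g x * F ((norm x)\<^sup>2))"
    unfolding eq by (rule integrable_mult_sq) (use A2 B2i in auto)
  have "(LBINT x. A x * B x)\<^sup>2 \<le> (LBINT x. (A x)\<^sup>2) * (LBINT x. (B x)\<^sup>2)"
    by (rule Cauchy_Schwarz_integral) (use A2 B2i in auto)
  also have "\<dots> \<le> L2_sq g * (LBINT x. (B x)\<^sup>2)"
    unfolding L2_sq_def by (intro mult_right_mono integral_mono A2 L2D(2)[OF g] A_le) auto
  also have "(LBINT x. (B x)\<^sup>2) = pi * (LBINT s:{0<..}. (F s)\<^sup>2 / s)"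
    unfolding B2 by (rule integral_norm_sq) simp
  finally show "(LBINT x. radial_part g x * F ((norm x)\<^sup>2))\<^sup>2
       \<le> L2_sq g * (pi * (LBINT s:{0<..}. (F s)\<^sup>2 / s))"
    unfolding eq .
qed

text \<open>The weight ds/s is the source of the logarithm in the modulus of continuity of the
  profile.\<close>

lemma weight_integrable:
  fixes F :: "real \<Rightarrow> real"
  assumes [measurable]: "F \<in> borel_measurable borel" and "0 < a" "a \<le> b"
    and F: "\<And>s. \<bar>F s\<bar> \<le> B * indicator {a..b} s"
  shows "set_integrable lborel {0<..} (\<lambda>s. (F s)\<^sup>2 / s)"
    and "(LBINT s:{0<..}. (F s)\<^sup>2 / s) \<le> B\<^sup>2 * (ln b - ln a)"
proof -
  have i: "has_bochner_integral lborel (\<lambda>s. (B\<^sup>2 / s) * indicator {a..b} s) (B\<^sup>2 * ln b - B\<^sup>2 * ln a)"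
    using assms(2,3)
    by (intro has_bochner_integral_FTC_Icc_real) (auto intro!: derivative_eq_intros continuous_intros)
  have le: "0 \<le> indicator {0<..} s *\<^sub>R ((F s)\<^sup>2 / s)"
    "indicator {0<..} s *\<^sub>R ((F s)\<^sup>2 / s) \<le> (B\<^sup>2 / s) * indicator {a..b} s" for s
  proof -
    show "0 \<le> indicator {0<..} s *\<^sub>R ((F s)\<^sup>2 / s)" by (simp add: indicator_def)
    have "(F s)\<^sup>2 \<le> B\<^sup>2 * indicator {a..b} s"
      using F[of s] by (cases "s \<in> {a..b}") (auto simp: abs_le_square_iff[symmetric])
    then show "indicator {0<..} s *\<^sub>R ((F s)\<^sup>2 / s) \<le> (B\<^sup>2 / s) * indicator {a..b} s"
      using assms(2) by (cases "s > 0") (auto simp: divide_right_mono indicator_def split: if_splits)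
  qed
  have le_norm: "norm (indicator {0<..} s *\<^sub>R ((F s)\<^sup>2 / s)) \<le> norm ((B\<^sup>2 / s) * indicator {a..b} s)" for s
    using le[of s] unfolding real_norm_def by linarith
  have i1: "integrable lborel (\<lambda>s. indicator {0<..} s *\<^sub>R ((F s)\<^sup>2 / s))"
    by (rule Bochner_Integration.integrable_bound[where f = "\<lambda>s. (B\<^sup>2 / s) * indicator {a..b} s"])
      (use i AE_I2[OF le_norm] in \<open>simp_all only: has_bochner_integral_iff, measurable\<close>)
  then show "set_integrable lborel {0<..} (\<lambda>s. (F s)\<^sup>2 / s)" by (simp add: set_integrable_def)
  have "(LBINT s:{0<..}. (F s)\<^sup>2 / s) \<le> (LBINT s. (B\<^sup>2 / s) * indicator {a..b} s)"
    unfolding set_lebesgue_integral_def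
    using i1 i le(2) by (intro integral_mono) (auto simp: has_bochner_integral_iff)
  also have "\<dots> = B\<^sup>2 * (ln b - ln a)"
    using i by (simp add: has_bochner_integral_iff right_diff_distrib)
  finally show "(LBINT s:{0<..}. (F s)\<^sup>2 / s) \<le> B\<^sup>2 * (ln b - ln a)" .
qed

lemma has_derivative_norm_sq:
  "((\<lambda>x::plane. (norm x)\<^sup>2) has_derivative (\<lambda>h. 2 * (x \<bullet> h))) (at x)"
  unfolding power2_norm_eq_inner
  by (rule has_derivative_eq_rhs[OF has_derivative_inner[OF has_derivative_ident has_derivative_ident]])
    (auto simp: inner_commute)

lemma smooth_plane_norm_sq: "smooth_plane (\<lambda>x. (norm x)\<^sup>2)"
proof -
  have "(\<lambda>x::plane. (norm x)\<^sup>2) = (\<lambda>x. x $ 1 * x $ 1 + x $ 2 * x $ 2)"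
    by (auto simp: power2_norm_eq_inner inner_vec_def UNIV_2)
  then show ?thesis
    by (simp only:) (rule smooth_plane.add[OF smooth_plane.mult[OF smooth_plane.coord smooth_plane.coord]
       smooth_plane.mult[OF smooth_plane.coord smooth_plane.coord]])
qed

text \<open>Tests the weak gradient with the vector field \<open>\<Psi>(|x|\<^sup>2) x / |x|\<^sup>2\<close>, whose divergence
  is \<open>2 \<Psi>'(|x|\<^sup>2)\<close>.\<close>

lemma weak_gradient_radial:
  assumes u: "u \<in> L2" and g: "g \<in> L2" and w: "weak_gradient u g"
    and \<Psi>: "smooth_real \<Psi>" "\<And>s. (\<Psi> has_real_derivative \<Psi>' s) (at s)"
    and a: "0 < a" "\<And>s. s < a \<Longrightarrow> \<Psi> s = 0" and b: "\<And>s. b < s \<Longrightarrow> \<Psi> s = 0"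
  shows "2 * (LBINT x. u x * \<Psi>' ((norm x)\<^sup>2)) = - (LBINT x. radial_part g x * \<Psi> ((norm x)\<^sup>2))"
proof -
  define \<psi> where "\<psi> = (\<lambda>s. \<Psi> s / s)"
  have \<psi>s: "smooth_real \<psi>" unfolding \<psi>_def by (rule smooth_real.quot[OF \<Psi>(1) a])
  obtain \<psi>' where \<psi>': "smooth_real \<psi>'" "\<And>s. (\<psi> has_real_derivative \<psi>' s) (at s)"
    using smooth_real_deriv[OF \<psi>s] by blast
  have \<Psi>eq: "\<Psi> = (\<lambda>s. s * \<psi> s)" using a by (auto simp: \<psi>_def)
  have \<Psi>'eq: "\<Psi>' s = \<psi> s + s * \<psi>' s" for s
  proof (rule DERIV_unique[OF \<Psi>(2)])
    show "(\<Psi> has_real_derivative \<psi> s + s * \<psi>' s) (at s)"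
      unfolding \<Psi>eq by (auto intro!: derivative_eq_intros \<psi>'(2))
  qed
  define \<phi> where "\<phi> = (\<lambda>(i::2) x. \<psi> ((norm x)\<^sup>2) * x $ i)"
  have test: "test_function (\<phi> i)" for i
  proof (rule smooth_plane_test[where R = "max 1 b"])
    show "smooth_plane (\<phi> i)" unfolding \<phi>_def
      by (rule smooth_plane.mult[OF smooth_plane.comp[OF smooth_plane_norm_sq \<psi>s] smooth_plane.coord])
    fix x :: plane assume x: "norm x > max 1 b"
    \<comment> \<open>The lower bound 1 on the support radius gives |x| \<le> |x|^2 outside, hence
      |x|^2 > b without a square root of b.\<close>
    then have "b < norm x" "norm x * 1 \<le> norm x * norm x" using mult_left_mono[of 1 "norm x" "norm x"] by simp_all
    then have "(norm x)\<^sup>2 > b" by (simp add: power2_eq_square)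
    then show "\<phi> i x = 0" by (simp add: \<phi>_def \<psi>_def b)
  qed
  have pd: "pderiv_at i (\<phi> i) x = \<psi> ((norm x)\<^sup>2) + 2 * (x $ i)\<^sup>2 * \<psi>' ((norm x)\<^sup>2)" for i x
  proof -
    have "((\<lambda>x. \<psi> ((norm x)\<^sup>2)) has_derivative (\<lambda>h. \<psi>' ((norm x)\<^sup>2) * (2 * (x \<bullet> h)))) (at x)"
      using has_derivative_norm_sq \<psi>'(2)[unfolded has_field_derivative_def] by (rule has_derivative_compose)
    from has_derivative_mult[OF this bounded_linear.has_derivative[OF bounded_linear_vec_nth has_derivative_ident], of i]
    have hd: "(\<phi> i has_derivative (\<lambda>h. \<psi> ((norm x)\<^sup>2) * h $ i + \<psi>' ((norm x)\<^sup>2) * (2 * (x \<bullet> h)) * x $ i)) (at x)"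
      by (simp add: \<phi>_def)
    show ?thesis
      unfolding pderiv_at_eq[OF hd] by (simp add: inner_axis) (simp add: axis_def power2_eq_square)
  qed
  note L = C1c_L2[OF test_function_C1c[OF test]]
  have n2: "(norm x)\<^sup>2 = (\<Sum>i\<in>UNIV. (x $ i)\<^sup>2)" for x :: plane
    by (simp only: power2_norm_eq_inner inner_vec_def inner_real_def power2_eq_square[of "x $ i" for i])
  have "2 * (LBINT x. u x * \<Psi>' ((norm x)\<^sup>2)) = (LBINT x. 2 * (u x * \<Psi>' ((norm x)\<^sup>2)))"
    by simp
  \<comment> \<open>In dimension two the divergence of \<psi>(|x|^2) x is 2 \<psi> + 2 |x|^2
    \<psi>', which is 2 \<Psi>'(|x|^2) because \<Psi>(s) = s \<psi>(s).\<close>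
  also have "\<dots> = (LBINT x. (\<Sum>i\<in>UNIV. u x * pderiv_at i (\<phi> i) x))"
  proof (intro Bochner_Integration.integral_cong refl)
    fix x :: plane
    have "(\<Sum>i\<in>UNIV. u x * pderiv_at i (\<phi> i) x) = u x * (2 * \<psi> ((norm x)\<^sup>2) + 2 * (norm x)\<^sup>2 * \<psi>' ((norm x)\<^sup>2))"
      unfolding pd sum_distrib_left[symmetric] n2
      by (simp add: sum.distrib sum_distrib_left sum_distrib_right mult.assoc)
    then show "2 * (u x * \<Psi>' ((norm x)\<^sup>2)) = (\<Sum>i\<in>UNIV. u x * pderiv_at i (\<phi> i) x)"
      by (simp add: \<Psi>'eq algebra_simps)
  qed
  also have "\<dots> = (\<Sum>i\<in>UNIV. LBINT x. u x * pderiv_at i (\<phi> i) x)"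
    by (intro Bochner_Integration.integral_sum L2_mult_integrable u L)
  also have "\<dots> = (\<Sum>i\<in>UNIV. - (LBINT x. g x $ i * \<phi> i x))"
    using w test by (simp add: weak_gradient_def)
  also have "\<dots> = - (LBINT x. (\<Sum>i\<in>UNIV. g x $ i * \<phi> i x))"
    by (subst Bochner_Integration.integral_sum)
      (auto simp: sum_negf intro!: L2_mult_integrable L2_vec_nth g L)
  also have "(\<lambda>x. \<Sum>i\<in>UNIV. g x $ i * \<phi> i x) = (\<lambda>x. radial_part g x * \<Psi> ((norm x)\<^sup>2))"
  proof
    fix x
    show "(\<Sum>i\<in>UNIV. g x $ i * \<phi> i x) = radial_part g x * \<Psi> ((norm x)\<^sup>2)"
      by (simp add: radial_part_def \<phi>_def \<psi>_def inner_vec_def sum_distrib_left sum_distrib_right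
          sum_divide_distrib mult_ac)
  qed
  finally show ?thesis .
qed

section \<open>The du Bois-Reymond lemma on the half-line\<close>

lemma integrable_continuous_support:
  fixes h :: "real \<Rightarrow> real"
  assumes c: "continuous_on {a..b} h" and z: "\<And>s. s \<notin> {a..b} \<Longrightarrow> h s = 0"
  shows "integrable lborel h"
proof -
  have "set_integrable lborel {a..b} h" using c by (rule borel_integrable_atLeastAtMost')
  moreover have "(\<lambda>s. indicator {a..b} s *\<^sub>R h s) = h" using z by (force simp: indicator_def)
  ultimately show ?thesis by (simp add: set_integrable_def)
qed

text \<open>The antiderivative is normalized to vanish at a, hence to the left of it; to the right
  of b it equals the total integral, which is 0.\<close>

lemma mean_zero_primitive:
  fixes \<theta> :: "real \<Rightarrow> real"
  assumes c: "\<And>s. isCont \<theta> s" and ab: "a \<le> b"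
    and z: "\<And>s. s \<le> a \<or> b \<le> s \<Longrightarrow> \<theta> s = 0" and m: "(LBINT s. \<theta> s) = 0"
  obtains \<psi> where "\<And>s. (\<psi> has_real_derivative \<theta> s) (at s)" "\<And>s. s \<le> a \<or> b \<le> s \<Longrightarrow> \<psi> s = 0"
proof -
  obtain P where P: "\<And>s. (P has_real_derivative \<theta> s) (at s)"
    using einterval_antiderivative[of "-\<infinity>" "\<infinity>" \<theta>] c
    by (auto simp: has_real_derivative_iff_has_vector_derivative)
  define \<psi> where "\<psi> = (\<lambda>s. P s - P a)"
  have d: "(\<psi> has_real_derivative \<theta> s) (at s)" for s
    unfolding \<psi>_def by (auto intro!: derivative_eq_intros P)
  have FTC: "(LBINT s. \<theta> s * indicator {r..t} s) = \<psi> t - \<psi> r" if "r \<le> t" for r t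
    by (rule integral_FTC_Icc_real[OF that d c])
  have "\<psi> s = 0" if s: "s \<le> a \<or> b \<le> s" for s
    using s
  proof
    assume s: "s \<le> a"
    have "(\<lambda>t. \<theta> t * indicator {s..a} t) = (\<lambda>t. 0)" using z by (auto simp: indicator_def fun_eq_iff)
    then show ?thesis using FTC[OF s] by (simp only:) (simp add: \<psi>_def)
  next
    assume s: "b \<le> s"
    have "\<theta> t * indicator {a..s} t = \<theta> t" for t
      using z[of t] s by (cases "t \<in> {a..s}") auto
    then have "(\<lambda>t. \<theta> t * indicator {a..s} t) = \<theta>" by (rule ext)
    then show ?thesis using FTC[of a s] s ab m by (simp only:) (simp add: \<psi>_def)
  qed
  with d that show ?thesis by blast
qed

lemma isCont_bump: "isCont (bump n a b) s"
  using smooth_real_continuous[OF smooth_bump, of UNIV] by (simp add: continuous_on_eq_continuous_at)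

lemma measurable_bump [measurable]: "bump n a b \<in> borel_measurable borel"
  by (rule borel_measurable_continuous_onI[OF smooth_real_continuous[OF smooth_bump]])

lemma integrable_bump: "integrable lborel (bump n a b)"
  by (rule integrable_continuous_support[OF smooth_real_continuous[OF smooth_bump], of a b], rule bump_eq_0) auto

lemma integral_bump_pos: "0 < (LBINT s. bump 1 1 2 s)"
proof -
  have "(LBINT s. bump 1 1 2 s) \<noteq> 0"
  proof
    assume "(LBINT s. bump 1 1 2 s) = 0"
    then have "AE s in lborel. bump 1 1 2 s = 0"
      using integral_nonneg_eq_0_iff_AE[OF integrable_bump[of 1 1 2]] by (simp add: bump_nonneg)
    then obtain s where "s \<in> {1<..<2::real}" "bump 1 1 2 s = 0"
      using AE_lborel_ex_between[of "\<lambda>s. bump 1 1 2 s = 0" 1 2] by auto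
    then show False by (simp add: bump_def flat_def)
  qed
  moreover have "(LBINT s. bump 1 1 2 s) \<ge> 0" by (intro integral_nonneg_AE AE_I2 bump_nonneg)
  ultimately show ?thesis by simp
qed

lemma mult_bump_eq: "h s * bump n a b s = (indicator {a..b} s *\<^sub>R h s) * bump n a b s"
  by (cases "s \<in> {a..b}") (auto simp: bump_eq_0)

lemma mult_bump_le: "norm (h s * bump n a b s) \<le> norm (indicator {a..b} s *\<^sub>R h s)"
proof -
  have "bump n a b s \<le> 1" by (rule order_trans[OF bump_le]) (simp add: indicator_def)
  then show ?thesis
    unfolding mult_bump_eq using bump_nonneg[of n a b s] by (simp add: abs_mult mult_left_le)
qed

lemma set_integrable_mult_bump:
  fixes h :: "real \<Rightarrow> real"
  assumes "set_integrable lborel {a..b} h"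
  shows "integrable lborel (\<lambda>s. h s * bump n a b s)"
proof (rule Bochner_Integration.integrable_bound)
  show i: "integrable lborel (\<lambda>s. indicator {a..b} s *\<^sub>R h s)" using assms by (simp add: set_integrable_def)
  note [measurable] = borel_measurable_integrable[OF i]
  show "(\<lambda>s. h s * bump n a b s) \<in> borel_measurable lborel" by (subst mult_bump_eq) measurable
qed (simp only: mult_bump_le AE_I2)

lemma integral_mult_bump_tendsto:
  fixes h :: "real \<Rightarrow> real"
  assumes "set_integrable lborel {a..b} h"
  shows "(\<lambda>n. LBINT s. h s * bump n a b s) \<longlonglongrightarrow> (LBINT s. h s * indicator {a..b} s)"
proof (rule integral_dominated_convergence[where w = "\<lambda>s. norm (indicator {a..b} s *\<^sub>R h s)"])
  have i: "integrable lborel (\<lambda>s. indicator {a..b} s *\<^sub>R h s)" using assms by (simp add: set_integrable_def)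
  then show "integrable lborel (\<lambda>s. norm (indicator {a..b} s *\<^sub>R h s))" by (rule integrable_norm)
  show "(\<lambda>s. h s * indicator {a..b} s) \<in> borel_measurable lborel"
    using borel_measurable_integrable[OF i] by (simp add: mult.commute)
  show "AE s in lborel. (\<lambda>n. h s * bump n a b s) \<longlonglongrightarrow> h s * indicator {a..b} s"
    using AE_lborel_singleton[of a] AE_lborel_singleton[of b]
  proof eventually_elim
    case (elim s)
    then have "indicator {a..b} s = (indicator {a<..<b} s :: real)" by (auto simp: indicator_def)
    then show ?case by (auto intro!: tendsto_mult bump_tendsto)
  qed
qed (simp_all only: mult_bump_le AE_I2 borel_measurable_integrable[OF set_integrable_mult_bump[OF assms]])

text \<open>A bump minus the right multiple of one reference bump has mean 0 and is therefore the
  derivative of an admissible \<Psi>. So D and a constant have the same integral against every bump,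
  and in the limit over every interval. The support window in the hypothesis always contains 1, the
  base point used later for \<open>crossing\<close>.\<close>

lemma du_Bois_Reymond:
  fixes D :: "real \<Rightarrow> real"
  assumes [measurable]: "D \<in> borel_measurable borel"
    and int: "\<And>a b. 0 < a \<Longrightarrow> a \<le> b \<Longrightarrow> set_integrable lborel {a..b} D"
    and zero: "\<And>\<Psi> \<Psi>' a b. smooth_real \<Psi> \<Longrightarrow> smooth_real \<Psi>' \<Longrightarrow> (\<And>s. (\<Psi> has_real_derivative \<Psi>' s) (at s)) \<Longrightarrow>
       0 < a \<Longrightarrow> a \<le> 1 \<Longrightarrow> 1 \<le> b \<Longrightarrow> (\<And>s. s < a \<Longrightarrow> \<Psi> s = 0) \<Longrightarrow> (\<And>s. b < s \<Longrightarrow> \<Psi> s = 0) \<Longrightarrow>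
       (LBINT s. D s * \<Psi>' s) = 0"
  obtains C where "AE s in lborel. s > 0 \<longrightarrow> D s = C"
proof -
  define I0 where "I0 = (LBINT s. bump 1 1 2 s)"
  have I0: "I0 > 0" unfolding I0_def by (rule integral_bump_pos)
  define C where "C = (LBINT s. D s * bump 1 1 2 s) / I0"
  have Db: "(LBINT s. D s * bump n a b s) = C * (LBINT s. bump n a b s)" if ab: "0 < a" "a \<le> b" for n a b
  proof -
    define J where "J = (LBINT s. bump n a b s)"
    \<comment> \<open>The coefficient J / I0 makes the mean of \<theta> vanish; it is also what
      determines the constant C.\<close>
    define \<theta> where "\<theta> = (\<lambda>s. bump n a b s - (J / I0) * bump 1 1 2 s)"
    have \<theta>s: "smooth_real \<theta>" unfolding \<theta>_def
      by (intro smooth_real_diff smooth_real.mult smooth_real.const smooth_bump)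
    have \<theta>c: "isCont \<theta> s" for s
      using smooth_real_continuous[OF \<theta>s, of UNIV] by (simp add: continuous_on_eq_continuous_at)
    define lo hi where "lo = min a 1" and "hi = max b 2"
    have lohi: "0 < lo" "lo \<le> 1" "1 \<le> hi" "lo \<le> hi" using ab by (auto simp: lo_def hi_def)
    have \<theta>0: "\<theta> s = 0" if "s \<le> lo \<or> hi \<le> s" for s
    proof -
      have "s \<notin> {a<..<b}" "s \<notin> {1<..<2}" using that by (auto simp: lo_def hi_def)
      then show ?thesis by (simp add: \<theta>_def bump_eq_0)
    qed
    have "(LBINT s. \<theta> s) = J - (J / I0) * I0"
      unfolding \<theta>_def using integrable_bump by (simp add: J_def I0_def)
    then have "(LBINT s. \<theta> s) = 0" using I0 by simp
    then obtain \<Psi> where \<Psi>d: "\<And>s. (\<Psi> has_real_derivative \<theta> s) (at s)"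
      and z: "\<And>s. s \<le> lo \<or> hi \<le> s \<Longrightarrow> \<Psi> s = 0"
      using mean_zero_primitive[OF \<theta>c lohi(4) \<theta>0] by blast
    have "(LBINT s. D s * \<theta> s) = 0"
      by (rule zero[OF smooth_real.primitive[OF \<theta>s \<Psi>d] \<theta>s \<Psi>d lohi(1-3)]) (simp_all add: z)
    moreover have "(LBINT s. D s * \<theta> s) =
       (LBINT s. D s * bump n a b s - (J / I0) * (D s * bump 1 1 2 s))"
      by (simp add: \<theta>_def algebra_simps)
    moreover have "\<dots> = (LBINT s. D s * bump n a b s) - (J / I0) * (LBINT s. D s * bump 1 1 2 s)"
      using set_integrable_mult_bump[OF int[OF ab]] set_integrable_mult_bump[OF int[of 1 2]] by simp
    ultimately show ?thesis by (simp add: C_def J_def)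
  qed
  have DC: "set_integrable lborel {a..b} (\<lambda>s. D s - C)" if "0 < a" "a \<le> b" for a b
    using int[OF that] integrable_real_indicator[OF _ emeasure_compact_finite[OF compact_Icc[of a b]]]
    by (intro set_integral_diff) (auto simp: set_integrable_def)
  have box0: "(LBINT s. (D s - C) * indicator {a..b} s) = 0" if ab: "0 < a" "a \<le> b" for a b
  proof -
    note integral_mult_bump_tendsto[OF DC[OF ab]]
    moreover have "(LBINT s. (D s - C) * bump n a b s) = 0" for n
    proof -
      have "(LBINT s. (D s - C) * bump n a b s) = (LBINT s. D s * bump n a b s - C * bump n a b s)"
        by (simp add: algebra_simps)
      also have "\<dots> = 0" using set_integrable_mult_bump[OF int[OF ab]] integrable_bump Db[OF ab] by simp
      finally show ?thesis .
    qed
    ultimately show ?thesis by (simp add: LIMSEQ_const_iff)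
  qed
  \<comment> \<open>Integrability of D is assumed only on compact subintervals of (0, \<infinity>),
    so the conclusion is reached on an exhaustion by the intervals (1/(m+1), m+1).\<close>
  have "AE s in lborel. (D s - C) * indicator {1 / real (Suc m)<..<real (Suc m)} s = 0" for m
  proof (rule AE_zero_if_box_integrals_zero)
    let ?l = "1 / real (Suc m)" and ?r = "real (Suc m)"
    have lr: "0 < ?l" "?l \<le> ?r" by (simp_all add: field_simps)
    show "set_integrable lborel (box a b) (\<lambda>s. (D s - C) * indicator {?l<..<?r} s)" for a b
      unfolding set_integrable_def
      by (rule Bochner_Integration.integrable_bound[OF DC[OF lr, unfolded set_integrable_def]])
        (auto simp: indicator_def)
    show "(LBINT s:box a b. (D s - C) * indicator {?l<..<?r} s) = 0" for a b
    proof -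
      have "AE s in lborel. indicator (box a b) s *\<^sub>R ((D s - C) * indicator {?l<..<?r} s)
          = (D s - C) * indicator {max a ?l..min b ?r} s"
        using AE_lborel_singleton[of a] AE_lborel_singleton[of b] AE_lborel_singleton[of ?l] AE_lborel_singleton[of ?r]
        by eventually_elim (auto simp: indicator_def box_real)
      then have "(LBINT s:box a b. (D s - C) * indicator {?l<..<?r} s) =
        (LBINT s. (D s - C) * indicator {max a ?l..min b ?r} s)"
        unfolding set_lebesgue_integral_def by (intro integral_cong_AE) measurable
      also have "\<dots> = 0"
      proof (cases "max a ?l \<le> min b ?r")
        case True
        then show ?thesis using less_le_trans[OF lr(1) max.cobounded2] by (rule box0[rotated])
      next
        case False
        then have "{max a ?l..min b ?r} = {}" by auto
        then show ?thesis by simp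
      qed
      finally show ?thesis .
    qed
  qed measurable
  then have "AE s in lborel. \<forall>m. (D s - C) * indicator {1 / real (Suc m)<..<real (Suc m)} s = 0"
    by (subst AE_all_countable) blast
  then have "AE s in lborel. s > 0 \<longrightarrow> D s = C"
  proof eventually_elim
    case (elim s)
    show ?case
    proof
      assume "s > 0"
      obtain m1 where m1: "inverse (real (Suc m1)) < s" using reals_Archimedean[OF \<open>s > 0\<close>] by blast
      obtain m2 where m2: "s < real m2" using reals_Archimedean2 by blast
      define m where "m = max m1 m2"
      have "1 / real (Suc m) \<le> inverse (real (Suc m1))" by (simp add: m_def field_simps)
      then have "s \<in> {1 / real (Suc m)<..<real (Suc m)}" using m1 m2 by (auto simp: m_def)
      then show "D s = C" using elim[rule_format, of m] by simp
    qed
  qed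
  with that show ?thesis by blast
qed

text \<open>The signed indicator of the interval between 1 and s: integrating h(\<sigma>) against it
  gives the oriented integral of h from 1 to s. An interior base point is used because integrals
  down to 0 may diverge.\<close>

definition crossing :: "real \<Rightarrow> real \<Rightarrow> real" where
  "crossing s \<sigma> = (if 1 \<le> \<sigma> \<and> \<sigma> < s then 1 else if s \<le> \<sigma> \<and> \<sigma> < 1 then - 1 else 0)"

lemma crossing_diff: "a \<le> b \<Longrightarrow> crossing b \<sigma> - crossing a \<sigma> = indicator {a..<b} \<sigma>"
  by (auto simp: crossing_def indicator_def)

lemma crossing_bound: "a \<le> s \<Longrightarrow> s \<le> b \<Longrightarrow> a \<le> 1 \<Longrightarrow> 1 \<le> b \<Longrightarrow> \<bar>crossing s \<sigma>\<bar> \<le> 1 * indicator {a..b} \<sigma>"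
  by (auto simp: crossing_def indicator_def)

text \<open>As a function of s, the kernel is the indicator of s > \<sigma> if \<sigma> \<ge> 1 and
  minus that of s \<le> \<sigma> otherwise. Since \<Psi> vanishes at both ends, the fundamental
  theorem gives -\<Psi>(\<sigma>) in both cases.\<close>

lemma integral_crossing:
  assumes d: "\<And>s. (\<Psi> has_real_derivative \<Psi>' s) (at s)" and c: "\<And>s. isCont \<Psi>' s"
    and a: "0 < a" "\<And>s. s < a \<Longrightarrow> \<Psi> s = 0" "\<And>s. s < a \<Longrightarrow> \<Psi>' s = 0"
    and b: "\<And>s. b < s \<Longrightarrow> \<Psi> s = 0" "\<And>s. b < s \<Longrightarrow> \<Psi>' s = 0" and \<sigma>: "0 < \<sigma>"
  shows "(LBINT s. \<Psi>' s * crossing s \<sigma>) = - \<Psi> \<sigma>"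
proof (cases "1 \<le> \<sigma>")
  case True
  define M where "M = max \<sigma> b + 1"
  have [measurable]: "\<Psi>' \<in> borel_measurable borel"
    using c by (intro borel_measurable_continuous_onI continuous_at_imp_continuous_on) auto
  have "AE s in lborel. \<Psi>' s * crossing s \<sigma> = \<Psi>' s * indicator {\<sigma>..M} s"
    using AE_lborel_singleton[of \<sigma>]
    by eventually_elim (use True b in \<open>auto simp: crossing_def indicator_def M_def\<close>)
  then have "(LBINT s. \<Psi>' s * crossing s \<sigma>) = (LBINT s. \<Psi>' s * indicator {\<sigma>..M} s)"
    by (intro integral_cong_AE) (auto simp: crossing_def)
  also have "\<dots> = \<Psi> M - \<Psi> \<sigma>"
    by (rule integral_FTC_Icc_real[OF _ d c]) (simp add: M_def)
  also have "\<Psi> M = 0" by (rule b) (simp add: M_def)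
  finally show ?thesis by simp
next
  case False
  define m where "m = min \<sigma> a / 2"
  have m: "m < a" "m \<le> \<sigma>" using a(1) \<sigma> by (auto simp: m_def min_def)
  have "(\<lambda>s. \<Psi>' s * crossing s \<sigma>) = (\<lambda>s. - (\<Psi>' s * indicator {m..\<sigma>} s))"
    using False a(3) m by (fastforce simp: crossing_def indicator_def)
  then have "(LBINT s. \<Psi>' s * crossing s \<sigma>) = - (LBINT s. \<Psi>' s * indicator {m..\<sigma>} s)"
    by simp
  also have "\<dots> = - (\<Psi> \<sigma> - \<Psi> m)"
    using integral_FTC_Icc_real[OF m(2) d c] by simp
  also have "\<Psi> m = 0" by (rule a(2)[OF m(1)])
  finally show ?thesis by simp
qed

lemma integrable_tensor:
  fixes p :: "real \<Rightarrow> real" and q :: "plane \<Rightarrow> real"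
  assumes "integrable lborel p" "integrable lborel q"
  shows "integrable (lborel \<Otimes>\<^sub>M lborel) (\<lambda>z. p (fst z) * q (snd z))"
proof (rule lborel_pair.Fubini_integrable)
  have [measurable]: "p \<in> borel_measurable lborel" "q \<in> borel_measurable lborel" using assms by auto
  show "(\<lambda>z. p (fst z) * q (snd z)) \<in> borel_measurable (lborel \<Otimes>\<^sub>M lborel)" by measurable
qed (use assms in \<open>simp_all add: abs_mult\<close>)

text \<open>For smooth u the radial part of g is 2 W'(|x|^2), and the image measure has density
  \<pi>; so K(s), the integral of the radial part over the region between |x|^2 = 1 and |x|^2 = s,
  should be 2\<pi> (W(s) - W(1)). In general Fubini and the radial test fields show that 2\<pi> w -
  K annihilates every admissible \<Psi>', hence is constant almost everywhere. As K has a
  logarithmic modulus of continuity, it provides the continuous representative.\<close>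

lemma radial_representation:
  assumes u: "u \<in> L2" and g: "g \<in> L2" and wg: "weak_gradient u g" and rad: "radial u"
  obtains W where "W \<in> borel_measurable borel" "continuous_on {0<..} W"
    "AE x in lborel. u x = W ((norm x)\<^sup>2)"
    "\<And>a b. 0 < a \<Longrightarrow> a \<le> b \<Longrightarrow>
       2 * pi * (W b - W a) = (LBINT x. radial_part g x * indicator {a..<b} ((norm x)\<^sup>2))"
proof -
  have [measurable]: "u \<in> borel_measurable borel" "g \<in> borel_measurable borel" using u g by (auto intro: L2D)
  have [measurable]: "radial_part g \<in> borel_measurable borel" unfolding radial_part_def by measurable
  obtain w where w[measurable]: "w \<in> borel_measurable borel" and uw: "AE x in lborel. u x = w ((norm x)\<^sup>2)"
    using radial_Borel_profile[OF _ rad] by auto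
  define K where "K = (\<lambda>s. LBINT x. radial_part g x * crossing s ((norm x)\<^sup>2))"
  have [measurable]: "(\<lambda>\<sigma>. crossing s \<sigma>) \<in> borel_measurable borel" for s
    unfolding crossing_def by measurable
  have cr[measurable]: "(\<lambda>p. crossing (fst p) ((norm (snd p))\<^sup>2)) \<in> borel_measurable (borel \<Otimes>\<^sub>M (borel :: plane measure))"
    unfolding crossing_def by measurable
  have Ki: "integrable lborel (\<lambda>x. radial_part g x * crossing s ((norm x)\<^sup>2))" if "s > 0" for s
    by (rule radial_part_weighted(1)[OF g _ weight_integrable(1)[OF _ _ _ crossing_bound[of "min s 1" s "max s 1"]]])
      (use that in auto)
  have Kdiff: "K b - K a = (LBINT x. radial_part g x * indicator {a..<b} ((norm x)\<^sup>2))"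
    if "0 < a" "a \<le> b" for a b
  proof -
    have "K b - K a = (LBINT x. radial_part g x * crossing b ((norm x)\<^sup>2) - radial_part g x * crossing a ((norm x)\<^sup>2))"
      unfolding K_def using that by (intro Bochner_Integration.integral_diff[symmetric] Ki) auto
    also have "\<dots> = (LBINT x. radial_part g x * indicator {a..<b} ((norm x)\<^sup>2))"
      by (simp add: right_diff_distrib[symmetric] crossing_diff that)
    finally show ?thesis .
  qed
  have Kmod: "(K b - K a)\<^sup>2 \<le> L2_sq g * (pi * (ln b - ln a))" if ab: "0 < a" "a \<le> b" for a b
  proof -
    have ib: "\<bar>indicator {a..<b} s\<bar> \<le> (1::real) * indicator {a..b} s" for s :: real by (auto simp: indicator_def)
    have "(K b - K a)\<^sup>2 \<le> L2_sq g * (pi * (LBINT s:{0<..}. (indicator {a..<b} s)\<^sup>2 / s))"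
      unfolding Kdiff[OF ab]
      by (rule radial_part_weighted(2)[OF g _ weight_integrable(1)[OF _ ab ib]]) auto
    also have "\<dots> \<le> L2_sq g * (pi * (1\<^sup>2 * (ln b - ln a)))"
      by (intro mult_left_mono weight_integrable(2)[OF _ ab ib] L2_sq_nonneg) auto
    finally show ?thesis by simp
  qed
  have Kmod': "\<bar>K s - K t\<bar> \<le> sqrt (L2_sq g * (pi * \<bar>ln s - ln t\<bar>))" if "0 < s" "0 < t" for s t
  proof (rule real_le_rsqrt)
    show "\<bar>K s - K t\<bar>\<^sup>2 \<le> L2_sq g * (pi * \<bar>ln s - ln t\<bar>)"
      using Kmod[of s t] Kmod[of t s] that
      by (cases "s \<le> t") (auto simp: power2_commute abs_if)
  qed
  have Kc: "continuous_on {0<..} K"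
    unfolding continuous_on
  proof
    fix t :: real assume t: "t \<in> {0<..}"
    have "((\<lambda>s. sqrt (L2_sq g * (pi * \<bar>ln s - ln t\<bar>))) \<longlongrightarrow> sqrt (L2_sq g * (pi * \<bar>ln t - ln t\<bar>))) (at t within {0<..})"
      using t by (intro tendsto_intros) auto
    then have "((\<lambda>s. sqrt (L2_sq g * (pi * \<bar>ln s - ln t\<bar>))) \<longlongrightarrow> 0) (at t within {0<..})" by simp
    then have "((\<lambda>s. K s - K t) \<longlongrightarrow> 0) (at t within {0<..})"
      by (rule Lim_null_comparison[rotated])
        (use Kmod' t in \<open>auto simp: eventually_at_filter\<close>)
    then show "(K \<longlongrightarrow> K t) (at t within {0<..})" by (simp add: LIM_zero_iff)
  qed
  have Km[measurable]: "K \<in> borel_measurable borel"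
    unfolding K_def
  proof (rule lborel.borel_measurable_lebesgue_integral)
    have "(\<lambda>p. radial_part g (snd p) * crossing (fst p) ((norm (snd p))\<^sup>2)) \<in> borel_measurable (borel \<Otimes>\<^sub>M lborel)"
      by measurable
    then show "(\<lambda>(s, x). radial_part g x * crossing s ((norm x)\<^sup>2)) \<in> borel_measurable (borel \<Otimes>\<^sub>M lborel)"
      by (simp add: case_prod_unfold)
  qed
  have ind2: "(indicator A s)\<^sup>2 = (indicator A s :: real)" for A and s :: real
    by (simp add: indicator_def)
  have "integrable lborel (\<lambda>x. (w ((norm (x::plane))\<^sup>2))\<^sup>2)"
  proof (rule integrable_cong_AE_imp[OF L2D(2)[OF u]])
    show "AE x in lborel. (norm (u x))\<^sup>2 = (w ((norm x)\<^sup>2))\<^sup>2" using uw by eventually_elim simp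
  qed measurable
  then have w2: "integrable lborel (\<lambda>s. (indicator {0<..} s * w s)\<^sup>2)"
    using integrable_norm_sq_iff[of "\<lambda>s. (w s)\<^sup>2"]
    by (simp add: set_integrable_def power_mult_distrib ind2)
  \<comment> \<open>For s \<le> 0 the integral defining K may diverge and take its default value, so
    D is cut off there.\<close>
  define D where "D = (\<lambda>s. indicator {0<..} s * (2 * pi * w s - K s))"
  have [measurable]: "D \<in> borel_measurable borel" unfolding D_def by measurable
  obtain C where C: "AE s in lborel. s > 0 \<longrightarrow> D s = C"
  proof (rule du_Bois_Reymond)
    show "D \<in> borel_measurable borel" by measurable
    show "set_integrable lborel {a..b} D" if "0 < a" "a \<le> b" for a b
    proof -
      have "integrable lborel (\<lambda>s. (indicator {0<..} s * w s) * indicator {a..b} s)"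
        using w2 integrable_real_indicator[OF _ emeasure_compact_finite[OF compact_Icc[of a b]]]
        by (intro integrable_mult_sq) (auto simp: ind2)
      moreover have "set_integrable lborel {a..b} K"
        by (rule borel_integrable_atLeastAtMost'[OF continuous_on_subset[OF Kc]]) (use that in auto)
      ultimately have "integrable lborel (\<lambda>s. 2 * pi * ((indicator {0<..} s * w s) * indicator {a..b} s) - indicator {a..b} s *\<^sub>R K s)"
        by (simp add: set_integrable_def)
      also have "(\<lambda>s. 2 * pi * ((indicator {0<..} s * w s) * indicator {a..b} s) - indicator {a..b} s *\<^sub>R K s)
          = (\<lambda>s. indicator {a..b} s *\<^sub>R D s)"
        using that by (auto simp: D_def indicator_def)
      finally show ?thesis by (simp add: set_integrable_def)
    qed
    fix \<Psi> \<Psi>' a b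
    assume \<Psi>: "smooth_real \<Psi>" "smooth_real \<Psi>'" "\<And>s. (\<Psi> has_real_derivative \<Psi>' s) (at s)"
      and ab: "0 < a" "a \<le> 1" "1 \<le> b" "\<And>s. s < a \<Longrightarrow> \<Psi> s = 0" "\<And>s. b < s \<Longrightarrow> \<Psi> s = 0"
    have c: "isCont \<Psi>' s" for s
      using smooth_real_continuous[OF \<Psi>(2), of UNIV] by (simp add: continuous_on_eq_continuous_at)
    have [measurable]: "\<Psi> \<in> borel_measurable borel" "\<Psi>' \<in> borel_measurable borel"
      using \<Psi> by (auto intro!: borel_measurable_continuous_onI smooth_real_continuous)
    have z: "\<Psi>' s = 0" if "s < a \<or> b < s" for s
    proof -
      have "(\<Psi> has_real_derivative 0) (at s)"
        by (rule has_field_derivative_transform_within_open[of "\<lambda>s. 0" _ _ "{..<a} \<union> {b<..}"])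
          (use that ab in auto)
      then show ?thesis using \<Psi>(3) DERIV_unique by blast
    qed
    have supp: "indicator {a..b} s * \<Psi>' s = \<Psi>' s" "indicator {a..b} s * (\<Psi>' s)\<^sup>2 = (\<Psi>' s)\<^sup>2" for s
      using z[of s] by (cases "s < a \<or> b < s"; auto simp: indicator_def)+
    have \<Psi>'i: "integrable lborel \<Psi>'" and \<Psi>'2: "integrable lborel (\<lambda>s. (\<Psi>' s)\<^sup>2)"
    proof -
      have "set_integrable lborel {a..b} \<Psi>'" "set_integrable lborel {a..b} (\<lambda>s. (\<Psi>' s)\<^sup>2)"
        using smooth_real_continuous[OF \<Psi>(2)] by (auto intro!: borel_integrable_atLeastAtMost' continuous_intros)
      then show "integrable lborel \<Psi>'" "integrable lborel (\<lambda>s. (\<Psi>' s)\<^sup>2)"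
        by (simp_all add: set_integrable_def supp)
    qed
    define f where "f = (\<lambda>s x. \<Psi>' s * (radial_part g x * crossing s ((norm x)\<^sup>2)))"
    have ib: "\<bar>indicator {a..b} s\<bar> \<le> (1::real) * indicator {a..b} s" for s :: real by auto
    have q: "integrable lborel (\<lambda>x. radial_part g x * indicator {a..b} ((norm x)\<^sup>2))"
      by (rule radial_part_weighted(1)[OF g _ weight_integrable(1)[OF _ ab(1) _ ib]]) (use ab in auto)
    \<comment> \<open>For s in the support of \<Psi>' the kernel lives in [a, b], because 1 lies
      there too. A product of a function of s and a function of x thus dominates f.\<close>
    have fi: "integrable (lborel \<Otimes>\<^sub>M lborel) (case_prod f)"
    proof (rule Bochner_Integration.integrable_bound[OF integrable_tensor[OF \<Psi>'i q]])
      have "(\<lambda>p. \<Psi>' (fst p) * (radial_part g (snd p) * crossing (fst p) ((norm (snd p))\<^sup>2))) \<in> borel_measurable (lborel \<Otimes>\<^sub>M lborel)"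
        by measurable
      then show "case_prod f \<in> borel_measurable (lborel \<Otimes>\<^sub>M lborel)"
        by (simp add: f_def case_prod_unfold)
      show "AE p in lborel \<Otimes>\<^sub>M lborel. norm (case_prod f p)
         \<le> norm (\<Psi>' (fst p) * (radial_part g (snd p) * indicator {a..b} ((norm (snd p))\<^sup>2)))"
      proof (rule AE_I2)
        fix p :: "real \<times> plane"
        obtain s x where p: "p = (s, x)" by (cases p)
        show "norm (case_prod f p) \<le> norm (\<Psi>' (fst p) * (radial_part g (snd p) * indicator {a..b} ((norm (snd p))\<^sup>2)))"
        proof (cases "s < a \<or> b < s")
          case True
          then show ?thesis by (simp add: p f_def z)
        next
          case False
          then have "\<bar>crossing s ((norm x)\<^sup>2)\<bar> \<le> indicator {a..b} ((norm x)\<^sup>2)"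
            using crossing_bound[of a s b] ab by auto
          then show ?thesis by (simp add: p f_def abs_mult mult_left_mono)
        qed
      qed
    qed
    have "(LBINT s. \<Psi>' s * K s) = (LBINT s. LBINT x. f s x)"
      unfolding f_def K_def by simp
    also have "\<dots> = (LBINT x. LBINT s. f s x)"
      by (rule lborel_pair.Fubini_integral[OF fi, symmetric])
    also have "\<dots> = (LBINT x. - (radial_part g x * \<Psi> ((norm x)\<^sup>2)))"
    proof (intro Bochner_Integration.integral_cong refl)
      fix x :: plane
      have "(LBINT s. f s x) = radial_part g x * (LBINT s. \<Psi>' s * crossing s ((norm x)\<^sup>2))"
        unfolding f_def by (subst integral_mult_right_zero[symmetric]) (simp add: mult_ac)
      also have "\<dots> = - (radial_part g x * \<Psi> ((norm x)\<^sup>2))"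
      proof (cases "x = 0")
        case True
        then show ?thesis by (simp add: radial_part_def)
      next
        case False
        then show ?thesis
          using integral_crossing[OF \<Psi>(3) c ab(1,4) _ ab(5), where \<sigma> = "(norm x)\<^sup>2"] z by simp
      qed
      finally show "(LBINT s. f s x) = - (radial_part g x * \<Psi> ((norm x)\<^sup>2))" .
    qed
    also have "\<dots> = 2 * (LBINT x. u x * \<Psi>' ((norm x)\<^sup>2))"
      using weak_gradient_radial[OF u g wg \<Psi>(1,3) ab(1,4,5)] by simp
    also have "(LBINT x. u x * \<Psi>' ((norm x)\<^sup>2)) = (LBINT x. w ((norm (x::plane))\<^sup>2) * \<Psi>' ((norm x)\<^sup>2))"
    proof (rule integral_cong_AE)
      show "AE x in lborel. u x * \<Psi>' ((norm x)\<^sup>2) = w ((norm x)\<^sup>2) * \<Psi>' ((norm x)\<^sup>2)"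
        using uw by eventually_elim simp
    qed measurable
    also have "\<dots> = pi * (LBINT s:{0<..}. w s * \<Psi>' s)"
      by (rule integral_norm_sq[of "\<lambda>s. w s * \<Psi>' s"]) measurable
    finally have main: "(LBINT s. \<Psi>' s * K s) = 2 * pi * (LBINT s. (indicator {0<..} s * w s) * \<Psi>' s)"
      by (simp add: set_lebesgue_integral_def mult.assoc)
    have i1: "integrable lborel (\<lambda>s. (indicator {0<..} s * w s) * \<Psi>' s)"
      by (rule integrable_mult_sq[OF _ _ w2 \<Psi>'2]) measurable
    have i2: "integrable lborel (\<lambda>s. \<Psi>' s * K s)"
      using lborel_pair.integrable_fst[OF fi] by (simp add: f_def K_def)
    have "(LBINT s. D s * \<Psi>' s) = (LBINT s. 2 * pi * ((indicator {0<..} s * w s) * \<Psi>' s) - \<Psi>' s * K s)"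
    proof (intro Bochner_Integration.integral_cong refl)
      fix s show "D s * \<Psi>' s = 2 * pi * ((indicator {0<..} s * w s) * \<Psi>' s) - \<Psi>' s * K s"
        using z[of s] ab(1) by (cases "s > 0") (auto simp: D_def algebra_simps)
    qed
    also have "\<dots> = 2 * pi * (LBINT s. (indicator {0<..} s * w s) * \<Psi>' s) - (LBINT s. \<Psi>' s * K s)"
      using i1 i2 by simp
    also have "\<dots> = 0" using main by simp
    finally show "(LBINT s. D s * \<Psi>' s) = 0" .
  qed
  define W where "W = (\<lambda>s. (K s + C) / (2 * pi))"
  show ?thesis
  proof
    show "W \<in> borel_measurable borel" unfolding W_def by measurable
    show "continuous_on {0<..} W" unfolding W_def by (intro continuous_intros Kc) auto
    have "AE s in lborel. s > 0 \<longrightarrow> w s = W s"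
      using C by eventually_elim (auto simp: D_def W_def field_simps)
    then have "AE x in lborel. w ((norm (x::plane))\<^sup>2) = W ((norm x)\<^sup>2)"
      by (rule AE_norm_sq[where P = "\<lambda>s. w s = W s"])
    then show "AE x in lborel. u x = W ((norm x)\<^sup>2)" using uw by eventually_elim simp
    show "2 * pi * (W b - W a) = (LBINT x. radial_part g x * indicator {a..<b} ((norm x)\<^sup>2))"
      if "0 < a" "a \<le> b" for a b
      using Kdiff[OF that] by (simp add: W_def field_simps)
  qed
qed

text \<open>Cauchy-Schwarz on the annulus a \<le> |x|^2 < b gives (2\<pi>)^2 on the left against
  \<pi> on the right. The resulting factor 1/(4\<pi>) fixes the threshold in the Trudinger-Moser
  estimate.\<close>

lemma profile_modulus:
  assumes g: "g \<in> L2" and ab: "0 < a" "a \<le> b"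
    and W: "2 * pi * (W b - W a) = (LBINT x. radial_part g x * indicator {a..<b} ((norm x)\<^sup>2))"
  shows "(W b - W a)\<^sup>2 \<le> L2_sq g * (ln b - ln a) / (4 * pi)"
proof -
  have ib: "\<bar>indicator {a..<b} s\<bar> \<le> (1::real) * indicator {a..b} s" for s :: real by (auto simp: indicator_def)
  have "(2 * pi * (W b - W a))\<^sup>2 \<le> L2_sq g * (pi * (LBINT s:{0<..}. (indicator {a..<b} s)\<^sup>2 / s))"
    unfolding W by (rule radial_part_weighted(2)[OF g _ weight_integrable(1)[OF _ ab ib]]) auto
  also have "\<dots> \<le> L2_sq g * (pi * (1\<^sup>2 * (ln b - ln a)))"
    by (intro mult_left_mono weight_integrable(2)[OF _ ab ib] L2_sq_nonneg) auto
  finally have "(2 * pi * (W b - W a))\<^sup>2 \<le> pi * (L2_sq g * (ln b - ln a))"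
    by (simp add: mult_ac)
  moreover have "(2 * pi * (W b - W a))\<^sup>2 = pi * (4 * pi * (W b - W a)\<^sup>2)"
    by (simp add: power_mult_distrib power2_eq_square[of pi])
  ultimately have "4 * pi * (W b - W a)\<^sup>2 \<le> L2_sq g * (ln b - ln a)"
    by simp
  then show ?thesis by (simp add: field_simps)
qed

section \<open>The nonlinearity\<close>

lemma powr_integral:
  fixes c \<beta> :: real
  assumes "0 < c" "\<beta> < 1"
  shows "has_bochner_integral lborel (\<lambda>s. indicator {0..c} s * s powr (- \<beta>)) (c powr (1 - \<beta>) / (1 - \<beta>))"
proof -
  have "((\<lambda>s. s powr (- \<beta>)) has_integral (c powr (- \<beta> + 1) / (- \<beta> + 1))) {0..c}"
    by (rule has_integral_powr_from_0) (use assms in auto)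
  then have "(\<integral>\<^sup>+ s. ennreal (indicator {0..c} s * s powr (- \<beta>)) \<partial>lborel) = ennreal (c powr (- \<beta> + 1) / (- \<beta> + 1))"
    by (intro nn_integral_has_integral_lebesgue) auto
  then have "(\<integral>\<^sup>+ s. ennreal (indicator {0..c} s * s powr (- \<beta>)) \<partial>lborel) = ennreal (c powr (1 - \<beta>) / (1 - \<beta>))"
    by (simp add: algebra_simps)
  then show ?thesis
    by (rule has_bochner_integral_nn_integral[rotated 3]) (use assms in auto)
qed

locale nonlinearity =
  fixes f :: "real \<Rightarrow> real" and \<alpha>0 :: real
  assumes f_cont: "continuous_on UNIV f"
    and f_nonpos: "\<And>s. s \<le> 0 \<Longrightarrow> f s = 0"
    and f_pos: "\<And>s. s > 0 \<Longrightarrow> f s > 0"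
    and f_origin: "\<exists>p>2. Limsup (at_right 0) (\<lambda>s. ereal (f s / s powr (p - 1))) < \<infinity>"
    and alpha0: "\<alpha>0 > 0"
    and f_super: "\<And>\<alpha>. \<alpha> > \<alpha>0 \<Longrightarrow> ((\<lambda>s. f s * exp (- \<alpha> * s\<^sup>2)) \<longlongrightarrow> 0) at_top"
    and F_f: "((\<lambda>s. primitive f s / (f s * s)) \<longlongrightarrow> 0) at_top"
begin

lemma f_nonneg: "0 \<le> f s"
  using f_nonpos[of s] f_pos[of s] by (cases "s \<le> 0") auto

lemma f_mult_nonneg: "0 \<le> f s * s"
  using f_nonpos[of s] f_pos[of s] by (cases "s \<le> 0") auto

lemma measurable_f [measurable]: "f \<in> borel_measurable borel"
  using f_cont by (rule borel_measurable_continuous_onI)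

lemma isCont_f: "isCont f s"
  using f_cont by (simp add: continuous_on_eq_continuous_at)

lemma primitive_deriv: "(primitive f has_real_derivative f s) (at s)"
proof -
  let ?a = "- \<bar>s\<bar> - 1" and ?b = "\<bar>s\<bar> + 1"
  have "((\<lambda>u. LBINT y=ereal 0..ereal u. f y) has_vector_derivative f s) (at s within {?a..?b})"
    by (rule interval_integral_FTC2) (auto intro: continuous_on_subset[OF f_cont])
  then have "((\<lambda>u. LBINT y=ereal 0..ereal u. f y) has_vector_derivative f s) (at s within {?a<..<?b})"
    by (rule has_vector_derivative_within_subset) auto
  then have "((\<lambda>u. LBINT y=ereal 0..ereal u. f y) has_vector_derivative f s) (at s)"
    by (subst (asm) has_vector_derivative_within_open) auto
  then show ?thesis
    unfolding primitive_def has_real_derivative_iff_has_vector_derivative zero_ereal_def .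
qed

lemma primitive_0: "primitive f 0 = 0"
  by (simp add: primitive_def zero_ereal_def[symmetric])

lemma continuous_primitive: "continuous_on A (primitive f)"
  using primitive_deriv by (meson DERIV_continuous_on has_field_derivative_at_within)

lemma measurable_primitive [measurable]: "primitive f \<in> borel_measurable borel"
  using continuous_primitive by (rule borel_measurable_continuous_onI)

lemma primitive_mono: "s \<le> t \<Longrightarrow> primitive f s \<le> primitive f t"
  using primitive_deriv f_nonneg by (meson DERIV_nonneg_imp_nondecreasing)

lemma primitive_nonpos: "s \<le> 0 \<Longrightarrow> primitive f s = 0"
proof -
  assume s: "s \<le> 0"
  show ?thesis
  proof (cases "s = 0")
    case False
    then obtain z where z: "s < z" "z < 0" "primitive f 0 - primitive f s = (0 - s) * f z"
      using MVT2[of s 0 "primitive f" f] primitive_deriv s by auto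
    then show ?thesis using f_nonpos[of z] primitive_0 by simp
  qed (simp add: primitive_0)
qed

lemma primitive_nonneg: "0 \<le> primitive f s"
  using primitive_mono[of 0 s] primitive_nonpos[of s] primitive_0 by (cases "s \<le> 0") auto

text \<open>Near 0, s^(p-1) \<le> s because p > 2 and s \<le> 1. On the remaining compact interval
  [e, R] a bound for f suffices, since s/e \<ge> 1.\<close>

lemma f_linear_bound:
  obtains C where "C \<ge> 0" "\<And>s. 0 \<le> s \<Longrightarrow> s \<le> R \<Longrightarrow> f s \<le> C * s"
proof -
  obtain p where p: "p > 2" "Limsup (at_right 0) (\<lambda>s. ereal (f s / s powr (p - 1))) < \<infinity>"
    using f_origin by blast
  then obtain C1 :: real where "Limsup (at_right 0) (\<lambda>s. ereal (f s / s powr (p - 1))) < ereal C1"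
    using ereal_dense2[OF p(2)] by auto
  then have "\<forall>\<^sub>F s in at_right 0. ereal (f s / s powr (p - 1)) < ereal C1"
    by (rule Limsup_lessD)
  then obtain d where d: "d > 0" "\<And>s. 0 < s \<Longrightarrow> s < d \<Longrightarrow> f s / s powr (p - 1) < C1"
    by (auto simp: eventually_at_right_field)
  define e where "e = min (d / 2) 1"
  have e: "0 < e" "e < d" "e \<le> 1" using d by (auto simp: e_def)
  have near: "f s \<le> \<bar>C1\<bar> * s" if "0 \<le> s" "s \<le> e" for s
  proof (cases "s = 0")
    case False
    then have s: "0 < s" "s < d" "s \<le> 1" using that e by auto
    have "f s \<le> C1 * s powr (p - 1)" using d(2)[OF s(1,2)] s by (simp add: field_simps)
    also have "\<dots> \<le> \<bar>C1\<bar> * s powr 1"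
      using s p by (intro mult_mono powr_mono') auto
    finally show ?thesis using s by simp
  qed (simp add: f_nonpos)
  have "compact (f ` {0..R})"
    by (intro compact_continuous_image continuous_on_subset[OF f_cont]) auto
  then obtain M where M: "\<And>s. s \<in> {0..R} \<Longrightarrow> \<bar>f s\<bar> \<le> M"
    using compact_imp_bounded[of "f ` {0..R}"] unfolding bounded_iff real_norm_def by blast
  show ?thesis
  proof
    show "0 \<le> \<bar>C1\<bar> + \<bar>M\<bar> / e" using e by simp
    fix s assume s: "0 \<le> s" "s \<le> R"
    show "f s \<le> (\<bar>C1\<bar> + \<bar>M\<bar> / e) * s"
    proof (cases "s \<le> e")
      case True
      have "0 \<le> \<bar>M\<bar> / e * s" using e s by simp
      then show ?thesis using near[OF s(1) True] by (simp add: distrib_right)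
    next
      case False
      have "f s \<le> \<bar>M\<bar> * 1" using M[of s] s by auto
      also have "\<dots> \<le> \<bar>M\<bar> * (s / e)" using False e by (intro mult_left_mono) auto
      also have "\<dots> \<le> (\<bar>C1\<bar> + \<bar>M\<bar> / e) * s" using s by (simp add: distrib_right)
      finally show ?thesis .
    qed
  qed
qed

lemma f_quadratic_bound:
  obtains C where "C \<ge> 0" "\<And>s. s \<le> R \<Longrightarrow> f s * s \<le> C * s\<^sup>2"
proof -
  obtain C where C: "C \<ge> 0" "\<And>s. 0 \<le> s \<Longrightarrow> s \<le> R \<Longrightarrow> f s \<le> C * s" using f_linear_bound by blast
  have "f s * s \<le> C * s\<^sup>2" if "s \<le> R" for s
  proof (cases "s \<le> 0")
    case False
    then have "f s * s \<le> (C * s) * s" using C(2)[of s] that by (intro mult_right_mono) auto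
    then show ?thesis by (simp add: power2_eq_square)
  qed (use C in \<open>simp add: f_nonpos\<close>)
  with C(1) that show ?thesis by blast
qed

text \<open>The growth condition is used at an exponent \<alpha>' strictly between \<alpha>0 and
  \<alpha>; the gap absorbs the extra factor s into exp((\<alpha> - \<alpha>') s^2).\<close>

lemma f_exp_bound:
  assumes "\<alpha> > \<alpha>0"
  obtains C where "C \<ge> 0" "\<And>s. f s * s \<le> C * exp (\<alpha> * s\<^sup>2)"
proof -
  define \<alpha>' where "\<alpha>' = (\<alpha>0 + \<alpha>) / 2"
  have \<alpha>': "\<alpha>0 < \<alpha>'" "\<alpha>' < \<alpha>" using assms by (auto simp: \<alpha>'_def)
  have "((\<lambda>s. f s * exp (- \<alpha>' * s\<^sup>2)) \<longlongrightarrow> 0) at_top" by (rule f_super[OF \<alpha>'(1)])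
  then have "\<forall>\<^sub>F s in at_top. f s * exp (- \<alpha>' * s\<^sup>2) < 1" by (rule order_tendstoD) simp
  then obtain R where R: "\<And>s. R \<le> s \<Longrightarrow> f s * exp (- \<alpha>' * s\<^sup>2) < 1" by (auto simp: eventually_at_top_linorder)
  define d where "d = \<alpha> - \<alpha>'"
  have d: "d > 0" using \<alpha>' by (simp add: d_def)
  obtain C where C: "C \<ge> 0" "\<And>s. s \<le> R \<Longrightarrow> f s * s \<le> C * s\<^sup>2" using f_quadratic_bound by blast
  have \<alpha>pos: "\<alpha> > 0" using assms alpha0 by simp
  have sq: "s\<^sup>2 \<le> (1 / \<alpha>) * exp (\<alpha> * s\<^sup>2)" for s
  proof -
    have "\<alpha> * s\<^sup>2 \<le> exp (\<alpha> * s\<^sup>2)" using exp_ge_add_one_self[of "\<alpha> * s\<^sup>2"] by linarith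
    then show ?thesis using \<alpha>pos by (simp add: field_simps)
  qed
  have lin: "s \<le> (1 + 1 / d) * exp (d * s\<^sup>2)" for s
  proof -
    have "s \<le> 1 + s\<^sup>2"
      using zero_le_power2[of "s - 1"] zero_le_power2[of s] unfolding power2_diff by (simp, linarith)
    moreover have "d * s\<^sup>2 \<le> exp (d * s\<^sup>2)" "1 \<le> exp (d * s\<^sup>2)"
      using exp_ge_add_one_self[of "d * s\<^sup>2"] d by (linarith, simp)
    then have "s\<^sup>2 \<le> (1 / d) * exp (d * s\<^sup>2)" using d by (simp add: field_simps)
    ultimately show ?thesis using \<open>1 \<le> exp (d * s\<^sup>2)\<close> unfolding distrib_right by linarith
  qed
  show ?thesis
  proof
    show "0 \<le> C / \<alpha> + (1 + 1 / d)" using C \<alpha>pos d by simp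
    fix s
    have pos: "0 \<le> (1 + 1 / d) * exp (\<alpha> * s\<^sup>2)" "0 \<le> C / \<alpha> * exp (\<alpha> * s\<^sup>2)" using C \<alpha>pos d by auto
    show "f s * s \<le> (C / \<alpha> + (1 + 1 / d)) * exp (\<alpha> * s\<^sup>2)"
    proof (cases "s \<le> R \<or> s \<le> 0")
      case True
      have "f s * s \<le> C * s\<^sup>2"
        using True C by (cases "s \<le> 0") (auto simp: f_nonpos)
      also have "\<dots> \<le> C * ((1 / \<alpha>) * exp (\<alpha> * s\<^sup>2))" by (intro mult_left_mono sq C)
      finally show ?thesis using pos by (simp add: distrib_right)
    next
      case False
      have "f s \<le> exp (\<alpha>' * s\<^sup>2)" using R[of s] False by (simp add: exp_minus field_simps)
      then have "f s * s \<le> exp (\<alpha>' * s\<^sup>2) * ((1 + 1 / d) * exp (d * s\<^sup>2))"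
        using lin[of s] False f_nonneg[of s] by (intro mult_mono) auto
      also have "\<dots> = (1 + 1 / d) * exp (\<alpha> * s\<^sup>2)"
        by (simp add: d_def exp_add[symmetric] left_diff_distrib)
      finally show ?thesis using pos by (simp add: distrib_right)
    qed
  qed
qed

text \<open>For large s the bound is the hypothesis that F(s) / (f(s) s) tends to 0; for the other
  positive s the linear bound on f makes F quadratic.\<close>

lemma primitive_bound:
  assumes "\<epsilon> > 0"
  obtains C where "C \<ge> 0" "\<And>s. primitive f s \<le> \<epsilon> * (f s * s) + C * s\<^sup>2"
proof -
  have "\<forall>\<^sub>F s in at_top. primitive f s / (f s * s) < \<epsilon>"
    using order_tendstoD(2)[OF F_f assms] .
  then obtain R where R: "\<And>s. R \<le> s \<Longrightarrow> primitive f s / (f s * s) < \<epsilon>"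
    by (auto simp: eventually_at_top_linorder)
  obtain C where C: "C \<ge> 0" "\<And>s. 0 \<le> s \<Longrightarrow> s \<le> R \<Longrightarrow> f s \<le> C * s" using f_linear_bound by blast
  have "primitive f s \<le> \<epsilon> * (f s * s) + C * s\<^sup>2" for s
  proof -
    have nn: "0 \<le> \<epsilon> * (f s * s)" "0 \<le> C * s\<^sup>2" using assms f_mult_nonneg[of s] C by auto
    consider "s \<le> 0" | "0 < s" "s \<le> R" | "0 < s" "R \<le> s" by linarith
    then show ?thesis
    proof cases
      case 1
      then show ?thesis using nn by (simp add: primitive_nonpos)
    next
      case 2
      obtain z where z: "0 < z" "z < s" "primitive f s - primitive f 0 = (s - 0) * f z"
        using MVT2[OF 2(1), of "primitive f" f] primitive_deriv by auto
      have "f z \<le> C * z" using z 2 by (intro C) auto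
      also have "\<dots> \<le> C * s" using z C by (intro mult_left_mono) auto
      finally have "s * f z \<le> s * (C * s)" using 2 by (intro mult_left_mono) auto
      then have "primitive f s \<le> C * s\<^sup>2" using z(3) by (simp add: primitive_0 power2_eq_square mult_ac)
      then show ?thesis using nn by linarith
    next
      case 3
      then have "primitive f s < \<epsilon> * (f s * s)" using R[of s] f_pos[of s] by (simp add: divide_less_eq)
      then show ?thesis using nn by linarith
    qed
  qed
  with C(1) that show ?thesis by blast
qed

text \<open>A subcritical Trudinger-Moser estimate. For radial functions it follows from the logarithmic
  modulus of continuity of the profile, which has the sharp constant.\<close>

lemma radial_Trudinger_Moser:
  assumes K: "K < 4 * pi / \<alpha>0" and \<epsilon>: "\<epsilon> > 0"
  obtains c1 where "c1 > 0"
    "\<And>c u g. 0 < c \<Longrightarrow> c < c1 \<Longrightarrow> u \<in> L2 \<Longrightarrow> g \<in> L2 \<Longrightarrow> weak_gradient u g \<Longrightarrow> radial u \<Longrightarrow>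
       L2_sq u = c\<^sup>2 \<Longrightarrow> L2_sq g \<le> K \<Longrightarrow> (LBINT x. f (u x) * u x) \<le> \<epsilon>"
proof -
  \<comment> \<open>The constant in the squared modulus of the profile. The maximum with 0 admits
    negative K, which occurs when the estimate is applied at a freely chosen level.\<close>
  define \<kappa> where "\<kappa> = max 0 K / (4 * pi)"
  have \<kappa>: "0 \<le> \<kappa>" "\<alpha>0 * \<kappa> < 1" using K alpha0 by (auto simp: \<kappa>_def field_simps max_def)
  \<comment> \<open>The slack \<delta> is spent twice, once to raise \<alpha>0 to \<alpha> and once
    to split the square of a sum; hence the square of 1 + \<delta>.\<close>
  have "((\<lambda>\<delta>. \<alpha>0 * \<kappa> * (1 + \<delta>)\<^sup>2) \<longlongrightarrow> \<alpha>0 * \<kappa> * (1 + 0)\<^sup>2) (at_right 0)" by (intro tendsto_intros)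
  then have "\<forall>\<^sub>F \<delta> in at_right 0. \<alpha>0 * \<kappa> * (1 + \<delta>)\<^sup>2 < 1"
    by (rule order_tendstoD) (use \<kappa> in simp)
  then obtain \<delta> where \<delta>: "\<delta> > 0" "\<alpha>0 * \<kappa> * (1 + \<delta>)\<^sup>2 < 1"
    by (metis (mono_tags, lifting) eventually_at_right_field dense)
  define \<alpha> where "\<alpha> = \<alpha>0 * (1 + \<delta>)"
  define \<beta> where "\<beta> = \<alpha> * ((1 + \<delta>) * \<kappa>)"
  have \<alpha>: "\<alpha> > \<alpha>0" "\<alpha> > 0" using alpha0 \<delta> by (auto simp: \<alpha>_def)
  have \<beta>: "\<beta> < 1" using \<delta>(2) by (simp add: \<beta>_def \<alpha>_def power2_eq_square mult_ac)
  \<comment> \<open>Outside |x|^2 < c the profile is bounded by 1 at some point of [s, 2s], plus its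
    oscillation sqrt(\<kappa> ln 2) over that interval.\<close>
  define R where "R = 1 + sqrt (\<kappa> * ln 2)"
  have R: "R \<ge> 1" using \<kappa> by (simp add: R_def)
  obtain C1 where C1: "C1 \<ge> 0" "\<And>s. s \<le> R \<Longrightarrow> f s * s \<le> C1 * s\<^sup>2" using f_quadratic_bound by blast
  obtain C2 where C2: "C2 \<ge> 0" "\<And>s. f s * s \<le> C2 * exp (\<alpha> * s\<^sup>2)" using f_exp_bound[OF \<alpha>(1)] by blast
  define C3 where "C3 = C2 * exp (\<alpha> * ((1 + 1 / \<delta>) * R\<^sup>2))"
  have C3: "C3 \<ge> 0" using C2 by (simp add: C3_def)
  define M where "M = pi * (C3 / (1 - \<beta>)) + C1"
  have M: "M \<ge> 0" using C1 C3 \<beta> by (simp add: M_def)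
  show ?thesis
  proof
    show "min 1 (\<epsilon> / (M + 1)) > 0" using \<epsilon> M by simp
    fix c u g
    assume c: "0 < c" "c < min 1 (\<epsilon> / (M + 1))" and u: "u \<in> L2" and g: "g \<in> L2"
      and wg: "weak_gradient u g" and rad: "radial u" and uc: "L2_sq u = c\<^sup>2" and gK: "L2_sq g \<le> K"
    obtain W where W[measurable]: "W \<in> borel_measurable borel" and "continuous_on {0<..} W"
      and uW: "AE x in lborel. u x = W ((norm x)\<^sup>2)"
      and increment: "\<And>a b. 0 < a \<Longrightarrow> a \<le> b \<Longrightarrow>
         2 * pi * (W b - W a) = (LBINT x. radial_part g x * indicator {a..<b} ((norm x)\<^sup>2))"
      by (rule radial_representation[OF u g wg rad]) (rule that)
    have [measurable]: "u \<in> borel_measurable borel" using u by (rule L2D)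
    have osc: "\<bar>W b - W a\<bar> \<le> sqrt (\<kappa> * (ln b - ln a))" if "0 < a" "a \<le> b" for a b
    proof -
      have "(W b - W a)\<^sup>2 \<le> L2_sq g * (ln b - ln a) / (4 * pi)"
        by (rule profile_modulus[OF g that increment[OF that]])
      also have "\<dots> \<le> max 0 K * (ln b - ln a) / (4 * pi)"
        using gK that by (intro divide_right_mono mult_right_mono) auto
      finally show ?thesis by (intro real_le_rsqrt) (simp add: \<kappa>_def)
    qed
    have W2u: "(LBINT x. (W ((norm (x::plane))\<^sup>2))\<^sup>2) = c\<^sup>2"
    proof -
      have "(LBINT x. (W ((norm (x::plane))\<^sup>2))\<^sup>2) = (LBINT x. (norm (u x))\<^sup>2)"
        by (rule integral_cong_AE) (use uW in \<open>auto elim: eventually_mono\<close>)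
      then show ?thesis using uc by (simp add: L2_sq_def)
    qed
    have "integrable lborel (\<lambda>x. (W ((norm (x::plane))\<^sup>2))\<^sup>2)"
      by (rule integrable_cong_AE_imp[OF L2D(2)[OF u]]) (use uW in \<open>auto elim: eventually_mono\<close>)
    then have W2i: "set_integrable lborel {0<..} (\<lambda>s. (W s)\<^sup>2)"
      using integrable_norm_sq_iff[of "\<lambda>s. (W s)\<^sup>2"] by simp
    have W2: "pi * (LBINT s:{0<..}. (W s)\<^sup>2) = c\<^sup>2"
      using W2u integral_norm_sq[of "\<lambda>s. (W s)\<^sup>2"] by simp
    \<comment> \<open>If W^2 > 1 held on all of [s, 2s], the mass would satisfy c^2 \<ge> \<pi> s >
      s \<ge> c, contradicting c < 1.\<close>
    have far: "\<bar>W s\<bar> \<le> R" if s: "c \<le> s" for s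
    proof -
      have s0: "0 < s" using c s by simp
      have "\<exists>t\<in>{s..2 * s}. (W t)\<^sup>2 \<le> 1"
      proof (rule ccontr)
        assume "\<not> ?thesis"
        then have big: "\<And>t. t \<in> {s..2 * s} \<Longrightarrow> 1 < (W t)\<^sup>2" by (meson not_le)
        have i: "integrable lborel (indicator {s..2 * s} :: real \<Rightarrow> real)"
          by (rule integrable_real_indicator[OF _ emeasure_compact_finite[OF compact_Icc]]) simp
        have "s = (LBINT t. indicator {s..2 * s} t)" using s0 by simp
        also have "\<dots> \<le> (LBINT s:{0<..}. (W s)\<^sup>2)"
          unfolding set_lebesgue_integral_def using i W2i[unfolded set_integrable_def]
        proof (rule integral_mono)
          fix t show "indicator {s..2 * s} t \<le> indicator {0<..} t *\<^sub>R (W t)\<^sup>2"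
            using big[of t] s0 by (auto simp: indicator_def)
        qed
        finally have "pi * s \<le> c\<^sup>2" using W2 by (metis mult_left_mono pi_ge_zero)
        moreover have "c\<^sup>2 \<le> c * 1" unfolding power2_eq_square using c by (intro mult_left_mono) auto
        moreover have "1 * s < pi * s" using s0 pi_gt3 by (intro mult_strict_right_mono) auto
        ultimately show False using s by linarith
      qed
      then obtain t where t: "s \<le> t" "t \<le> 2 * s" "\<bar>W t\<bar> \<le> 1" by (auto simp: abs_square_le_1)
      have "ln t \<le> ln (2 * s)" using t s0 by (subst ln_le_cancel_iff) auto
      then have "ln t - ln s \<le> ln 2" using s0 by (simp add: ln_mult)
      then have "\<bar>W t - W s\<bar> \<le> sqrt (\<kappa> * ln 2)"
        using osc[OF s0 t(1)] \<kappa>(1) by (meson mult_left_mono order_trans real_sqrt_le_mono)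
      then show ?thesis using t by (simp add: R_def)
    qed
    \<comment> \<open>With l = \<kappa> ln(c/s), the splitting (R + sqrt l)^2 \<le> (1 + 1/\<delta>)
      R^2 + (1 + \<delta>) l turns the exponential of \<alpha> W^2 into a constant times
      (c/s)^\<beta>, and \<beta> < 1 makes this integrable at 0.\<close>
    have near: "f (W s) * W s \<le> C3 * (c powr \<beta> * s powr (- \<beta>))" if s: "0 < s" "s \<le> c" for s
    proof -
      define l where "l = \<kappa> * (ln c - ln s)"
      have l: "l \<ge> 0" using \<kappa> s c by (simp add: l_def)
      have "\<bar>W s\<bar> \<le> R + sqrt l"
        using osc[OF s] far[of c] by (simp add: l_def)
      then have "(W s)\<^sup>2 \<le> (R + sqrt l)\<^sup>2" using R l by (intro power2_le_iff_abs_le[THEN iffD2]) auto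
      also have "\<dots> \<le> (1 + 1 / \<delta>) * R\<^sup>2 + (1 + \<delta>) * l"
      proof -
        have "0 \<le> (R / sqrt \<delta> - sqrt \<delta> * sqrt l)\<^sup>2" by simp
        also have "\<dots> = (1 / \<delta>) * R\<^sup>2 + \<delta> * l - 2 * R * sqrt l"
          using \<delta>(1) l by (simp add: power2_diff power_divide power_mult_distrib)
        finally show ?thesis using l by (simp add: power2_sum algebra_simps)
      qed
      finally have "\<alpha> * (W s)\<^sup>2 \<le> \<alpha> * ((1 + 1 / \<delta>) * R\<^sup>2) + \<alpha> * ((1 + \<delta>) * l)"
        using \<alpha>(2) by (metis distrib_left mult_left_mono less_imp_le)
      also have "\<alpha> * ((1 + \<delta>) * l) = \<beta> * ln c + (- \<beta>) * ln s"
        by (simp add: \<beta>_def l_def algebra_simps)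
      finally have "exp (\<alpha> * (W s)\<^sup>2) \<le> exp (\<alpha> * ((1 + 1 / \<delta>) * R\<^sup>2)) * (c powr \<beta> * s powr (- \<beta>))"
        using s c by (simp add: powr_def exp_add[symmetric])
      then have "C2 * exp (\<alpha> * (W s)\<^sup>2) \<le> C3 * (c powr \<beta> * s powr (- \<beta>))"
        using C2(1) by (simp add: C3_def mult.assoc mult_left_mono)
      then show ?thesis using C2(2)[of "W s"] by linarith
    qed
    define G where "G = (\<lambda>s. (C3 * c powr \<beta>) * (indicator {0..c} s * s powr (- \<beta>)) + C1 * (indicator {0<..} s *\<^sub>R (W s)\<^sup>2))"
    note pw = powr_integral[OF c(1) \<beta>]
    have Gi: "integrable lborel G"
      unfolding G_def using pw W2i
      by (intro Bochner_Integration.integrable_add integrable_mult_right) (auto simp: has_bochner_integral_iff set_integrable_def)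
    have bound: "indicator {0<..} s *\<^sub>R (f (W s) * W s) \<le> G s" for s
    proof -
      have nn: "0 \<le> (C3 * c powr \<beta>) * (indicator {0..c} s * s powr (- \<beta>))" "0 \<le> C1 * (indicator {0<..} s *\<^sub>R (W s)\<^sup>2)"
        using C3 C1 by auto
      consider "s \<le> 0" | "0 < s" "s \<le> c" | "c \<le> s" by linarith
      then show ?thesis
      proof cases
        case 1
        then have "0 \<le> G s" unfolding G_def using nn by linarith
        then show ?thesis using 1 by simp
      next
        case 2
        then show ?thesis using near[OF 2] nn by (simp add: G_def mult.assoc)
      next
        case 3
        have "f (W s) * W s \<le> C1 * (W s)\<^sup>2" using far[OF 3] by (intro C1) auto
        then show ?thesis using 3 c nn by (simp add: G_def)
      qed
    qed
    \<comment> \<open>The integral of (c/s)^\<beta> over (0, c) is c / (1 - \<beta>), linear in c.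
      So the singular region, too, contributes an amount that vanishes with c.\<close>
    have Gint: "integral\<^sup>L lborel G = C3 * c / (1 - \<beta>) + C1 * (LBINT s:{0<..}. (W s)\<^sup>2)"
    proof -
      have "integral\<^sup>L lborel G = (C3 * c powr \<beta>) * (c powr (1 - \<beta>) / (1 - \<beta>)) + C1 * (LBINT s:{0<..}. (W s)\<^sup>2)"
        unfolding G_def set_lebesgue_integral_def using pw W2i
        by (subst Bochner_Integration.integral_add) (auto simp: has_bochner_integral_iff set_integrable_def)
      also have "c powr \<beta> * c powr (1 - \<beta>) = c" using c by (simp add: powr_add[symmetric])
      then have "(C3 * c powr \<beta>) * (c powr (1 - \<beta>) / (1 - \<beta>)) = C3 * c / (1 - \<beta>)"
        by (simp add: mult.assoc)
      finally show ?thesis .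
    qed
    have "(LBINT x. f (u x) * u x) = (LBINT x. f (W ((norm (x::plane))\<^sup>2)) * W ((norm x)\<^sup>2))"
      by (rule integral_cong_AE) (use uW in \<open>auto elim: eventually_mono\<close>)
    also have "\<dots> = pi * (LBINT s. indicator {0<..} s *\<^sub>R (f (W s) * W s))"
      using integral_norm_sq[of "\<lambda>s. f (W s) * W s"] by (simp add: set_lebesgue_integral_def)
    also have "\<dots> \<le> pi * integral\<^sup>L lborel G"
    proof (rule mult_left_mono)
      have "integrable lborel (\<lambda>s. indicator {0<..} s *\<^sub>R (f (W s) * W s))"
        by (rule Bochner_Integration.integrable_bound[OF Gi])
          (use bound f_mult_nonneg in \<open>auto intro!: AE_I2 order_trans[OF _ abs_ge_self]\<close>)
      then show "(LBINT s. indicator {0<..} s *\<^sub>R (f (W s) * W s)) \<le> integral\<^sup>L lborel G"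
        by (rule integral_mono[OF _ Gi bound])
    qed simp
    also have "\<dots> = pi * (C3 / (1 - \<beta>)) * c + C1 * c\<^sup>2"
      unfolding Gint W2[symmetric] by (simp add: distrib_left mult_ac)
    also have "\<dots> \<le> pi * (C3 / (1 - \<beta>)) * c + C1 * c"
      using C1(1) c by (intro add_left_mono mult_left_mono) (auto simp: power2_eq_square mult_le_one)
    also have "\<dots> = M * c" by (simp add: M_def distrib_right)
    also have "\<dots> \<le> (M + 1) * c" using c by simp
    also have "\<dots> \<le> \<epsilon>" using c M by (simp add: field_simps)
    finally show "(LBINT x. f (u x) * u x) \<le> \<epsilon>" .
  qed
qed

end

section \<open>The Pohozaev identity\<close>

lemma isCont_quotient_vanishing:
  fixes \<eta> :: "real \<Rightarrow> real"
  assumes c: "\<And>s. isCont \<eta> s" and "0 < a" and z: "\<And>s. s \<le> a \<Longrightarrow> \<eta> s = 0"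
  shows "isCont (\<lambda>s. \<eta> s / (2 * s)) s"
proof (cases "s < a")
  case True
  have "\<forall>\<^sub>F t in nhds s. \<eta> t / (2 * t) = 0"
    unfolding eventually_nhds using True z by (intro exI[of _ "{..<a}"]) auto
  then show ?thesis by (subst isCont_cong[where g = "\<lambda>_. 0"]) auto
next
  case False
  then show ?thesis using assms by (intro continuous_intros) auto
qed

lemma C1c_radial:
  assumes d: "\<And>s. (\<psi> has_real_derivative \<theta> s) (at s)" and c: "continuous_on UNIV \<theta>"
    and z: "\<And>s. b \<le> s \<Longrightarrow> \<psi> s = 0"
  shows "C1c (\<lambda>x. \<psi> ((norm x)\<^sup>2))"
    and "pderiv_at i (\<lambda>x. \<psi> ((norm x)\<^sup>2)) x = \<theta> ((norm x)\<^sup>2) * (2 * x $ i)"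
proof -
  have D: "((\<lambda>x. \<psi> ((norm x)\<^sup>2)) has_derivative (\<lambda>h. \<theta> ((norm x)\<^sup>2) * (2 * (x \<bullet> h)))) (at x)" for x :: plane
  proof -
    show ?thesis
      using has_derivative_norm_sq d[unfolded has_field_derivative_def] by (rule has_derivative_compose)
  qed
  have pd: "pderiv_at i (\<lambda>x. \<psi> ((norm x)\<^sup>2)) x = \<theta> ((norm x)\<^sup>2) * (2 * x $ i)" for i x
    unfolding pderiv_at_eq[OF D] by (simp add: inner_axis)
  then show "pderiv_at i (\<lambda>x. \<psi> ((norm x)\<^sup>2)) x = \<theta> ((norm x)\<^sup>2) * (2 * x $ i)" .
  have "continuous_on UNIV (\<lambda>x. \<theta> ((norm x)\<^sup>2) * (2 * x $ i))" for i :: 2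
    by (intro continuous_intros continuous_on_compose2[OF c]) auto
  then have "continuous_on UNIV (pderiv_at i (\<lambda>x. \<psi> ((norm x)\<^sup>2)))" for i
    by (simp add: pd[abs_def])
  moreover have "\<psi> ((norm x)\<^sup>2) = 0" if "norm x > max 1 b" for x :: plane
  proof -
    have "b < norm x" "norm x * 1 \<le> norm x * norm x" using that mult_left_mono[of 1 "norm x" "norm x"] by simp_all
    then show ?thesis by (intro z) (simp add: power2_eq_square)
  qed
  ultimately show "C1c (\<lambda>x. \<psi> ((norm x)\<^sup>2))"
    unfolding C1c_def using D differentiableI by blast
qed

text \<open>If |Q| > \<epsilon> throughout the interval, the integral of |Q|/s would be at least
  \<epsilon> times the logarithmic length, and the right end is chosen to make that product |L| +
  1.\<close>

lemma ex_small_if_log_integrable: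
  fixes Q :: "real \<Rightarrow> real"
  assumes c: "continuous_on {0<..} Q"
    and L: "\<And>a b. 0 < a \<Longrightarrow> a \<le> b \<Longrightarrow> (LBINT s. (\<bar>Q s\<bar> / s) * indicator {a..b} s) \<le> L"
    and r: "r > 0" and \<epsilon>: "\<epsilon> > 0"
  shows "\<exists>s\<in>{r..r * exp ((\<bar>L\<bar> + 1) / \<epsilon>)}. \<bar>Q s\<bar> \<le> \<epsilon>"
proof (rule ccontr)
  define t where "t = r * exp ((\<bar>L\<bar> + 1) / \<epsilon>)"
  assume "\<not> ?thesis"
  then have big: "\<And>s. s \<in> {r..t} \<Longrightarrow> \<epsilon> < \<bar>Q s\<bar>" unfolding t_def by (meson not_le)
  have rt: "r \<le> t" using r \<epsilon> by (simp add: t_def)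
  have i: "has_bochner_integral lborel (\<lambda>s. (\<epsilon> / s) * indicator {r..t} s) (\<epsilon> * ln t - \<epsilon> * ln r)"
    using r rt
    by (intro has_bochner_integral_FTC_Icc_real) (auto intro!: derivative_eq_intros continuous_intros)
  have "set_integrable lborel {r..t} (\<lambda>s. \<bar>Q s\<bar> / s)"
    using r by (intro borel_integrable_atLeastAtMost' continuous_intros continuous_on_subset[OF c]) auto
  then have i2: "integrable lborel (\<lambda>s. (\<bar>Q s\<bar> / s) * indicator {r..t} s)"
    by (simp add: set_integrable_def mult.commute)
  have "\<epsilon> * ln t - \<epsilon> * ln r = (LBINT s. (\<epsilon> / s) * indicator {r..t} s)"
    using i by (simp add: has_bochner_integral_iff)
  also have "\<dots> \<le> (LBINT s. (\<bar>Q s\<bar> / s) * indicator {r..t} s)"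
  proof (rule integral_mono)
    fix s show "(\<epsilon> / s) * indicator {r..t} s \<le> (\<bar>Q s\<bar> / s) * indicator {r..t} s"
      using big[of s] r by (cases "s \<in> {r..t}") (auto intro!: divide_right_mono)
  qed (use i i2 in \<open>auto simp: has_bochner_integral_iff\<close>)
  also have "\<dots> \<le> L" by (rule L[OF r rt])
  finally have "\<epsilon> * (ln t - ln r) \<le> L" by (simp add: right_diff_distrib)
  moreover have "ln t - ln r = (\<bar>L\<bar> + 1) / \<epsilon>" using r by (simp add: t_def ln_mult)
  ultimately show False using \<epsilon> by simp
qed

text \<open>Since ds/s has infinite mass at both 0 and infinity, a uniform bound on the integrals of
  |Q|/s forces Q to be small somewhere near each end. The fundamental theorem between such points,
  and integrability of H, give the value 0.\<close>

lemma integral_zero_if_log_integrable: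
  fixes Q H :: "real \<Rightarrow> real"
  assumes Q: "\<And>s. s > 0 \<Longrightarrow> (Q has_real_derivative H s) (at s)"
    and H: "set_integrable lborel {0<..} H" "continuous_on {0<..} H"
    and L: "\<And>a b. 0 < a \<Longrightarrow> a \<le> b \<Longrightarrow> (LBINT s. (\<bar>Q s\<bar> / s) * indicator {a..b} s) \<le> L"
  shows "(LBINT s:{0<..}. H s) = 0"
proof -
  have Qc: "continuous_on {0<..} Q"
    using Q by (intro continuous_at_imp_continuous_on) (auto intro: DERIV_isCont)
  have Hc: "isCont H s" if "s > 0" for s
    using H(2) that by (simp add: continuous_on_eq_continuous_at)
  \<comment> \<open>The ratio of the end points in the search interval. Starting the search at
    1/(n+1) divided by M n keeps the point found below 1/(n+1).\<close>
  define M where "M = (\<lambda>n. exp ((\<bar>L\<bar> + 1) / (1 / real (Suc n))))"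
  have M: "M n > 0" for n by (simp add: M_def)
  have "\<exists>s. 0 < s \<and> s \<le> 1 / real (Suc n) \<and> \<bar>Q s\<bar> \<le> 1 / real (Suc n)" for n
  proof -
    have "\<exists>s\<in>{1 / real (Suc n) / M n..1 / real (Suc n) / M n * M n}. \<bar>Q s\<bar> \<le> 1 / real (Suc n)"
      unfolding M_def by (rule ex_small_if_log_integrable[OF Qc L]) auto
    then obtain s where "1 / real (Suc n) / M n \<le> s" "s \<le> 1 / real (Suc n)" "\<bar>Q s\<bar> \<le> 1 / real (Suc n)"
      using M[of n] by auto
    moreover have "0 < 1 / real (Suc n) / M n" using M[of n] by simp
    ultimately show ?thesis by (meson less_le_trans)
  qed
  then obtain a where a: "\<And>n. 0 < a n" "\<And>n. a n \<le> 1 / real (Suc n)" "\<And>n. \<bar>Q (a n)\<bar> \<le> 1 / real (Suc n)"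
    by metis
  have "\<exists>s\<ge>real (Suc n). \<bar>Q s\<bar> \<le> 1 / real (Suc n)" for n
    using ex_small_if_log_integrable[OF Qc L, of "real (Suc n)" "1 / real (Suc n)"] by auto
  then obtain b where b: "\<And>n. real (Suc n) \<le> b n" "\<And>n. \<bar>Q (b n)\<bar> \<le> 1 / real (Suc n)"
    by metis
  have lim: "(\<lambda>n. 1 / real (Suc n)) \<longlonglongrightarrow> 0" by (rule LIMSEQ_Suc[OF lim_1_over_n])
  have a0: "a \<longlonglongrightarrow> 0"
    by (rule tendsto_sandwich[OF _ _ tendsto_const lim]) (use a in \<open>auto intro!: always_eventually less_imp_le\<close>)
  have Qa: "(\<lambda>n. Q (a n)) \<longlonglongrightarrow> 0"
    by (rule Lim_null_comparison[OF _ lim]) (use a in auto)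
  have Qb: "(\<lambda>n. Q (b n)) \<longlonglongrightarrow> 0"
    by (rule Lim_null_comparison[OF _ lim]) (use b in auto)
  have ab: "a n \<le> b n" for n
  proof -
    have "a n \<le> 1 / real (Suc n)" by (rule a)
    also have "\<dots> \<le> real (Suc n)" by (simp add: field_simps)
    also have "\<dots> \<le> b n" by (rule b)
    finally show ?thesis .
  qed
  have FTC: "(LBINT s. H s * indicator {a n..b n} s) = Q (b n) - Q (a n)" for n
    using a(1)[of n] by (intro integral_FTC_Icc_real[OF ab] Q Hc) auto
  have [measurable]: "(\<lambda>s. H s * indicator {0<..} s) \<in> borel_measurable borel"
    using H(1) by (simp add: set_integrable_def mult.commute borel_measurable_integrable)
  have "(\<lambda>n. LBINT s. H s * indicator {a n..b n} s) \<longlonglongrightarrow> (LBINT s. H s * indicator {0<..} s)"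
  proof (rule integral_dominated_convergence[where w = "\<lambda>s. \<bar>H s * indicator {0<..} s\<bar>"])
    show "integrable lborel (\<lambda>s. \<bar>H s * indicator {0<..} s\<bar>)"
      using H(1) by (simp add: set_integrable_def mult.commute)
    have eq: "H s * indicator {a n..b n} s = (H s * indicator {0<..} s) * indicator {a n..b n} s" for n s
      using a(1)[of n] by (auto simp: indicator_def)
    show "(\<lambda>s. H s * indicator {a n..b n} s) \<in> borel_measurable lborel" for n
      unfolding eq by measurable
    show "AE s in lborel. norm (H s * indicator {a n..b n} s) \<le> \<bar>H s * indicator {0<..} s\<bar>" for n
      unfolding eq by (auto simp: indicator_def)
    show "AE s in lborel. (\<lambda>n. H s * indicator {a n..b n} s) \<longlonglongrightarrow> H s * indicator {0<..} s"
    proof (rule AE_I2)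
      fix s :: real
      show "(\<lambda>n. H s * indicator {a n..b n} s) \<longlonglongrightarrow> H s * indicator {0<..} s"
      proof (cases "s > 0")
        case True
        have "\<forall>\<^sub>F n in sequentially. a n < s" using order_tendstoD(2)[OF a0 True] .
        moreover have "\<forall>\<^sub>F n in sequentially. s < real (Suc n)"
        proof -
          obtain m where "s < real m" using reals_Archimedean2 by blast
          then show ?thesis by (intro eventually_sequentiallyI[of m]) auto
        qed
        ultimately have "\<forall>\<^sub>F n in sequentially. H s * indicator {0<..} s = H s * indicator {a n..b n} s"
        proof eventually_elim
          case (elim n)
          then show ?case using True b(1)[of n] by (simp add: indicator_def)
        qed
        then show ?thesis by (rule Lim_transform_eventually[OF tendsto_const])
      next
        case False
        then have "s \<notin> {a n..b n}" for n using a(1)[of n] by auto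
        then show ?thesis using False by simp
      qed
    qed
  qed measurable
  then have "(\<lambda>n. Q (b n) - Q (a n)) \<longlonglongrightarrow> (LBINT s:{0<..}. H s)"
    by (simp add: FTC set_lebesgue_integral_def mult.commute)
  moreover have "(\<lambda>n. Q (b n) - Q (a n)) \<longlonglongrightarrow> 0 - 0" by (intro tendsto_diff Qa Qb)
  ultimately show ?thesis using LIMSEQ_unique by fastforce
qed

context nonlinearity
begin

text \<open>The weak equation is tested with \<psi>(|x|^2), whose gradient is 2 \<theta>(|x|^2) x.
  An integration by parts on the line then moves the derivative from the antiderivative N to \<psi>,
  so that only \<theta> remains.\<close>

lemma weak_form_radial:
  assumes ws: "weak_solution f lam u" and W[measurable]: "W \<in> borel_measurable borel"
    and Wc: "continuous_on {0<..} W" and uW: "AE x in lborel. u x = W ((norm x)\<^sup>2)"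
    and N: "\<And>s. s > 0 \<Longrightarrow> (N has_real_derivative (f (W s) - lam * W s)) (at s)"
    and d: "\<And>s. (\<psi> has_real_derivative \<theta> s) (at s)" and c: "\<And>s. isCont \<theta> s"
    and a: "0 < a" "a \<le> b" and z: "\<And>s. s \<le> a \<or> b \<le> s \<Longrightarrow> \<psi> s = 0" "\<And>s. s \<le> a \<or> b \<le> s \<Longrightarrow> \<theta> s = 0"
  shows "(LBINT x. radial_part (grad u) x * (2 * (norm x)\<^sup>2 * \<theta> ((norm x)\<^sup>2)))
     = - pi * (LBINT s. N s * \<theta> s)"
proof -
  have u: "u \<in> H1" using ws by (simp add: weak_solution_def)
  have [measurable]: "u \<in> borel_measurable borel" "grad u \<in> borel_measurable borel"
    using u grad_H1(1)[OF u] by (auto intro: L2D simp: H1_def)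
  have thc: "continuous_on A \<theta>" for A using c by (intro continuous_at_imp_continuous_on) auto
  have psc: "continuous_on A \<psi>" for A using d by (intro continuous_at_imp_continuous_on) (auto intro: DERIV_isCont)
  have [measurable]: "\<psi> \<in> borel_measurable borel" "\<theta> \<in> borel_measurable borel"
    using thc psc by (auto intro!: borel_measurable_continuous_onI)
  define \<phi> where "\<phi> = (\<lambda>x::plane. \<psi> ((norm x)\<^sup>2))"
  have \<phi>: "C1c \<phi>" unfolding \<phi>_def by (rule C1c_radial(1)[OF d thc]) (use z in auto)
  have pd: "pderiv_at i \<phi> x = \<theta> ((norm x)\<^sup>2) * (2 * x $ i)" for i x
    unfolding \<phi>_def by (rule C1c_radial(2)[OF d thc]) (use z in auto)
  have [measurable]: "grad \<phi> \<in> borel_measurable borel"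
    using grad_H1(1)[OF C1c_H1[OF \<phi>]] by (rule L2D)
  have pdm[measurable]: "(\<lambda>x. \<chi> i. pderiv_at i \<phi> x) \<in> borel_measurable borel"
    using C1c_grad_L2[OF \<phi>] by (rule L2D)
  have "(LBINT x. grad u x \<bullet> grad \<phi> x) = (LBINT x. grad u x \<bullet> (\<chi> i. pderiv_at i \<phi> x))"
  proof (rule integral_cong_AE)
    show "AE x in lborel. grad u x \<bullet> grad \<phi> x = grad u x \<bullet> (\<chi> i. pderiv_at i \<phi> x)"
      using grad_AE_eq[OF C1c_L2(1)[OF \<phi>] C1c_grad_L2[OF \<phi>] C1c_weak_gradient[OF \<phi>]]
      by eventually_elim simp
  qed measurable
  also have "\<dots> = (LBINT x. radial_part (grad u) x * (2 * (norm x)\<^sup>2 * \<theta> ((norm x)\<^sup>2)))"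
  proof (intro Bochner_Integration.integral_cong refl)
    fix x
    have "grad u x \<bullet> (\<chi> i. pderiv_at i \<phi> x) = 2 * \<theta> ((norm x)\<^sup>2) * (grad u x \<bullet> x)"
      by (simp add: pd inner_vec_def sum_distrib_left mult_ac)
    also have "\<dots> = radial_part (grad u) x * (2 * (norm x)\<^sup>2 * \<theta> ((norm x)\<^sup>2))"
      by (cases "x = 0") (auto simp: radial_part_def)
    finally show "grad u x \<bullet> (\<chi> i. pderiv_at i \<phi> x) = radial_part (grad u) x * (2 * (norm x)\<^sup>2 * \<theta> ((norm x)\<^sup>2))" .
  qed
  finally have g: "(LBINT x. grad u x \<bullet> grad \<phi> x) = (LBINT x. radial_part (grad u) x * (2 * (norm x)\<^sup>2 * \<theta> ((norm x)\<^sup>2)))" .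
  have ex: "(LBINT x. h (u x) * \<phi> x) = pi * (LBINT s. h (W s) * \<psi> s)"
    if [measurable]: "h \<in> borel_measurable borel" for h
  proof -
    have "(LBINT x. h (u x) * \<phi> x) = (LBINT x. h (W ((norm x)\<^sup>2)) * \<psi> ((norm (x::plane))\<^sup>2))"
    proof (rule integral_cong_AE)
      show "AE x in lborel. h (u x) * \<phi> x = h (W ((norm x)\<^sup>2)) * \<psi> ((norm x)\<^sup>2)"
        using uW by eventually_elim (simp add: \<phi>_def)
    qed (simp_all add: \<phi>_def)
    also have "\<dots> = pi * (LBINT s:{0<..}. h (W s) * \<psi> s)"
      by (rule integral_norm_sq[of "\<lambda>s. h (W s) * \<psi> s"]) measurable
    also have "(LBINT s:{0<..}. h (W s) * \<psi> s) = (LBINT s. h (W s) * \<psi> s)"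
      unfolding set_lebesgue_integral_def
      using z(1) a by (intro Bochner_Integration.integral_cong) (auto simp: indicator_def)
    finally show ?thesis .
  qed
  have Wab: "continuous_on {a..b} W" using a by (intro continuous_on_subset[OF Wc]) auto
  have fWab: "continuous_on {a..b} (\<lambda>s. f (W s))" by (rule continuous_on_compose2[OF f_cont Wab]) auto
  have z': "s \<notin> {a..b} \<Longrightarrow> \<psi> s = 0" "s \<notin> {a..b} \<Longrightarrow> \<theta> s = 0" for s using z[of s] by auto
  have Nab: "continuous_on {a..b} N"
    using a by (intro continuous_at_imp_continuous_on ballI DERIV_isCont[OF N]) auto
  have i1: "integrable lborel (\<lambda>s. f (W s) * \<psi> s)" and i2: "integrable lborel (\<lambda>s. W s * \<psi> s)"
    and i3: "integrable lborel (\<lambda>s. N s * \<theta> s)"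
    by (rule integrable_continuous_support[of a b]; auto intro!: continuous_intros Wab fWab Nab thc psc simp: z')+
  have "(LBINT s. f (W s) * \<psi> s) - lam * (LBINT s. W s * \<psi> s) + (LBINT s. N s * \<theta> s)
     = (LBINT s. f (W s) * \<psi> s - lam * (W s * \<psi> s) + N s * \<theta> s)"
    using i1 i2 i3 by simp
  also have "\<dots> = (LBINT s. ((f (W s) - lam * W s) * \<psi> s + \<theta> s * N s) * indicator {a..b} s)"
    using z' by (intro Bochner_Integration.integral_cong refl) (auto simp: indicator_def algebra_simps)
  also have "\<dots> = N b * \<psi> b - N a * \<psi> a"
  proof (rule integral_FTC_Icc_real[OF a(2)])
    fix s assume s: "a \<le> s" "s \<le> b"
    then have "s > 0" using a by simp
    then show "((\<lambda>s. N s * \<psi> s) has_real_derivative (f (W s) - lam * W s) * \<psi> s + \<theta> s * N s) (at s)"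
      by (intro DERIV_mult N d)
    have "isCont W s" using Wc \<open>s > 0\<close> by (simp add: continuous_on_eq_continuous_at)
    then show "isCont (\<lambda>s. (f (W s) - lam * W s) * \<psi> s + \<theta> s * N s) s"
      using DERIV_isCont[OF d] DERIV_isCont[OF N[OF \<open>s > 0\<close>]] c
      by (intro continuous_intros isCont_o2[OF _ isCont_f]) auto
  qed
  also have "\<dots> = 0" using z(1)[of a] z(1)[of b] by simp
  finally have ibp: "(LBINT s. f (W s) * \<psi> s) - lam * (LBINT s. W s * \<psi> s) = - (LBINT s. N s * \<theta> s)" by simp
  have "(LBINT x. grad u x \<bullet> grad \<phi> x) + lam * (LBINT x. u x * \<phi> x) = (LBINT x. f (u x) * \<phi> x)"
    using ws C1c_H1[OF \<phi>] by (simp add: weak_solution_def)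
  then have "(LBINT x. grad u x \<bullet> grad \<phi> x) = pi * ((LBINT s. f (W s) * \<psi> s) - lam * (LBINT s. W s * \<psi> s))"
    using ex[of f] ex[of "\<lambda>s. s"] by (simp add: algebra_simps)
  then show ?thesis unfolding g ibp by simp
qed

text \<open>Compact support of \<psi> forces its derivative \<theta> to have mean 0, so the weak
  form is available only for such \<theta>. Subtracting a multiple of a fixed \<theta>0 of mean 1
  removes the restriction at the price of one unknown constant C. The identity then exhibits the
  radial part of the gradient as a continuous density in s.\<close>

lemma radial_flux:
  assumes ws: "weak_solution f lam u" and W[measurable]: "W \<in> borel_measurable borel"
    and Wc: "continuous_on {0<..} W" and uW: "AE x in lborel. u x = W ((norm x)\<^sup>2)"
    and N: "\<And>s. s > 0 \<Longrightarrow> (N has_real_derivative (f (W s) - lam * W s)) (at s)"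
  obtains C where "\<And>\<eta> a b. (\<And>s. isCont \<eta> s) \<Longrightarrow> 0 < a \<Longrightarrow> a \<le> b \<Longrightarrow> (\<And>s. s \<le> a \<or> b \<le> s \<Longrightarrow> \<eta> s = 0) \<Longrightarrow>
    (LBINT x. radial_part (grad u) x * \<eta> ((norm x)\<^sup>2)) = (LBINT s. (C - pi * N s) * (\<eta> s / (2 * s)))"
proof -
  have u: "u \<in> H1" using ws by (simp add: weak_solution_def)
  define T where "T = (\<lambda>\<eta>. LBINT x. radial_part (grad u) x * \<eta> ((norm x)\<^sup>2))"
  have Ti: "integrable lborel (\<lambda>x. radial_part (grad u) x * \<eta> ((norm x)\<^sup>2))"
    if c: "\<And>s. isCont \<eta> s" and ab: "0 < a" "a \<le> b" and z: "\<And>s. s \<le> a \<or> b \<le> s \<Longrightarrow> \<eta> s = 0" for \<eta> and a b :: real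
  proof -
    have cc: "continuous_on A \<eta>" for A using c by (intro continuous_at_imp_continuous_on) auto
    have "compact (\<eta> ` {a..b})" by (intro compact_continuous_image cc) auto
    then obtain B where B: "\<And>s. s \<in> {a..b} \<Longrightarrow> \<bar>\<eta> s\<bar> \<le> B"
      using compact_imp_bounded[of "\<eta> ` {a..b}"] unfolding bounded_iff real_norm_def by blast
    have "\<bar>\<eta> s\<bar> \<le> B * indicator {a..b} s" for s
      using B[of s] z[of s] by (cases "s \<in> {a..b}") auto
    then show ?thesis
      by (intro radial_part_weighted(1)[OF grad_H1(1)[OF u]] weight_integrable(1)[OF _ ab]
          borel_measurable_continuous_onI cc)
  qed
  have Nc: "isCont N s" if "s > 0" for s using N[OF that] by (rule DERIV_isCont)
  have Ni: "integrable lborel (\<lambda>s. N s * h s)"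
    if "\<And>s. isCont h s" "0 < a" "\<And>s. s \<notin> {a..b} \<Longrightarrow> h s = 0" for h and a b :: real
    using that Nc by (intro integrable_continuous_support[of a b] continuous_on_mult continuous_at_imp_continuous_on) auto
  define I0 where "I0 = (LBINT s. bump 1 1 2 s)"
  have I0: "I0 > 0" unfolding I0_def by (rule integral_bump_pos)
  define \<theta>0 where "\<theta>0 = (\<lambda>s. bump 1 1 2 s / I0)"
  have \<theta>0c: "isCont \<theta>0 s" for s unfolding \<theta>0_def using I0 isCont_bump by (intro continuous_intros) auto
  have \<theta>0z: "s \<le> 1 \<or> 2 \<le> s \<Longrightarrow> \<theta>0 s = 0" for s by (auto simp: \<theta>0_def bump_eq_0)
  define \<eta>0 where "\<eta>0 = (\<lambda>s. 2 * s * \<theta>0 s)"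
  have \<eta>0c: "isCont \<eta>0 s" for s unfolding \<eta>0_def by (intro continuous_intros \<theta>0c)
  define C where "C = T \<eta>0 + pi * (LBINT s. N s * \<theta>0 s)"
  show ?thesis
  proof
    fix \<eta> :: "real \<Rightarrow> real" and a b :: real
    assume c: "\<And>s. isCont \<eta> s" and ab: "0 < a" "a \<le> b" and z: "\<And>s. s \<le> a \<or> b \<le> s \<Longrightarrow> \<eta> s = 0"
    define \<theta>1 where "\<theta>1 = (\<lambda>s. \<eta> s / (2 * s))"
    have \<theta>1c: "isCont \<theta>1 s" for s
      unfolding \<theta>1_def by (rule isCont_quotient_vanishing[OF c ab(1)]) (use z in auto)
    have \<theta>1z: "s \<le> a \<or> b \<le> s \<Longrightarrow> \<theta>1 s = 0" for s by (simp add: \<theta>1_def z)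
    have \<theta>1i: "integrable lborel \<theta>1"
      by (rule integrable_continuous_support[of a b]) (auto intro!: continuous_at_imp_continuous_on \<theta>1c \<theta>1z)
    have N1: "integrable lborel (\<lambda>s. N s * \<theta>1 s)"
      by (rule Ni[OF \<theta>1c ab(1), of b], rule \<theta>1z) auto
    have N0: "integrable lborel (\<lambda>s. N s * \<theta>0 s)"
      by (rule Ni[OF \<theta>0c, of 1 2], simp, rule \<theta>0z) auto
    define J where "J = (LBINT s. \<theta>1 s)"
    define lo hi where "lo = min a 1" and "hi = max b 2"
    have lohi: "0 < lo" "lo \<le> hi" using ab by (auto simp: lo_def hi_def)
    define \<theta> where "\<theta> = (\<lambda>s. \<theta>1 s - J * \<theta>0 s)"
    have \<theta>c: "isCont \<theta> s" for s unfolding \<theta>_def by (intro continuous_intros \<theta>0c \<theta>1c)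
    have \<theta>z: "\<theta> s = 0" if "s \<le> lo \<or> hi \<le> s" for s
      using that by (auto simp: \<theta>_def lo_def hi_def \<theta>0z \<theta>1z)
    have th0: "integrable lborel \<theta>0" "(LBINT s. \<theta>0 s) = 1"
      using integrable_bump I0 by (auto simp: \<theta>0_def I0_def)
    have "(LBINT s. \<theta> s) = 0"
      unfolding \<theta>_def using \<theta>1i th0 by (simp add: J_def)
    then obtain \<psi> where \<psi>: "\<And>s. (\<psi> has_real_derivative \<theta> s) (at s)" "\<And>s. s \<le> lo \<or> hi \<le> s \<Longrightarrow> \<psi> s = 0"
      using mean_zero_primitive[OF \<theta>c lohi(2) \<theta>z] by blast
    have "(LBINT x. radial_part (grad u) x * (2 * (norm x)\<^sup>2 * \<theta> ((norm x)\<^sup>2)))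
       = - pi * (LBINT s. N s * \<theta> s)"
      by (rule weak_form_radial[OF ws W Wc uW N \<psi>(1) \<theta>c lohi \<psi>(2) \<theta>z])
    also have "(\<lambda>x. radial_part (grad u) x * (2 * (norm x)\<^sup>2 * \<theta> ((norm x)\<^sup>2))) =
      (\<lambda>x. radial_part (grad u) x * \<eta> ((norm x)\<^sup>2) - J * (radial_part (grad u) x * \<eta>0 ((norm x)\<^sup>2)))"
    proof
      fix x :: plane
      show "radial_part (grad u) x * (2 * (norm x)\<^sup>2 * \<theta> ((norm x)\<^sup>2)) =
        radial_part (grad u) x * \<eta> ((norm x)\<^sup>2) - J * (radial_part (grad u) x * \<eta>0 ((norm x)\<^sup>2))"
        by (cases "x = 0") (simp_all add: \<theta>_def \<theta>1_def \<eta>0_def algebra_simps radial_part_def)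
    qed
    also have "(LBINT x. radial_part (grad u) x * \<eta> ((norm x)\<^sup>2) - J * (radial_part (grad u) x * \<eta>0 ((norm x)\<^sup>2)))
       = T \<eta> - J * T \<eta>0"
      using Ti[OF c ab z] Ti[OF \<eta>0c, of 1 2] \<theta>0z unfolding T_def \<eta>0_def by simp
    also have "(LBINT s. N s * \<theta> s) = (LBINT s. N s * \<theta>1 s - J * (N s * \<theta>0 s))"
      by (simp add: \<theta>_def algebra_simps)
    also have "\<dots> = (LBINT s. N s * \<theta>1 s) - J * (LBINT s. N s * \<theta>0 s)"
      using N0 N1 by simp
    finally have "T \<eta> = C * J - pi * (LBINT s. N s * \<theta>1 s)"
      by (simp add: C_def algebra_simps)
    also have "\<dots> = (LBINT s. C * \<theta>1 s - pi * (N s * \<theta>1 s))"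
      using \<theta>1i N1 by (simp add: J_def)
    also have "(\<lambda>s. C * \<theta>1 s - pi * (N s * \<theta>1 s)) = (\<lambda>s. (C - pi * N s) * \<theta>1 s)"
      by (simp add: fun_eq_iff algebra_simps)
    finally show "(LBINT x. radial_part (grad u) x * \<eta> ((norm x)\<^sup>2)) = (LBINT s. (C - pi * N s) * (\<eta> s / (2 * s)))"
      by (simp only: T_def \<theta>1_def)
  qed
qed

end

lemma antiderivative_on_pos:
  fixes h :: "real \<Rightarrow> real"
  assumes "\<And>s. s > 0 \<Longrightarrow> isCont h s"
  obtains P where "\<And>s. s > 0 \<Longrightarrow> (P has_real_derivative h s) (at s)"
  using einterval_antiderivative[of 0 "\<infinity>" h] assms
  by (auto simp: has_real_derivative_iff_has_vector_derivative)

context nonlinearity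
begin

text \<open>The flux identity yields a function q playing the part of s W', with q' = (lam W - f(W))
  / 4 in the classical sense; then W' = q/s is classical as well. The candidate primitive Q of H
  satisfies |Q|/s \<le> |H| + 2 q^2/s, and q^2/s is integrable because the Dirichlet integral is
  finite. So the boundary terms disappear and H has integral 0, which is the identity.\<close>

theorem Pohozaev:
  assumes ws: "weak_solution f lam u" and rad: "radial u"
    and Fi: "integrable lborel (\<lambda>x. primitive f (u x))"
  shows "lam * L2_sq u = 2 * (LBINT x. primitive f (u x))"
proof -
  define g where "g = grad u"
  have u: "u \<in> H1" using ws by (simp add: weak_solution_def)
  then have uL: "u \<in> L2" by (simp add: H1_def)
  have g: "g \<in> L2" "weak_gradient u g" using grad_H1[OF u] by (simp_all add: g_def)
  have [measurable]: "u \<in> borel_measurable borel" "g \<in> borel_measurable borel" using uL g by (auto intro: L2D)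
  have [measurable]: "radial_part g \<in> borel_measurable borel" unfolding radial_part_def by measurable
  obtain W where W[measurable]: "W \<in> borel_measurable borel" and Wc: "continuous_on {0<..} W"
    and uW: "AE x in lborel. u x = W ((norm x)\<^sup>2)"
    and increment: "\<And>a b. 0 < a \<Longrightarrow> a \<le> b \<Longrightarrow>
       2 * pi * (W b - W a) = (LBINT x. radial_part g x * indicator {a..<b} ((norm x)\<^sup>2))"
    by (rule radial_representation[OF uL g rad]) (rule that)
  have Wi: "isCont W s" if "s > 0" for s using Wc that by (simp add: continuous_on_eq_continuous_at)
  obtain N where N: "\<And>s. s > 0 \<Longrightarrow> (N has_real_derivative (f (W s) - lam * W s)) (at s)"
    by (rule antiderivative_on_pos[of "\<lambda>s. f (W s) - lam * W s"])
      (auto intro!: continuous_intros Wi isCont_o2[OF _ isCont_f])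
  obtain C where C: "\<forall>\<eta> a b. (\<forall>s. isCont \<eta> s) \<longrightarrow> 0 < a \<longrightarrow> a \<le> b \<longrightarrow> (\<forall>s. s \<le> a \<or> b \<le> s \<longrightarrow> \<eta> s = 0) \<longrightarrow>
    (LBINT x. radial_part (grad u) x * \<eta> ((norm x)\<^sup>2)) = (LBINT s. (C - pi * N s) * (\<eta> s / (2 * s)))"
    by (rule radial_flux[OF ws W Wc uW N], assumption, rule that) blast
  \<comment> \<open>Scaled so that the density of the radial part is 2\<pi> q/s. For smooth W this
    density is 2\<pi> W', whence q = s W'.\<close>
  define q where "q = (\<lambda>s. (C - pi * N s) / (4 * pi))"
  have flux: "(LBINT x. radial_part g x * \<eta> ((norm x)\<^sup>2)) = (LBINT s. 2 * pi * q s / s * \<eta> s)"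
    if "\<And>s. isCont \<eta> s" "0 < a" "a \<le> b" "\<And>s. s \<le> a \<or> b \<le> s \<Longrightarrow> \<eta> s = 0" for \<eta> a b
  proof -
    have "(C - pi * N s) * (\<eta> s / (2 * s)) = 2 * pi * q s / s * \<eta> s" for s
      by (cases "s = 0") (simp_all add: q_def field_simps)
    then show ?thesis using C[rule_format, of \<eta> a b] that by (simp add: g_def)
  qed
  have q': "(q has_real_derivative (lam * W s - f (W s)) / 4) (at s)" if "s > 0" for s
  proof -
    have "q = (\<lambda>s. C / (4 * pi) - (1 / 4) * N s)" by (simp add: q_def fun_eq_iff diff_divide_distrib)
    then show ?thesis
      using DERIV_diff[OF DERIV_const DERIV_cmult[OF N[OF that]], of "C / (4 * pi)" "1 / 4"]
      by (simp add: diff_divide_distrib)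
  qed
  have qc: "isCont q s" if "s > 0" for s using q'[OF that] by (rule DERIV_isCont)
  have b_le: "bump n a b s \<le> indicator {a..<b} s" "bump n a b s \<le> indicator {a..b} s" for n s and a b :: real
    by (rule order_trans[OF bump_le]; auto simp: indicator_def)+
  have b_lim: "(\<lambda>n. LBINT s. h s * bump n a b s) \<longlonglongrightarrow> (LBINT s. h s * indicator {a..b} s)"
    if "\<And>s. s > 0 \<Longrightarrow> isCont h s" "0 < a" for h and a b :: real
    using that by (intro integral_mult_bump_tendsto borel_integrable_atLeastAtMost' continuous_at_imp_continuous_on) auto
  \<comment> \<open>The increment formula involves an indicator while the flux identity requires a
    continuous function. Bumps are admissible and converge to the indicator on both sides.\<close>
  have Wdiff: "2 * pi * (W b - W a) = (LBINT s. 2 * pi * q s / s * indicator {a..b} s)"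
    if ab: "0 < a" "a \<le> b" for a b
  proof (rule LIMSEQ_unique)
    show "(\<lambda>n. LBINT s. 2 * pi * q s / s * bump n a b s) \<longlonglongrightarrow> (LBINT s. 2 * pi * q s / s * indicator {a..b} s)"
      by (rule b_lim[OF _ ab(1)]) (auto intro!: continuous_intros qc)
    have ib: "\<bar>indicator {a..<b} s\<bar> \<le> (1::real) * indicator {a..b} s" for s :: real by (auto simp: indicator_def)
    have ri: "integrable lborel (\<lambda>x. radial_part g x * indicator {a..<b} ((norm x)\<^sup>2))"
      by (rule radial_part_weighted(1)[OF g(1) _ weight_integrable(1)[OF _ ab ib]]) auto
    have "(\<lambda>n. LBINT x. radial_part g x * bump n a b ((norm x)\<^sup>2))
       \<longlonglongrightarrow> (LBINT x. radial_part g x * indicator {a..<b} ((norm x)\<^sup>2))"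
    proof (rule integral_dominated_convergence[where w = "\<lambda>x. \<bar>radial_part g x * indicator {a..<b} ((norm x)\<^sup>2)\<bar>"])
      show "integrable lborel (\<lambda>x. \<bar>radial_part g x * indicator {a..<b} ((norm x)\<^sup>2)\<bar>)" using ri by simp
      have "AE s in lborel. s > 0 \<longrightarrow> s \<noteq> a" using AE_lborel_singleton[of a] by eventually_elim simp
      then have "AE x in lborel. (norm (x::plane))\<^sup>2 \<noteq> a" by (rule AE_norm_sq[where P = "\<lambda>s. s \<noteq> a"])
      then show "AE x in lborel. (\<lambda>n. radial_part g x * bump n a b ((norm x)\<^sup>2)) \<longlonglongrightarrow> radial_part g x * indicator {a..<b} ((norm x)\<^sup>2)"
      proof eventually_elim
        case (elim x)
        then have "indicator {a..<b} ((norm x)\<^sup>2) = (indicator {a<..<b} ((norm x)\<^sup>2) :: real)" by (auto simp: indicator_def)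
        then show ?case by (auto intro!: tendsto_mult bump_tendsto)
      qed
      show "AE x in lborel. norm (radial_part g x * bump n a b ((norm x)\<^sup>2)) \<le> \<bar>radial_part g x * indicator {a..<b} ((norm x)\<^sup>2)\<bar>" for n
        using b_le(1) bump_nonneg by (auto simp: abs_mult intro!: mult_left_mono)
    qed measurable
    moreover have "(LBINT x. radial_part g x * bump n a b ((norm x)\<^sup>2)) = (LBINT s. 2 * pi * q s / s * bump n a b s)" for n
      by (rule flux[OF isCont_bump ab], rule bump_eq_0) auto
    ultimately show "(\<lambda>n. LBINT s. 2 * pi * q s / s * bump n a b s) \<longlonglongrightarrow> 2 * pi * (W b - W a)"
      by (simp only: increment[OF ab])
  qed
  obtain P where P: "\<And>s. s > 0 \<Longrightarrow> (P has_real_derivative 2 * pi * q s / s) (at s)"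
    by (rule antiderivative_on_pos[of "\<lambda>s. 2 * pi * q s / s"]) (auto intro!: continuous_intros qc)
  have WP': "2 * pi * (W b - W a) = P b - P a" if ab: "0 < a" "a \<le> b" for a b
    unfolding Wdiff[OF ab] using ab qc
    by (intro integral_FTC_Icc_real P) (auto intro!: continuous_intros)
  have WP: "W s = W 1 + (P s - P 1) / (2 * pi)" if "s > 0" for s
    using WP'[of 1 s] WP'[of s 1] that by (cases "1 \<le> s") (auto simp: field_simps)
  have W': "(W has_real_derivative q s / s) (at s)" if "s > 0" for s
  proof (rule has_field_derivative_transform_within_open[where S = "{0<..}"])
    show "((\<lambda>s. W 1 + (P s - P 1) / (2 * pi)) has_real_derivative q s / s) (at s)"
      using that by (auto intro!: derivative_eq_intros P)
  qed (use that WP[symmetric] in simp_all)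
  \<comment> \<open>Testing the flux identity with \<eta> = q times a bump gives 2\<pi> X on the
    left. As the square of a bump is at most the bump, the right side is at most the square root of
    \<pi> X times the Dirichlet integral; cancelling X gives a bound independent of n, a and
    b.\<close>
  have q2: "(LBINT s. (q s)\<^sup>2 / s * indicator {a..b} s) \<le> L2_sq g / (4 * pi)" if ab: "0 < a" "a \<le> b" for a b
  proof (rule LIMSEQ_le_const2)
    show "(\<lambda>n. LBINT s. (q s)\<^sup>2 / s * bump n a b s) \<longlonglongrightarrow> (LBINT s. (q s)\<^sup>2 / s * indicator {a..b} s)"
      by (rule b_lim[OF _ ab(1)]) (auto intro!: continuous_intros qc)
    have "(LBINT s. (q s)\<^sup>2 / s * bump n a b s) \<le> L2_sq g / (4 * pi)" for n
    proof -
      define X where "X = (LBINT s. (q s)\<^sup>2 / s * bump n a b s)"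
      define \<eta> where "\<eta> = (\<lambda>s. q s * bump n a b s)"
      have \<eta>z: "s \<le> a \<or> b \<le> s \<Longrightarrow> \<eta> s = 0" for s by (auto simp: \<eta>_def bump_eq_0)
      have \<eta>c: "isCont \<eta> s" for s
      proof (cases "s > 0")
        case True
        then show ?thesis unfolding \<eta>_def by (intro continuous_mult qc isCont_bump)
      next
        case False
        have "\<forall>\<^sub>F t in nhds s. \<eta> t = 0"
          unfolding eventually_nhds using False ab \<eta>z by (intro exI[of _ "{..<a}"]) auto
        then show ?thesis by (subst isCont_cong[where g = "\<lambda>_. 0"]) auto
      qed
      have \<eta>cc: "continuous_on A \<eta>" for A using \<eta>c by (intro continuous_at_imp_continuous_on) auto
      have "compact (\<eta> ` {a..b})" by (intro compact_continuous_image \<eta>cc) auto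
      then obtain B where B: "\<And>s. s \<in> {a..b} \<Longrightarrow> \<bar>\<eta> s\<bar> \<le> B"
        using compact_imp_bounded[of "\<eta> ` {a..b}"] unfolding bounded_iff real_norm_def by blast
      have \<eta>B: "\<bar>\<eta> s\<bar> \<le> B * indicator {a..b} s" for s
        using B[of s] \<eta>z[of s] by (cases "s \<in> {a..b}") auto
      have \<eta>m: "\<eta> \<in> borel_measurable borel" by (rule borel_measurable_continuous_onI[OF \<eta>cc])
      note wi = weight_integrable(1)[OF \<eta>m ab \<eta>B]
      have "continuous_on {a..b} (\<lambda>s. (q s)\<^sup>2 / s * bump n a b s)"
        using ab by (intro continuous_at_imp_continuous_on ballI continuous_intros qc isCont_bump) auto
      then have Xi: "integrable lborel (\<lambda>s. (q s)\<^sup>2 / s * bump n a b s)"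
        by (rule integrable_continuous_support) (auto simp: bump_eq_0)
      have X0: "X \<ge> 0"
      proof -
        have "0 \<le> (q s)\<^sup>2 / s * bump n a b s" for s
          using bump_nonneg[of n a b s] bump_eq_0[of s a b n] ab by (cases "s > a") auto
        then show ?thesis unfolding X_def by (intro integral_nonneg_AE) auto
      qed
      have "(LBINT x. radial_part g x * \<eta> ((norm x)\<^sup>2)) = (LBINT s. 2 * pi * ((q s)\<^sup>2 / s * bump n a b s))"
        by (subst flux[OF \<eta>c ab \<eta>z]) (auto simp: \<eta>_def power2_eq_square mult_ac)
      then have "(LBINT x. radial_part g x * \<eta> ((norm x)\<^sup>2)) = 2 * pi * X"
        unfolding X_def by (simp only: integral_mult_right_zero)
      then have "(2 * pi * X)\<^sup>2 \<le> L2_sq g * (pi * (LBINT s:{0<..}. (\<eta> s)\<^sup>2 / s))"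
        using radial_part_weighted(2)[OF g(1) \<eta>m wi] by simp
      also have "(LBINT s:{0<..}. (\<eta> s)\<^sup>2 / s) \<le> X"
        unfolding X_def set_lebesgue_integral_def
      proof (rule integral_mono[OF wi[unfolded set_integrable_def] Xi])
        fix s
        have b1: "(bump n a b s)\<^sup>2 \<le> bump n a b s"
          using bump_nonneg[of n a b s] b_le(2)[of n a b s]
          by (cases "s \<in> {a..b}") (auto simp: power2_eq_square mult_left_le bump_eq_0)
        show "indicator {0<..} s *\<^sub>R ((\<eta> s)\<^sup>2 / s) \<le> (q s)\<^sup>2 / s * bump n a b s"
        proof (cases "s > 0")
          case True
          have "(\<eta> s)\<^sup>2 / s = (q s)\<^sup>2 / s * (bump n a b s)\<^sup>2" by (simp add: \<eta>_def power_mult_distrib)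
          also have "\<dots> \<le> (q s)\<^sup>2 / s * bump n a b s" using True b1 by (intro mult_left_mono) auto
          finally show ?thesis using True by simp
        next
          case False
          then show ?thesis using ab by (simp add: bump_eq_0)
        qed
      qed
      finally have "(2 * pi * X)\<^sup>2 \<le> L2_sq g * (pi * X)" by (simp add: mult_left_mono L2_sq_nonneg)
      then have "pi * X * (4 * pi * X) \<le> pi * X * L2_sq g" by (simp add: power2_eq_square mult_ac)
      then have "4 * pi * X \<le> L2_sq g"
        using X0 L2_sq_nonneg[of g] by (cases "X = 0") auto
      then show ?thesis unfolding X_def[symmetric] by (simp add: field_simps)
    qed
    then show "\<exists>m. \<forall>n\<ge>m. (LBINT s. (q s)\<^sup>2 / s * bump n a b s) \<le> L2_sq g / (4 * pi)" by blast
  qed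
  define H where "H = (\<lambda>s. lam / 2 * (W s)\<^sup>2 - primitive f (W s))"
  have [measurable]: "H \<in> borel_measurable borel" unfolding H_def by measurable
  have Hu: "AE x in lborel. lam / 2 * (norm (u x))\<^sup>2 - primitive f (u x) = H ((norm x)\<^sup>2)"
    using uW by eventually_elim (simp add: H_def)
  have Hui: "integrable lborel (\<lambda>x. lam / 2 * (norm (u x))\<^sup>2 - primitive f (u x))"
    using L2D(2)[OF uL] Fi by simp
  have "integrable lborel (\<lambda>x. H ((norm (x::plane))\<^sup>2))"
    by (rule integrable_cong_AE_imp[OF Hui _ Hu]) measurable
  then have Hi: "set_integrable lborel {0<..} H" by (simp add: integrable_norm_sq_iff)
  have Hc: "continuous_on {0<..} H"
    unfolding H_def by (intro continuous_intros Wc continuous_on_compose2[OF continuous_primitive Wc]) auto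
  \<comment> \<open>In the derivative, s H' and 4 q q' both equal (lam W - f(W)) q and cancel,
    leaving H.\<close>
  define Q where "Q = (\<lambda>s. s * H s - 2 * (q s)\<^sup>2)"
  have "(LBINT s:{0<..}. H s) = 0"
  proof (rule integral_zero_if_log_integrable[OF _ Hi Hc])
    fix s :: real assume s: "s > 0"
    have "((\<lambda>s. primitive f (W s)) has_real_derivative f (W s) * (q s / s)) (at s)"
      by (rule DERIV_chain2[OF primitive_deriv W'[OF s]])
    then have "(H has_real_derivative (lam * W s - f (W s)) * (q s / s)) (at s)"
      unfolding H_def by (auto intro!: derivative_eq_intros W'[OF s] simp: algebra_simps)
    then show "(Q has_real_derivative H s) (at s)"
      unfolding Q_def using s by (auto intro!: derivative_eq_intros q'[OF s] simp: algebra_simps diff_divide_distrib)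
  next
    fix a b :: real assume ab: "0 < a" "a \<le> b"
    have HcC: "continuous_on {a..b} H" using ab by (intro continuous_on_subset[OF Hc]) auto
    have qcC: "continuous_on {a..b} q" using ab by (intro continuous_at_imp_continuous_on ballI qc) auto
    have i1: "integrable lborel (\<lambda>s. (\<bar>Q s\<bar> / s) * indicator {a..b} s)"
      and i2: "integrable lborel (\<lambda>s. \<bar>H s\<bar> * indicator {a..b} s)"
      and i3: "integrable lborel (\<lambda>s. (q s)\<^sup>2 / s * indicator {a..b} s)"
    proof -
      have "continuous_on {a..b} (\<lambda>s. \<bar>Q s\<bar> / s)" "continuous_on {a..b} (\<lambda>s. \<bar>H s\<bar>)" "continuous_on {a..b} (\<lambda>s. (q s)\<^sup>2 / s)"
        unfolding Q_def using ab by (auto intro!: continuous_intros HcC qcC)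
      from this[THEN borel_integrable_atLeastAtMost']
      show "integrable lborel (\<lambda>s. (\<bar>Q s\<bar> / s) * indicator {a..b} s)"
        "integrable lborel (\<lambda>s. \<bar>H s\<bar> * indicator {a..b} s)"
        "integrable lborel (\<lambda>s. (q s)\<^sup>2 / s * indicator {a..b} s)"
        by (simp_all add: set_integrable_def mult.commute)
    qed
    have i4: "integrable lborel (\<lambda>s. \<bar>H s\<bar> * indicator {0<..} s)"
      using integrable_abs[OF Hi[unfolded set_integrable_def]] by (simp add: abs_mult mult.commute)
    have "(LBINT s. (\<bar>Q s\<bar> / s) * indicator {a..b} s) \<le> (LBINT s. \<bar>H s\<bar> * indicator {a..b} s + 2 * ((q s)\<^sup>2 / s * indicator {a..b} s))"
    proof (rule integral_mono[OF i1])
      show "integrable lborel (\<lambda>s. \<bar>H s\<bar> * indicator {a..b} s + 2 * ((q s)\<^sup>2 / s * indicator {a..b} s))"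
        by (intro Bochner_Integration.integrable_add integrable_mult_right i2 i3)
      fix s
      show "(\<bar>Q s\<bar> / s) * indicator {a..b} s \<le> \<bar>H s\<bar> * indicator {a..b} s + 2 * ((q s)\<^sup>2 / s * indicator {a..b} s)"
      proof (cases "s \<in> {a..b}")
        case True
        then have s: "s > 0" using ab by simp
        have "\<bar>Q s\<bar> \<le> \<bar>s * H s\<bar> + \<bar>2 * (q s)\<^sup>2\<bar>" unfolding Q_def by (rule abs_triangle_ineq4)
        also have "\<dots> = (\<bar>H s\<bar> + 2 * ((q s)\<^sup>2 / s)) * s" using s by (simp add: abs_mult field_simps)
        finally have "\<bar>Q s\<bar> / s \<le> \<bar>H s\<bar> + 2 * ((q s)\<^sup>2 / s)" using s by (simp add: pos_divide_le_eq)
        then show ?thesis using True by simp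
      qed simp
    qed
    also have "\<dots> = (LBINT s. \<bar>H s\<bar> * indicator {a..b} s) + 2 * (LBINT s. (q s)\<^sup>2 / s * indicator {a..b} s)"
      by (subst Bochner_Integration.integral_add[OF i2 integrable_mult_right[OF i3]]) (simp only: integral_mult_right_zero)
    also have "\<dots> \<le> (LBINT s. \<bar>H s\<bar> * indicator {0<..} s) + 2 * (L2_sq g / (4 * pi))"
      using i2 i4 ab by (intro add_mono integral_mono mult_left_mono q2) (auto simp: indicator_def)
    finally show "(LBINT s. (\<bar>Q s\<bar> / s) * indicator {a..b} s) \<le> (LBINT s. \<bar>H s\<bar> * indicator {0<..} s) + 2 * (L2_sq g / (4 * pi))" .
  qed
  then have "(LBINT x. H ((norm (x::plane))\<^sup>2)) = 0" by (simp add: integral_norm_sq)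
  moreover have "(LBINT x. H ((norm (x::plane))\<^sup>2)) = (LBINT x. lam / 2 * (norm (u x))\<^sup>2 - primitive f (u x))"
    by (rule integral_cong_AE) (use Hu in \<open>auto elim: eventually_mono\<close>)
  moreover have "\<dots> = lam / 2 * L2_sq u - (LBINT x. primitive f (u x))"
    using L2D(2)[OF uL] Fi by (simp add: L2_sq_def)
  ultimately show ?thesis by simp
qed

end

section \<open>The mountain pass level\<close>

text \<open>The gradient is an arbitrary choice of representative, so it is additive only almost
  everywhere; this is enough for the \<open>H1_norm\<close> of a difference to dominate the L2
  distance of the gradients.\<close>

lemma continuous_on_grad_norm_path:
  assumes H: "\<And>t. t \<ge> 0 \<Longrightarrow> \<gamma> t \<in> H1" and \<gamma>: "H1_continuous_path \<gamma>"
  shows "continuous_on {0..} (\<lambda>t. L2_sq (grad (\<gamma> t)))"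
  unfolding continuous_on
proof
  fix t :: real assume "t \<in> {0..}"
  then have t: "t \<ge> 0" by simp
  define h where "h = (\<lambda>s. H1_norm (\<lambda>x. \<gamma> s x - \<gamma> t x))"
  have h: "(h \<longlongrightarrow> 0) (at t within {0..})" using \<gamma> t by (simp add: H1_continuous_path_def h_def)
  have le: "\<bar>L2_sq (grad (\<gamma> s)) - L2_sq (grad (\<gamma> t))\<bar> \<le> 2 * sqrt (L2_sq (grad (\<gamma> t))) * h s + (h s)\<^sup>2"
    if s: "s \<ge> 0" for s
  proof -
    note g = grad_H1(1)[OF H[OF s]] grad_H1(1)[OF H[OF t]]
    have L: "\<gamma> s \<in> L2" "\<gamma> t \<in> L2" using H[OF s] H[OF t] by (simp_all add: H1_def)
    have d: "(\<lambda>x. \<gamma> s x - \<gamma> t x) \<in> H1"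
      using L2_diff[OF L] L2_diff[OF g] weak_gradient_diff[OF H[OF s] H[OF t]] by (auto simp: H1_def)
    define l where "l = L2_sq (\<lambda>x. grad (\<gamma> s) x - grad (\<gamma> t) x)"
    have "AE x in lborel. grad (\<lambda>x. \<gamma> s x - \<gamma> t x) x = grad (\<gamma> s) x - grad (\<gamma> t) x"
      by (rule grad_AE_eq[OF L2_diff[OF L] L2_diff[OF g] weak_gradient_diff[OF H[OF s] H[OF t]]])
    then have "L2_sq (grad (\<lambda>x. \<gamma> s x - \<gamma> t x)) = l"
      unfolding l_def by (intro L2_sq_cong_AE grad_H1(1)[OF d] L2_diff g)
    then have "sqrt l \<le> h s"
      unfolding h_def H1_norm_def using L2_sq_nonneg[of "\<lambda>x. \<gamma> s x - \<gamma> t x"] by simp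
    moreover have "0 \<le> sqrt l" "(sqrt l)\<^sup>2 = l" using L2_sq_nonneg by (simp_all add: l_def)
    ultimately have "l \<le> (h s)\<^sup>2" by (metis power_mono)
    have "\<bar>L2_sq (grad (\<gamma> s)) - L2_sq (grad (\<gamma> t))\<bar> \<le> 2 * sqrt (L2_sq (grad (\<gamma> t))) * sqrt l + l"
      unfolding l_def by (rule L2_sq_perturb[OF g(2) g(1)])
    also have "\<dots> \<le> 2 * sqrt (L2_sq (grad (\<gamma> t))) * h s + (h s)\<^sup>2"
      using \<open>sqrt l \<le> h s\<close> \<open>l \<le> (h s)\<^sup>2\<close> L2_sq_nonneg by (intro add_mono mult_left_mono) auto
    finally show ?thesis .
  qed
  have "((\<lambda>s. 2 * sqrt (L2_sq (grad (\<gamma> t))) * h s + (h s)\<^sup>2) \<longlongrightarrow> 2 * sqrt (L2_sq (grad (\<gamma> t))) * 0 + 0\<^sup>2) (at t within {0..})"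
    by (intro tendsto_intros h)
  then have "((\<lambda>s. 2 * sqrt (L2_sq (grad (\<gamma> t))) * h s + (h s)\<^sup>2) \<longlongrightarrow> 0) (at t within {0..})" by simp
  then have "((\<lambda>s. L2_sq (grad (\<gamma> s)) - L2_sq (grad (\<gamma> t))) \<longlongrightarrow> 0) (at t within {0..})"
    by (rule Lim_null_comparison[rotated]) (use le in \<open>auto simp: eventually_at_filter\<close>)
  then show "((\<lambda>t. L2_sq (grad (\<gamma> t))) \<longlongrightarrow> L2_sq (grad (\<gamma> t))) (at t within {0..})"
    by (simp add: LIM_zero_iff)
qed

text \<open>A path of the mountain pass class starts inside \<open>V\<close> and ends outside, since its final energy
  lies below the infimum over \<open>V\<close>; hence it crosses the boundary.\<close>

lemma mp_level_ge:
  assumes u: "u \<in> V \<rho> c" and m: "ereal (energy f u) = inf_level f \<rho> c" "inf_level f \<rho> c < 0"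
    and \<tau>: "ereal \<tau> < (INF v \<in> bdV \<rho> c. ereal (energy f v))"
  shows "ereal \<tau> \<le> mp_level f \<rho> c u"
  unfolding mp_level_def
proof (rule INF_greatest)
  fix \<gamma> assume "\<gamma> \<in> mp_paths f \<rho> c u"
  then obtain t0 where \<gamma>: "\<And>t. t \<ge> 0 \<Longrightarrow> \<gamma> t \<in> Sr c" "H1_continuous_path \<gamma>" "AE x in lborel. \<gamma> 0 x = u x"
    and t0: "t0 > 0" "\<And>t. t \<ge> t0 \<Longrightarrow> ereal (energy f (\<gamma> t)) < 2 * inf_level f \<rho> c"
    by (auto simp: mp_paths_def)
  have S: "\<gamma> t \<in> S c" if "t \<ge> 0" for t using \<gamma>(1)[OF that] by (simp add: Sr_def)
  then have H: "\<gamma> t \<in> H1" if "t \<ge> 0" for t using that by (simp add: S_def)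
  define D where "D = (\<lambda>t. L2_sq (grad (\<gamma> t)))"
  have uH: "u \<in> H1" "L2_sq (grad u) < \<rho>" using u by (simp_all add: V_def S_def)
  have D0: "D 0 \<le> \<rho>"
    unfolding D_def using L2_sq_grad_cong_AE[OF H[of 0] uH(1) \<gamma>(3)] uH(2) by simp
  have DT: "\<rho> \<le> D t0"
  proof (rule ccontr)
    assume "\<not> ?thesis"
    then have "\<gamma> t0 \<in> V \<rho> c" using S[of t0] t0(1) by (simp add: V_def D_def)
    then have "inf_level f \<rho> c \<le> ereal (energy f (\<gamma> t0))" unfolding inf_level_def by (rule INF_lower)
    moreover have "ereal (energy f (\<gamma> t0)) < 2 * inf_level f \<rho> c" by (rule t0(2)) simp
    \<comment> \<open>The infimum is attained, hence finite, so the doubling takes place among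
      reals; as the value m is negative, 2 m < m.\<close>
    moreover have "2 * inf_level f \<rho> c = ereal (2 * energy f u)" unfolding m(1)[symmetric] by simp
    ultimately show False using m(2) unfolding m(1)[symmetric] by simp
  qed
  have "continuous_on {0..t0} D"
    unfolding D_def by (rule continuous_on_subset[OF continuous_on_grad_norm_path[OF H \<gamma>(2)]]) auto
  then obtain t where t: "0 \<le> t" "D t = \<rho>" using IVT'[of D 0 \<rho> t0] D0 DT t0(1) by auto
  then have "\<gamma> t \<in> bdV \<rho> c" using S[of t] by (simp add: bdV_def D_def)
  then have "(INF v \<in> bdV \<rho> c. ereal (energy f v)) \<le> ereal (energy f (\<gamma> t))" by (rule INF_lower)
  also have "\<dots> \<le> (SUP t \<in> {0..}. ereal (energy f (\<gamma> t)))" using t by (intro SUP_upper) simp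
  finally show "ereal \<tau> \<le> (SUP t \<in> {0..}. ereal (energy f (\<gamma> t)))" using \<tau> by simp
qed

context nonlinearity
begin

text \<open>Testing the equation with u itself gives A + lam c^2 = B, and the Pohozaev identity
  gives lam c^2 = 2 \<Phi>. This eliminates the multiplier, about whose size nothing is
  known.\<close>

lemma critical_point_identities:
  assumes ws: "weak_solution f lam u" and lam: "lam > 0" and u: "u \<in> Sr c" and c: "c > 0"
  defines "\<Phi> \<equiv> LBINT x. primitive f (u x)"
  shows "L2_sq (grad u) = 2 * energy f u + 2 * \<Phi>"
    and "(LBINT x. f (u x) * u x) = 2 * energy f u + 4 * \<Phi>"
    and "0 \<le> \<Phi>"
    and "\<And>\<epsilon> C. (\<And>s. primitive f s \<le> \<epsilon> * (f s * s) + C * s\<^sup>2) \<Longrightarrow>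
      \<Phi> \<le> \<epsilon> * (LBINT x. f (u x) * u x) + C * c\<^sup>2"
proof -
  have uH: "u \<in> H1" and rad: "radial u" and uc: "L2_sq u = c\<^sup>2" using u by (auto simp: Sr_def S_def H1r_def)
  have uL: "u \<in> L2" using uH by (simp add: H1_def)
  have [measurable]: "u \<in> borel_measurable borel" using uL by (rule L2D)
  have u2: "integrable lborel (\<lambda>x. (u x)\<^sup>2)" "(LBINT x. (u x)\<^sup>2) = c\<^sup>2"
    using L2D(2)[OF uL] uc by (simp_all add: L2_sq_def)
  have Nehari: "L2_sq (grad u) + lam * c\<^sup>2 = (LBINT x. f (u x) * u x)"
  proof -
    have "(LBINT x. grad u x \<bullet> grad u x) + lam * (LBINT x. u x * u x) = (LBINT x. f (u x) * u x)"
      using ws uH unfolding weak_solution_def by blast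
    then show ?thesis using u2(2) by (simp add: L2_sq_def power2_norm_eq_inner power2_eq_square[of "u x" for x])
  qed
  \<comment> \<open>Integrability is read off from the equation: otherwise the integral would take
    its default value 0, whereas the tested equation makes it at least lam c^2 > 0.\<close>
  have fi: "integrable lborel (\<lambda>x. f (u x) * u x)"
  proof (rule ccontr)
    assume "\<not> ?thesis"
    then have "(LBINT x. f (u x) * u x) = 0" by (rule not_integrable_integral_eq)
    then have "lam * c\<^sup>2 \<le> 0" using Nehari L2_sq_nonneg[of "grad u"] by linarith
    moreover have "0 < lam * c\<^sup>2" using lam c by simp
    ultimately show False by linarith
  qed
  have bnd: "integrable lborel (\<lambda>x. \<epsilon> * (f (u x) * u x) + C * (u x)\<^sup>2)" for \<epsilon> C using fi u2 by simp
  obtain C1 where C1: "\<And>s. primitive f s \<le> 1 * (f s * s) + C1 * s\<^sup>2" using primitive_bound[of 1] by auto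
  have Fi: "integrable lborel (\<lambda>x. primitive f (u x))"
    by (rule Bochner_Integration.integrable_bound[OF bnd[of 1 C1]])
      (use C1 primitive_nonneg in \<open>auto intro!: AE_I2 order_trans[OF _ abs_ge_self]\<close>)
  have "lam * c\<^sup>2 = 2 * \<Phi>" using Pohozaev[OF ws rad Fi] by (simp add: uc \<Phi>_def)
  moreover have E: "energy f u = L2_sq (grad u) / 2 - \<Phi>" by (simp add: energy_def \<Phi>_def)
  ultimately show "L2_sq (grad u) = 2 * energy f u + 2 * \<Phi>"
    "(LBINT x. f (u x) * u x) = 2 * energy f u + 4 * \<Phi>" using Nehari by simp_all
  show "0 \<le> \<Phi>" unfolding \<Phi>_def by (intro integral_nonneg_AE AE_I2 primitive_nonneg)
  show "\<Phi> \<le> \<epsilon> * (LBINT x. f (u x) * u x) + C * c\<^sup>2"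
    if "\<And>s. primitive f s \<le> \<epsilon> * (f s * s) + C * s\<^sup>2" for \<epsilon> C
  proof -
    have "\<Phi> \<le> (LBINT x. \<epsilon> * (f (u x) * u x) + C * (u x)\<^sup>2)"
      unfolding \<Phi>_def by (rule integral_mono[OF Fi bnd that])
    also have "\<dots> = \<epsilon> * (LBINT x. f (u x) * u x) + C * c\<^sup>2" using fi u2 by simp
    finally show ?thesis .
  qed
qed

end

section \<open>Passage to the limit of vanishing mass\<close>

theorem theorem1p5:
  fixes f :: "real \<Rightarrow> real" and \<alpha>0 c0 \<rho> \<tau>0 :: real
    and u ubar :: "real \<Rightarrow> plane \<Rightarrow> real" and lambar :: "real \<Rightarrow> real"
  assumes f_cont: "continuous_on UNIV f"
    and f_nonpos: "\<And>s. s \<le> 0 \<Longrightarrow> f s = 0"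
    and f_zero: "f 0 = 0"
    and f_pos: "\<And>s. s > 0 \<Longrightarrow> f s > 0"
    and f_origin: "\<exists>p::real. 2 < p \<and> p < 4 \<and>
          0 < Liminf (at_right 0) (\<lambda>s. ereal (f s / s powr (p - 1))) \<and>
          Liminf (at_right 0) (\<lambda>s. ereal (f s / s powr (p - 1)))
            \<le> Limsup (at_right 0) (\<lambda>s. ereal (f s / s powr (p - 1))) \<and>
          Limsup (at_right 0) (\<lambda>s. ereal (f s / s powr (p - 1))) < \<infinity>"
    and alpha0: "\<alpha>0 > 0"
    and f_super: "\<And>\<alpha>. \<alpha> > \<alpha>0 \<Longrightarrow> ((\<lambda>s. f s * exp (- \<alpha> * s\<^sup>2)) \<longlongrightarrow> 0) at_top"
    and f_sub: "\<And>\<alpha>. \<alpha> < \<alpha>0 \<Longrightarrow> filterlim (\<lambda>s. f s * exp (- \<alpha> * s\<^sup>2)) at_top at_top"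
    and F_f: "((\<lambda>s. primitive f s / (f s * s)) \<longlongrightarrow> 0) at_top"
    \<comment> \<open>the fixed constants and the local minimizers\<close>
    and c0: "c0 > 0"
    and rho: "0 < \<rho>" "\<rho> < 4 * pi / \<alpha>0"
    and tau0: "\<tau>0 > 0"
    and geometry: "\<And>c. 0 < c \<Longrightarrow> c < c0 \<Longrightarrow>
          inf_level f \<rho> c < 0 \<and> ereal \<tau>0 < (INF v \<in> bdV \<rho> c. ereal (energy f v))"
    and minimizer: "\<And>c. 0 < c \<Longrightarrow> c < c0 \<Longrightarrow>
          u c \<in> V \<rho> c \<and> ereal (energy f (u c)) = inf_level f \<rho> c \<and>
          (AE x in lborel. u c x > 0) \<and> radially_decreasing (u c) \<and>
          (\<exists>lam > 0. weak_solution f lam (u c)) \<and> normalized_ground_state f c (u c)"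
    \<comment> \<open>the mountain pass type critical points\<close>
    and mountain_pass: "\<And>c. 0 < c \<Longrightarrow> c < c0 \<Longrightarrow>
          ubar c \<in> Sr c \<and> (AE x in lborel. ubar c x > 0) \<and> lambar c > 0 \<and>
          weak_solution f (lambar c) (ubar c) \<and>
          ereal (energy f (ubar c)) = mp_level f \<rho> c (u c) \<and>
          0 < mp_level f \<rho> c (u c) \<and>
          mp_level f \<rho> c (u c) < inf_level f \<rho> c + ereal (2 * pi / \<alpha>0)"
  shows "((\<lambda>c. L2_sq (grad (ubar c))) \<longlongrightarrow> 4 * pi / \<alpha>0) (at_right 0) \<and>
         ((\<lambda>c. LINT x|lborel. f (ubar c x) * ubar c x) \<longlongrightarrow> 4 * pi / \<alpha>0) (at_right 0) \<and>
         ((\<lambda>c. mp_level f \<rho> c (u c)) \<longlongrightarrow> ereal (2 * pi / \<alpha>0)) (at_right 0)"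
proof -
  interpret nonlinearity f \<alpha>0
  proof
    show "\<exists>p>2. Limsup (at_right 0) (\<lambda>s. ereal (f s / s powr (p - 1))) < \<infinity>" using f_origin by blast
  qed (fact f_cont f_nonpos f_pos alpha0 f_super F_f)+
  define E where "E = (\<lambda>c. energy f (ubar c))"
  define \<Phi> where "\<Phi> = (\<lambda>c. LINT x|lborel. primitive f (ubar c x))"
  define A where "A = (\<lambda>c. L2_sq (grad (ubar c)))"
  define B where "B = (\<lambda>c. LINT x|lborel. f (ubar c x) * ubar c x)"
  define l where "l = 2 * pi / \<alpha>0"
  have l: "l > 0" using alpha0 by (simp add: l_def)
  have mp: "mp_level f \<rho> c (u c) = ereal (E c)" if "0 < c" "c < c0" for c
    using mountain_pass[OF that] by (simp add: E_def)
  have E_ge: "\<tau>0 \<le> E c" if c: "0 < c" "c < c0" for c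
  proof -
    have "ereal \<tau>0 \<le> mp_level f \<rho> c (u c)"
      using minimizer[OF c] geometry[OF c] by (intro mp_level_ge) auto
    then show ?thesis by (simp add: mp[OF c])
  qed
  have E_less: "E c < l" if c: "0 < c" "c < c0" for c
  proof -
    have "ereal (E c) < inf_level f \<rho> c + ereal l" using mountain_pass[OF c] mp[OF c] by (simp add: l_def)
    also have "inf_level f \<rho> c = ereal (energy f (u c))" using minimizer[OF c] by simp
    finally have "E c < energy f (u c) + l" by simp
    moreover have "energy f (u c) < 0" using minimizer[OF c] geometry[OF c] by (metis ereal_less(5) zero_ereal_def ereal_less_eq(3) not_le)
    ultimately show ?thesis by simp
  qed
  have A_eq: "A c = 2 * E c + 2 * \<Phi> c" and B_eq: "B c = 2 * E c + 4 * \<Phi> c" and \<Phi>_nonneg: "0 \<le> \<Phi> c"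
    and \<Phi>_le: "\<And>\<epsilon> C. (\<And>s. primitive f s \<le> \<epsilon> * (f s * s) + C * s\<^sup>2) \<Longrightarrow> \<Phi> c \<le> \<epsilon> * B c + C * c\<^sup>2"
    if c: "0 < c" "c < c0" for c
    using critical_point_identities[of "lambar c" "ubar c" c] mountain_pass[OF c] c
    unfolding A_def B_def E_def \<Phi>_def by auto
  have near0: "\<forall>\<^sub>F c in at_right 0. 0 < c \<and> c < c0"
    using eventually_at_right_real[OF c0] by eventually_elim auto
  have \<Phi>_small: "\<forall>\<^sub>F c in at_right 0. \<Phi> c \<le> \<eta>" if \<eta>: "\<eta> > 0" for \<eta>
  proof -
    \<comment> \<open>From B = 2 E + 4 \<Phi> and E < l follows B \<le> 2 l + 4 \<epsilon> B + 4 C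
      c^2. The bound 1/8 lets half of B be absorbed, so B \<le> 4 l + 8 C c^2; the other bound makes
      \<epsilon> times 4 l at most \<eta>/2.\<close>
    define \<epsilon> where "\<epsilon> = min (1 / 8) (\<eta> / (8 * l))"
    have \<epsilon>: "0 < \<epsilon>" "\<epsilon> \<le> 1 / 8" "\<epsilon> * (4 * l) \<le> \<eta> / 2"
    proof -
      show "0 < \<epsilon>" "\<epsilon> \<le> 1 / 8" using \<eta> l by (simp_all add: \<epsilon>_def)
      have "\<epsilon> * (4 * l) \<le> \<eta> / (8 * l) * (4 * l)" using l by (intro mult_right_mono) (auto simp: \<epsilon>_def)
      then show "\<epsilon> * (4 * l) \<le> \<eta> / 2" using l by simp
    qed
    obtain C where C: "C \<ge> 0" "\<And>s. primitive f s \<le> \<epsilon> * (f s * s) + C * s\<^sup>2"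
      using primitive_bound[OF \<epsilon>(1)] by blast
    have "((\<lambda>c. 2 * C * c\<^sup>2) \<longlongrightarrow> 2 * C * 0\<^sup>2) (at_right 0)" by (intro tendsto_intros)
    then have "\<forall>\<^sub>F c in at_right 0. 2 * C * c\<^sup>2 < \<eta> / 2"
      by (rule order_tendstoD) (use \<eta> in simp)
    with near0 show ?thesis
    proof eventually_elim
      case (elim c)
      then have c: "0 < c" "c < c0" by auto
      have \<Phi>1: "\<Phi> c \<le> \<epsilon> * B c + C * c\<^sup>2" by (rule \<Phi>_le[OF c C(2)])
      have B0: "0 \<le> B c" using B_eq[OF c] E_ge[OF c] tau0 \<Phi>_nonneg[OF c] by simp
      have "\<epsilon> * B c \<le> 1 / 8 * B c" using \<epsilon>(2) B0 by (rule mult_right_mono)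
      then have "B c \<le> 4 * l + 8 * (C * c\<^sup>2)" using \<Phi>1 B_eq[OF c] E_less[OF c] by linarith
      then have "\<epsilon> * B c \<le> \<epsilon> * (4 * l + 8 * (C * c\<^sup>2))" using \<epsilon>(1) by (intro mult_left_mono) auto
      moreover have "\<epsilon> * (8 * (C * c\<^sup>2)) \<le> 1 / 8 * (8 * (C * c\<^sup>2))"
        using \<epsilon>(2) C(1) by (intro mult_right_mono) auto
      ultimately have "\<epsilon> * B c \<le> \<eta> / 2 + C * c\<^sup>2" using \<epsilon>(3) by (simp add: distrib_left)
      then show ?case using \<Phi>1 elim by simp
    qed
  qed
  have \<Phi>_lim: "(\<Phi> \<longlongrightarrow> 0) (at_right 0)"
  proof (rule order_tendstoI)
    fix a :: real assume "a < 0"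
    show "\<forall>\<^sub>F c in at_right 0. a < \<Phi> c"
      by (rule eventually_mono[OF near0]) (use \<Phi>_nonneg \<open>a < 0\<close> in force)
  next
    fix a :: real assume "0 < a"
    then show "\<forall>\<^sub>F c in at_right 0. \<Phi> c < a"
      using \<Phi>_small[of "a / 2"] by (auto elim: eventually_mono)
  qed
  have E_lim: "(E \<longlongrightarrow> l) (at_right 0)"
  proof (rule order_tendstoI)
    fix a assume "l < a"
    with E_less show "\<forall>\<^sub>F c in at_right 0. E c < a"
      by (intro eventually_mono[OF near0]) force
  next
    fix a assume a: "a < l"
    \<comment> \<open>If E \<le> a and \<Phi> \<le> (l - a)/2, then A = 2 E + 2 \<Phi> \<le> a + l,
      still strictly below 2 l = 4\<pi>/\<alpha>0. This is the subcritical bound passed to the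
      Trudinger-Moser estimate.\<close>
    have "a + l < 4 * pi / \<alpha>0" using a by (simp add: l_def)
    from radial_Trudinger_Moser[OF this tau0] obtain c1 where c1: "c1 > 0"
      "\<And>c v g. 0 < c \<Longrightarrow> c < c1 \<Longrightarrow> v \<in> L2 \<Longrightarrow> g \<in> L2 \<Longrightarrow> weak_gradient v g \<Longrightarrow> radial v \<Longrightarrow>
         L2_sq v = c\<^sup>2 \<Longrightarrow> L2_sq g \<le> a + l \<Longrightarrow> (LINT x|lborel. f (v x) * v x) \<le> \<tau>0"
      by blast
    have "\<forall>\<^sub>F c in at_right 0. c < c1"
      using eventually_at_right_real[OF c1(1)] by eventually_elim auto
    moreover have "\<forall>\<^sub>F c in at_right 0. \<Phi> c \<le> (l - a) / 2" using a by (intro \<Phi>_small) simp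
    ultimately show "\<forall>\<^sub>F c in at_right 0. a < E c" using near0
    proof eventually_elim
      case (elim c)
      then have c: "0 < c" "c < c0" by auto
      show ?case
      proof (rule ccontr)
        assume "\<not> a < E c"
        then have "A c \<le> a + l" using A_eq[OF c] elim by simp
        moreover have S: "ubar c \<in> H1" "radial (ubar c)" "L2_sq (ubar c) = c\<^sup>2"
          using mountain_pass[OF c] by (auto simp: Sr_def S_def H1r_def)
        moreover have "ubar c \<in> L2" using S by (simp add: H1_def)
        ultimately have "B c \<le> \<tau>0"
          unfolding A_def B_def using c elim grad_H1[OF S(1)] by (intro c1(2)[of c "ubar c" "grad (ubar c)"]) auto
        then show False using B_eq[OF c] E_ge[OF c] \<Phi>_nonneg[OF c] tau0 by simp
      qed
    qed
  qed
  have "((\<lambda>c. 2 * E c + 2 * \<Phi> c) \<longlongrightarrow> 2 * l + 2 * 0) (at_right 0)" by (intro tendsto_intros E_lim \<Phi>_lim)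
  then have "(A \<longlongrightarrow> 2 * l + 2 * 0) (at_right 0)"
    by (rule Lim_transform_eventually) (use near0 A_eq in \<open>auto elim!: eventually_mono\<close>)
  moreover have "((\<lambda>c. 2 * E c + 4 * \<Phi> c) \<longlongrightarrow> 2 * l + 4 * 0) (at_right 0)" by (intro tendsto_intros E_lim \<Phi>_lim)
  then have "(B \<longlongrightarrow> 2 * l + 4 * 0) (at_right 0)"
    by (rule Lim_transform_eventually) (use near0 B_eq in \<open>auto elim!: eventually_mono\<close>)
  moreover have "((\<lambda>c. ereal (E c)) \<longlongrightarrow> ereal l) (at_right 0)" by (intro tendsto_intros E_lim)
  then have "((\<lambda>c. mp_level f \<rho> c (u c)) \<longlongrightarrow> ereal l) (at_right 0)"
    by (rule Lim_transform_eventually) (use near0 mp in \<open>auto elim!: eventually_mono\<close>)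
  ultimately show ?thesis by (simp add: A_def B_def l_def)
qed

end
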